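(* Assume (H1)–(H3) (see context). Fix $T>0$. For any $s\in[0,T)$, $v=(v_1,v_2)\in\mathbb{H}$, $f\in\mathcal{B}_b(\mathbb{H})$ and $(x,y)\in\mathbb{H}$, the directional derivative $\nabla_vP^0_{s,T}f(x,y)$ exists and $$(\nabla_vP^0_{s,T}f)(x,y)=\mathbb{E}\Big[f\big((X^0_{s,T},Y^0_{s,T})(x,y)\big)\int_s^T\big\langle\sigma_r^*(\sigma_r\sigma_r^* )^{-1}\Phi^v_{s,T}(r),dW_r\big\rangle\Big].$$
   Context: $\mathbb{H}_1,\mathbb{H}_2,\mathbb{H}_3$ separable Hilbert spaces, $\mathbb{H}=\mathbb{H}_1\times\mathbb{H}_2$; $W$ a cylindrical Brownian motion on $\mathbb{H}_3$; $B\in\mathcal{L}(\mathbb{H}_2;\mathbb{H}_1)$; $\sigma:[0,\infty)\to\mathcal{L}(\mathbb{H}_3;\mathbb{H}_2)$ measurable and locally bounded; for $i=1,2$, $A_i$ is a bounded-above linear operator generating a strongly continuous semigroup $e^{tA_i}$ on $\mathbb{H}_i$. (H1) $\sigma_t\sigma_t^*$ is invertible with $\|(\sigma_t\sigma_t^* )^{-1}\|$ locally bounded in $t$. (H2) $BB^*$ is invertible and $Be^{tA_2}=e^{tA_1}e^{tA_0}B$ for some $A_0\in\mathcal{L}(\mathbb{H}_1;\mathbb{H}_1)$ and all $t\ge0$. (H3) $-A_2$ is self-adjoint with discrete spectrum $0<\lambda_1\le\lambda_2\le\cdots$ (with multiplicity) and $\sum_i\lambda_i^{-(1-\delta)}<\infty$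 for some $\delta\in(0,1)$. For $s\ge0$ and $(x,y)\in\mathbb{H}$, $(X^0_{s,t},Y^0_{s,t})(x,y)$, $t\ge s$, is given by $Y^0_{s,t}=e^{(t-s)A_2}y+\int_s^te^{(t-r)A_2}\sigma_rdW_r$, $X^0_{s,t}=e^{(t-s)A_1}x+\int_s^te^{(t-r)A_1}BY^0_{s,r}dr$, and $P^0_{s,t}f(x,y):=\mathbb{E}f((X^0_{s,t},Y^0_{s,t})(x,y))$ for bounded measurable $f$; $\mathcal{B}_b(\mathbb{H})$ denotes bounded measurable real functions on $\mathbb{H}$. Define $Q_t=\int_0^tr(t-r)e^{rA_0}BB^*e^{rA_0^*}dr$ (invertible for $t>0$), and for $s\in[0,T)$, $v=(v_1,v_2)$, $V^v_{s,T}:=Q_{T-s}^{-1}\big[v_1+\int_s^T\frac{T-r}{T-s}e^{(r-s)A_0}Bv_2\,dr\big]$, $\Phi^v_{s,T}(r):=e^{(r-s)A_2}\Big[\frac{v_2}{T-s}+\frac{d}{dr}\{(r-s)(T-r)B^*e^{(r-s)A_0^*}\}V^v_{s,T}\Big]$. $\nabla_v$ is the directional derivative along $v$. *)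

theory Defs
  imports "HOL-Analysis.Analysis" "HOL-Probability.Probability"
begin

definition op_adj :: "('a::real_inner \<Rightarrow>\<^sub>L 'b::real_inner) \<Rightarrow> ('b \<Rightarrow>\<^sub>L 'a)" where
  "op_adj A = Blinfun (adjoint (blinfun_apply A))"

definition op_pow :: "('a::real_normed_vector \<Rightarrow>\<^sub>L 'a) \<Rightarrow> nat \<Rightarrow> ('a \<Rightarrow>\<^sub>L 'a)" where
  "op_pow A n = (((o\<^sub>L) A) ^^ n) id_blinfun"

definition op_exp :: "('a::banach \<Rightarrow>\<^sub>L 'a) \<Rightarrow> ('a \<Rightarrow>\<^sub>L 'a)" where
  "op_exp A = (\<Sum>n. (1 / fact n) *\<^sub>R op_pow A n)"

definition op_invertible :: "('a::real_normed_vector \<Rightarrow>\<^sub>L 'a) \<Rightarrow> bool" where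
  "op_invertible A \<longleftrightarrow> (\<exists>R. R o\<^sub>L A = id_blinfun \<and> A o\<^sub>L R = id_blinfun)"

definition op_inv :: "('a::real_normed_vector \<Rightarrow>\<^sub>L 'a) \<Rightarrow> ('a \<Rightarrow>\<^sub>L 'a)" where
  "op_inv A = (THE R. R o\<^sub>L A = id_blinfun \<and> A o\<^sub>L R = id_blinfun)"

text \<open>Strongly continuous semigroup and its (infinitesimal) generator, as a graph relation:
  \<open>sg_gen S x y\<close> means \<open>x \<in> D(A)\<close> and \<open>A x = y\<close>.\<close>
definition c0_semigroup :: "(real \<Rightarrow> ('a::real_normed_vector \<Rightarrow>\<^sub>L 'a)) \<Rightarrow> bool" where
  "c0_semigroup S \<longleftrightarrow> S 0 = id_blinfun
     \<and> (\<forall>t u. 0 \<le> t \<longrightarrow> 0 \<le> u \<longrightarrow> S (t + u) = S t o\<^sub>L S u)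
     \<and> (\<forall>x. continuous_on {0..} (\<lambda>t. S t x))"

definition sg_gen :: "(real \<Rightarrow> ('a::real_normed_vector \<Rightarrow>\<^sub>L 'a)) \<Rightarrow> 'a \<Rightarrow> 'a \<Rightarrow> bool" where
  "sg_gen S x y \<longleftrightarrow> ((\<lambda>t. (1 / t) *\<^sub>R (S t x - x)) \<longlongrightarrow> y) (at_right 0)"

definition gen_bounded_above :: "(real \<Rightarrow> ('a::real_inner \<Rightarrow>\<^sub>L 'a)) \<Rightarrow> bool" where
  "gen_bounded_above S \<longleftrightarrow> (\<exists>c. \<forall>x y. sg_gen S x y \<longrightarrow> y \<bullet> x \<le> c * (norm x)\<^sup>2)"

text \<open>\<open>W t h\<close> plays the role of \<open>\<langle>W_t, h\<rangle>\<close>. A cylindrical Brownian motion on \<open>H3\<close>: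
  a centred Gaussian family with covariance \<open>E[W_t h W_s g] = min t s \<langle>h,g\<rangle>\<close>
  (joint laws given by characteristic functions) with continuous paths.\<close>
definition cyl_BM :: "'w measure \<Rightarrow> (real \<Rightarrow> 'c::real_inner \<Rightarrow> 'w \<Rightarrow> real) \<Rightarrow> bool" where
  "cyl_BM M W \<longleftrightarrow> prob_space M
     \<and> (\<forall>t h. W t h \<in> borel_measurable M)
     \<and> (\<forall>h. AE \<omega> in M. continuous_on {0..} (\<lambda>t. W t h \<omega>))
     \<and> (\<forall>ps :: (real \<times> 'c \<times> real) list. (\<forall>(t, h, a) \<in> set ps. 0 \<le> t) \<longrightarrow>
          (\<integral>\<omega>. cis (\<Sum>(t, h, a) \<leftarrow> ps. a * W t h \<omega>) \<partial>M)
          = complex_of_real (exp (- (1/2) * (\<Sum>(t, h, a) \<leftarrow> ps. \<Sum>(t', h', a') \<leftarrow> ps.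
                 a * a' * min t t' * (h \<bullet> h')))))"

definition stepfun :: "(real \<times> real \<times> 'c::real_vector) list \<Rightarrow> real \<Rightarrow> 'c" where
  "stepfun ps r = (\<Sum>(a, b, h) \<leftarrow> ps. if a \<le> r \<and> r < b then h else 0)"

definition stepint :: "(real \<Rightarrow> 'c \<Rightarrow> 'w \<Rightarrow> real) \<Rightarrow> (real \<times> real \<times> 'c) list \<Rightarrow> 'w \<Rightarrow> real" where
  "stepint W ps \<omega> = (\<Sum>(a, b, h) \<leftarrow> ps. W b h \<omega> - W a h \<omega>)"

text \<open>\<open>Z\<close> is (a version of) the Wiener integral \<open>\<int>_0^\<infinity> \<langle>g(r), dW_r\<rangle>\<close> of the deterministic
  \<open>H3\<close>-valued integrand \<open>g\<close>: the \<open>L^2(M)\<close>-limit of the integrals of step functions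
  converging to \<open>g\<close> in \<open>L^2([0,\<infinity>); H3)\<close>.\<close>
definition wiener_int :: "'w measure \<Rightarrow> (real \<Rightarrow> 'c::real_inner \<Rightarrow> 'w \<Rightarrow> real) \<Rightarrow> (real \<Rightarrow> 'c) \<Rightarrow> ('w \<Rightarrow> real) \<Rightarrow> bool" where
  "wiener_int M W g Z \<longleftrightarrow> Z \<in> borel_measurable M \<and>
     (\<exists>ps :: nat \<Rightarrow> (real \<times> real \<times> 'c) list.
        (\<forall>k. \<forall>(a, b, h) \<in> set (ps k). 0 \<le> a \<and> a \<le> b)
      \<and> (\<lambda>k. \<integral>\<^sup>+ r. ennreal ((norm (g r - stepfun (ps k) r))\<^sup>2) \<partial>lborel) \<longlonglongrightarrow> 0
      \<and> (\<lambda>k. \<integral>\<^sup>+ \<omega>. ennreal ((Z \<omega> - stepint W (ps k) \<omega>)\<^sup>2) \<partial>M) \<longlonglongrightarrow> 0)"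

text \<open>\<open>N r\<close> is a jointly measurable version of the stochastic convolution
  \<open>\<int>_s^r e^{(r-u)A_2} \<sigma>_u dW_u\<close> (\<open>H2\<close>-valued), characterised weakly:
  \<open>\<langle>h, N r\<rangle> = \<int>_s^r \<langle>\<sigma>_u^* e^{(r-u)A_2^*} h, dW_u\<rangle>\<close> a.s., for every \<open>h\<close> and \<open>r \<ge> s\<close>.\<close>
definition stoch_conv :: "'w measure \<Rightarrow> (real \<Rightarrow> 'c::real_inner \<Rightarrow> 'w \<Rightarrow> real)
     \<Rightarrow> (real \<Rightarrow> ('b::{real_inner, banach, second_countable_topology} \<Rightarrow>\<^sub>L 'b))
     \<Rightarrow> (real \<Rightarrow> ('c \<Rightarrow>\<^sub>L 'b)) \<Rightarrow> real \<Rightarrow> (real \<Rightarrow> 'w \<Rightarrow> 'b) \<Rightarrow> bool" where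
  "stoch_conv M W S2 \<sigma> s N \<longleftrightarrow>
     (\<lambda>(r, \<omega>). N r \<omega>) \<in> borel_measurable (lborel \<Otimes>\<^sub>M M)
   \<and> (\<forall>r \<ge> s. \<forall>h. \<exists>Z. wiener_int M W
          (\<lambda>u. if u \<in> {s..r} then op_adj (\<sigma> u) (op_adj (S2 (r - u)) h) else 0) Z
        \<and> (AE \<omega> in M. h \<bullet> N r \<omega> = Z \<omega>))"

definition Xsol :: "(real \<Rightarrow> ('a::{real_inner, banach, second_countable_topology} \<Rightarrow>\<^sub>L 'a))
   \<Rightarrow> (real \<Rightarrow> ('b::{real_inner, banach, second_countable_topology} \<Rightarrow>\<^sub>L 'b)) \<Rightarrow> ('b \<Rightarrow>\<^sub>L 'a)
   \<Rightarrow> (real \<Rightarrow> 'w \<Rightarrow> 'b) \<Rightarrow> real \<Rightarrow> real \<Rightarrow> 'a \<times> 'b \<Rightarrow> 'w \<Rightarrow> 'a" where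
  "Xsol S1 S2 B N s t z \<omega> = S1 (t - s) (fst z)
     + (LINT r:{s..t}|lborel. S1 (t - r) (B (S2 (r - s) (snd z) + N r \<omega>)))"

definition Ysol :: "(real \<Rightarrow> ('b::{real_inner, banach, second_countable_topology} \<Rightarrow>\<^sub>L 'b))
   \<Rightarrow> (real \<Rightarrow> 'w \<Rightarrow> 'b) \<Rightarrow> real \<Rightarrow> real \<Rightarrow> 'a \<times> 'b \<Rightarrow> 'w \<Rightarrow> 'b" where
  "Ysol S2 N s t z \<omega> = S2 (t - s) (snd z) + N t \<omega>"

definition P0 :: "'w measure \<Rightarrow> (real \<Rightarrow> ('a::{real_inner, banach, second_countable_topology} \<Rightarrow>\<^sub>L 'a))
   \<Rightarrow> (real \<Rightarrow> ('b::{real_inner, banach, second_countable_topology} \<Rightarrow>\<^sub>L 'b)) \<Rightarrow> ('b \<Rightarrow>\<^sub>L 'a)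
   \<Rightarrow> (real \<Rightarrow> 'w \<Rightarrow> 'b) \<Rightarrow> real \<Rightarrow> real \<Rightarrow> ('a \<times> 'b \<Rightarrow> real) \<Rightarrow> 'a \<times> 'b \<Rightarrow> real" where
  "P0 M S1 S2 B N s t f z = (\<integral>\<omega>. f (Xsol S1 S2 B N s t z \<omega>, Ysol S2 N s t z \<omega>) \<partial>M)"

definition Qop :: "('a::{real_inner, banach} \<Rightarrow>\<^sub>L 'a) \<Rightarrow> ('b::real_inner \<Rightarrow>\<^sub>L 'a) \<Rightarrow> real \<Rightarrow> ('a \<Rightarrow>\<^sub>L 'a)" where
  "Qop A0 B t = integral {0..t} (\<lambda>r. (r * (t - r)) *\<^sub>R
      (op_exp (r *\<^sub>R A0) o\<^sub>L B o\<^sub>L op_adj B o\<^sub>L op_exp (r *\<^sub>R op_adj A0)))"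

definition Vvec :: "('a::{real_inner, banach} \<Rightarrow>\<^sub>L 'a) \<Rightarrow> ('b::real_inner \<Rightarrow>\<^sub>L 'a) \<Rightarrow> real \<Rightarrow> real \<Rightarrow> 'a \<times> 'b \<Rightarrow> 'a" where
  "Vvec A0 B s T v = op_inv (Qop A0 B (T - s))
     (fst v + integral {s..T} (\<lambda>r. ((T - r) / (T - s)) *\<^sub>R op_exp ((r - s) *\<^sub>R A0) (B (snd v))))"

definition Phi :: "(real \<Rightarrow> ('b::{real_inner, banach} \<Rightarrow>\<^sub>L 'b)) \<Rightarrow> ('a::{real_inner, banach} \<Rightarrow>\<^sub>L 'a)
   \<Rightarrow> ('b \<Rightarrow>\<^sub>L 'a) \<Rightarrow> real \<Rightarrow> real \<Rightarrow> 'a \<times> 'b \<Rightarrow> real \<Rightarrow> 'b" where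
  "Phi S2 A0 B s T v r = S2 (r - s) ((1 / (T - s)) *\<^sub>R snd v
     + vector_derivative (\<lambda>u. ((u - s) * (T - u)) *\<^sub>R (op_adj B o\<^sub>L op_exp ((u - s) *\<^sub>R op_adj A0))) (at r)
         (Vvec A0 B s T v))"

end

theory Submission
  imports Defs
begin

text \<open>
  Write \<open>\<xi>\<close> for the noise part \<open>(\<integral>_s^T e^{(T-r)A_1} B N_r dr, N_T)\<close> of the solution at time \<open>T\<close>, where \<open>N\<close> is the
  stochastic convolution. Every \<open>\<langle>k, \<xi>\<rangle>\<close> is a Wiener integral (a stochastic Fubini theorem), hence \<open>\<xi>\<close> is jointly
  Gaussian with \<open>Z = \<integral>_s^T \<langle>\<sigma>_r^* (\<sigma>_r \<sigma>_r^*)^{-1} \<Phi>(r), dW_r\<rangle>\<close>. The function \<open>\<Phi>\<close> is built so that the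
  covariance of \<open>\<xi>\<close> with \<open>Z\<close> is exactly the displacement of the solution at time \<open>T\<close> when the initial
  point moves in direction \<open>v\<close>; this uses \<open>B e^{tA_2} = e^{tA_1} e^{tA_0} B\<close> and the definition of \<open>Q\<close>.
  Shifting a Gaussian vector \<open>\<xi>\<close> by \<open>\<epsilon>\<close> times its covariance with \<open>Z\<close> amounts to the density
  \<open>exp (\<epsilon> Z - \<epsilon>^2 Var(Z) / 2)\<close> (Cameron--Martin), because \<open>\<xi> - Cov(\<xi>, Z) Z / Var(Z)\<close> is independent of \<open>Z\<close>;
  differentiating at \<open>\<epsilon> = 0\<close> gives the formula.
\<close>

section \<open>Adjoints, inverses and exponentials of bounded operators\<close>

text \<open>The stochastic convolution is given only through its inner products, each up to a null
  set, so the argument works with laws and characteristic functions throughout. The form of \<Phi>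
  becomes visible after integration. In the covariance of \<langle>h, N_r\<rangle> with
  \<open>Z\<close> the factors built from \<sigma> cancel, and what remains is h tested against
  e^{(r-s)A_2} c(r), where c is the primitive of the bracket in \<Phi>. One term of c is (r-s)/(T-s)
  v_2: it runs from 0 to v_2 and settles the second component at time T. The other carries the
  factor (r-s)(T-r), so it vanishes at both ends and is free to steer the first component. It
  contributes Q applied to V there, and V is chosen so that this supplies v_1 and the complementary
  weight (T-r)/(T-s) that the first term leaves out. Two obstacles shape the rest. The function
  e^{(T-r)A_1} B N_r must be integrable in r before \<xi> is a vector at all, and the summability of
  the eigenvalues provides this. The case Var(Z) = 0 needs its own argument, because splitting \<xi>
  along Z divides by the variance.\<close>

lemma riesz_representation:
  fixes f :: "'a::{real_inner,banach} \<Rightarrow> real"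
  assumes f: "bounded_linear f"
  shows "\<exists>z. \<forall>x. f x = z \<bullet> x"
proof -
  interpret f: bounded_linear f by (rule f)
  \<comment> \<open>The representing vector is found as the minimiser of this functional: if z
    represents \<open>f\<close>, then \<open>J x\<close> is the squared distance from x to z minus
    the squared norm of z.\<close>
  define J where "J x = x \<bullet> x - 2 * f x" for x
  obtain K where K: "\<And>x. norm (f x) \<le> norm x * K" using f.bounded by blast
  have below: "J x \<ge> - K\<^sup>2" for x
  proof -
    have "f x \<le> norm x * K" using K[of x] by simp
    moreover have "(norm x - K)\<^sup>2 \<ge> 0" by simp
    ultimately show ?thesis
      by (simp add: J_def power2_norm_eq_inner[symmetric] power2_eq_square algebra_simps)
  qed
  then have bdd: "bdd_below (range J)" by (auto intro!: bdd_belowI2)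
  define d where "d = Inf (range J)"
  have dle: "d \<le> J x" for x unfolding d_def by (rule cInf_lower) (auto simp: bdd)
  have "\<exists>x. J x < d + 1 / real (Suc n)" for n
  proof -
    have "Inf (range J) < d + 1 / real (Suc n)" by (simp add: d_def)
    then show ?thesis using bdd by (subst (asm) cInf_less_iff) auto
  qed
  then obtain X where X: "\<And>n. J (X n) < d + 1 / real (Suc n)" by metis
  \<comment> \<open>Parallelogram identity. The midpoint is never below the infimum
    \<open>d\<close>, so two points with nearly minimal values are close to each other; this makes
    minimising sequences Cauchy.\<close>
  have par: "J x + J y = 2 * J ((1/2) *\<^sub>R (x + y)) + (norm (x - y))\<^sup>2 / 2" for x y
    by (simp add: J_def f.scaleR f.add power2_norm_eq_inner inner_simps algebra_simps inner_commute)
       (simp add: field_simps inner_commute)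
  have diff: "(norm (x - y))\<^sup>2 < 4 * a" if "J x < d + a" "J y < d + a" for x y a
    using par[of x y] dle[of "(1/2) *\<^sub>R (x + y)"] that by simp
  have "Cauchy X"
  proof (rule metric_CauchyI)
    fix e :: real assume "e > 0"
    then obtain n0 where n0: "1 / real (Suc n0) < e\<^sup>2 / 4"
      using reals_Archimedean[of "e\<^sup>2/4"] by (auto simp: inverse_eq_divide)
    have "dist (X m) (X n) < e" if "m \<ge> n0" "n \<ge> n0" for m n
    proof -
      have *: "J (X k) < d + 1 / real (Suc n0)" if "k \<ge> n0" for k
      proof -
        have "1 / real (Suc k) \<le> 1 / real (Suc n0)" using that by (intro divide_left_mono) auto
        with X[of k] show ?thesis by simp
      qed
      have "(norm (X m - X n))\<^sup>2 < 4 * (1 / real (Suc n0))" by (rule diff) (use * that in auto)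
      also have "\<dots> < e\<^sup>2" using n0 by simp
      finally show ?thesis unfolding dist_norm by (rule power2_less_imp_less) (use \<open>e > 0\<close> in simp)
    qed
    then show "\<exists>M. \<forall>m\<ge>M. \<forall>n\<ge>M. dist (X m) (X n) < e" by blast
  qed
  then obtain z where z: "X \<longlonglongrightarrow> z" using Cauchy_convergent convergent_def by blast
  have "(\<lambda>n. J (X n)) \<longlonglongrightarrow> J z" unfolding J_def by (intro tendsto_intros f.tendsto z)
  moreover have "(\<lambda>n. d + 1 / real (Suc n)) \<longlonglongrightarrow> d + 0"
    by (intro tendsto_add tendsto_const) (rule LIMSEQ_inverse_real_of_nat[unfolded inverse_eq_divide])
  ultimately have Jz: "J z \<le> d"
    using LIMSEQ_le[of "\<lambda>n. J (X n)" "J z" "\<lambda>n. d + 1 / real (Suc n)" d] X by (auto intro: less_imp_le)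
  have "f h = z \<bullet> h" for h
  proof -
    define c where "c = z \<bullet> h - f h"
    define a where "a = h \<bullet> h"
    have a: "a \<ge> 0" by (simp add: a_def)
    have q: "2 * t * c + t\<^sup>2 * a \<ge> 0" for t
    proof -
      have "J (z + t *\<^sub>R h) \<ge> J z" using Jz dle by (meson order_trans)
      moreover have "J (z + t *\<^sub>R h) = J z + 2 * t * c + t\<^sup>2 * a"
        by (simp add: J_def c_def a_def f.add f.scaleR inner_simps algebra_simps power2_eq_square inner_commute)
      ultimately show ?thesis by simp
    qed
    \<comment> \<open>The optimal t = -c/a fails when h = 0. With b = a + 1 the value at t = -c/b is
      still negative unless c = 0.\<close>
    define b where "b = a + 1"
    have b: "b > 0" "a = b - 1" using a by (auto simp: b_def)
    have "0 \<le> b\<^sup>2 * (2 * (- c / b) * c + (- c / b)\<^sup>2 * a)" using q[of "- c / b"] by (intro mult_nonneg_nonneg) auto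
    also have "\<dots> = - (c\<^sup>2 * (a + 2))" unfolding b(2) using b(1) by (simp add: field_simps power2_eq_square)
    finally have "c\<^sup>2 * (a + 2) \<le> 0" by simp
    then have "c\<^sup>2 \<le> 0"  using a by (simp add: mult_le_0_iff)
    then show ?thesis by (simp add: c_def)
  qed
  then show ?thesis by blast
qed

text \<open>\<open>adjoint\<close> is a Hilbert choice and carries information only once some
  adjoint map exists. On a complete domain the Riesz vector of the functional x \<mapsto>
  \<open>A x \<bullet> y\<close> provides one for each y.\<close>

lemma adjoint_inner:
  fixes A :: "'a::{real_inner,banach} \<Rightarrow>\<^sub>L 'b::real_inner"
  shows "x \<bullet> adjoint (blinfun_apply A) y = blinfun_apply A x \<bullet> y"
proof -
  have "\<exists>z. \<forall>x. blinfun_apply A x \<bullet> y = z \<bullet> x" for y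
    by (rule riesz_representation)
       (intro bounded_linear_intros)
  then obtain f' where "\<forall>x y. blinfun_apply A x \<bullet> y = x \<bullet> f' y"
    by (metis inner_commute)
  then have "\<forall>x y. blinfun_apply A x \<bullet> y = x \<bullet> adjoint (blinfun_apply A) y"
    unfolding adjoint_def by (rule someI[of "\<lambda>f'. \<forall>x y. blinfun_apply A x \<bullet> y = x \<bullet> f' y"])
  then show ?thesis by simp
qed

text \<open>\<open>Blinfun\<close> returns the given map only if it is bounded linear. The bound
  comes from the image z of x: the square of its norm equals \<open>A z \<bullet> x\<close>, which
  is at most \<open>norm A * norm z * norm x\<close>.\<close>

lemma op_adj_apply:
  fixes A :: "'a::{real_inner,banach} \<Rightarrow>\<^sub>L 'b::real_inner"
  shows "blinfun_apply (op_adj A) = adjoint (blinfun_apply A)"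
  unfolding op_adj_def
proof (rule bounded_linear_Blinfun_apply, rule bounded_linear_intro[where K = "norm A"])
  fix x y :: 'b and r :: real
  show "adjoint A (x + y) = adjoint A x + adjoint A y"
    by (rule vector_eq_rdot[THEN iffD1]) (simp add: inner_commute[of _ "_::'a"] adjoint_inner inner_add_right inner_add_left)
  show "adjoint A (r *\<^sub>R x) = r *\<^sub>R adjoint A x"
    by (rule vector_eq_rdot[THEN iffD1]) (simp add: inner_commute[of _ "_::'a"] adjoint_inner)
  let ?z = "adjoint (blinfun_apply A) x"
  have "norm ?z * norm ?z = blinfun_apply A ?z \<bullet> x"
    by (simp add: adjoint_inner[symmetric] flip: power2_norm_eq_inner power2_eq_square)
  also have "\<dots> \<le> norm (blinfun_apply A ?z) * norm x" by (rule norm_cauchy_schwarz)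
  also have "\<dots> \<le> norm A * norm ?z * norm x" by (intro mult_right_mono norm_blinfun) auto
  finally show "norm ?z \<le> norm x * norm A"
    by (cases "norm ?z = 0") (auto simp: mult_ac mult_le_cancel_left_pos)
qed

lemma inner_op_adj:
  fixes A :: "'a::{real_inner,banach} \<Rightarrow>\<^sub>L 'b::real_inner"
  shows "x \<bullet> op_adj A y = A x \<bullet> y"
  by (simp add: op_adj_apply adjoint_inner)

lemma op_adj_inner:
  fixes A :: "'a::{real_inner,banach} \<Rightarrow>\<^sub>L 'b::real_inner"
  shows "op_adj A y \<bullet> x = y \<bullet> A x"
  by (metis inner_op_adj inner_commute)

lemma norm_op_adj_le:
  fixes A :: "'a::{real_inner,banach} \<Rightarrow>\<^sub>L 'b::real_inner"
  shows "norm (op_adj A) \<le> norm A"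
proof (rule norm_blinfun_bound)
  fix x
  let ?z = "op_adj A x"
  have "norm ?z * norm ?z = blinfun_apply A ?z \<bullet> x"
    by (simp add: inner_op_adj[symmetric] flip: power2_norm_eq_inner power2_eq_square)
  also have "\<dots> \<le> norm (blinfun_apply A ?z) * norm x" by (rule norm_cauchy_schwarz)
  also have "\<dots> \<le> norm A * norm ?z * norm x" by (intro mult_right_mono norm_blinfun) auto
  finally show "norm ?z \<le> norm A * norm x"
    by (cases "norm ?z = 0") (auto simp: mult_ac mult_le_cancel_left_pos)
qed simp

lemma op_adj_eqI:
  fixes A :: "'a::{real_inner,banach} \<Rightarrow>\<^sub>L 'b::real_inner" and C :: "'b \<Rightarrow>\<^sub>L 'a"
  assumes "\<And>x y. A x \<bullet> y = x \<bullet> C y"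
  shows "op_adj A = C"
  by (rule blinfun_eqI, rule vector_eq_ldot[THEN iffD1]) (simp add: inner_op_adj assms)

lemma bounded_linear_op_adj:
  "bounded_linear (op_adj :: ('a::{real_inner,banach} \<Rightarrow>\<^sub>L 'b::real_inner) \<Rightarrow> _)"
proof (rule bounded_linear_intro[where K = 1])
  fix A C :: "'a \<Rightarrow>\<^sub>L 'b" and r :: real
  show "op_adj (A + C) = op_adj A + op_adj C"
    by (rule op_adj_eqI) (simp add: blinfun.bilinear_simps inner_simps inner_op_adj)
  show "op_adj (r *\<^sub>R A) = r *\<^sub>R op_adj A"
    by (rule op_adj_eqI) (simp add: blinfun.bilinear_simps inner_simps inner_op_adj)
  show "norm (op_adj A) \<le> norm A * 1" using norm_op_adj_le[of A] by simp
qed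

lemma op_adj_compose:
  fixes A :: "'b::{real_inner,banach} \<Rightarrow>\<^sub>L 'c::real_inner" and C :: "'a::{real_inner,banach} \<Rightarrow>\<^sub>L 'b"
  shows "op_adj (A o\<^sub>L C) = op_adj C o\<^sub>L op_adj A"
  by (rule op_adj_eqI) (simp add: inner_op_adj)

lemma blinfun_compose_assoc: "(A o\<^sub>L C) o\<^sub>L D = A o\<^sub>L (C o\<^sub>L D)"
  by (rule blinfun_eqI) simp

lemma blinfun_compose_id [simp]: "A o\<^sub>L id_blinfun = A" "id_blinfun o\<^sub>L A = A"
  by (rule blinfun_eqI, simp)+

section \<open>Inverses, and invertibility of coercive operators\<close>

lemma op_inv_props:
  assumes "op_invertible A"
  shows "op_inv A o\<^sub>L A = id_blinfun" "A o\<^sub>L op_inv A = id_blinfun"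
proof -
  let ?P = "\<lambda>R. R o\<^sub>L A = id_blinfun \<and> A o\<^sub>L R = id_blinfun"
  obtain R where R: "?P R" using assms by (auto simp: op_invertible_def)
  have uniq: "R' = R" if "?P R'" for R'
  proof -
    have "R' = R' o\<^sub>L (A o\<^sub>L R)" using R by simp
    also have "\<dots> = R" unfolding blinfun_compose_assoc[symmetric] using that by simp
    finally show ?thesis .
  qed
  have "op_inv A = R" unfolding op_inv_def by (rule the_equality, rule R, rule uniq)
  then show "op_inv A o\<^sub>L A = id_blinfun" "A o\<^sub>L op_inv A = id_blinfun" using R by auto
qed

lemma op_inv_apply:
  assumes "op_invertible A"
  shows "op_inv A (A x) = x" "A (op_inv A x) = x"
  by (simp_all add: op_inv_props[OF assms] flip: blinfun_apply_blinfun_compose)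

text \<open>The Lax--Milgram argument: Q x = y is the fixed point equation of x \<mapsto> x - \<rho>
  Q x + \<rho> y, a contraction for small \<rho>. Coercivity also bounds the inverse by 1/c. This is
  what will invert \<open>Qop\<close>.\<close>

lemma op_invertible_coercive:
  fixes Q :: "'a::{real_inner,banach} \<Rightarrow>\<^sub>L 'a"
  assumes c: "c > 0" and Q: "\<And>x. c * (norm x)\<^sup>2 \<le> Q x \<bullet> x"
  shows "op_invertible Q"
proof -
  \<comment> \<open>A bound for the norm of \<open>Q\<close>, enlarged by c so that it is positive
    and at least c; then \<open>\<rho> * c \<le> 1\<close> below and the square root defining
    \<open>q\<close> makes sense.\<close>
  define K where "K = norm Q + c"
  have K: "K > 0" "c \<le> K" using c by (auto simp: K_def add_nonneg_pos)
  \<comment> \<open>The minimiser of 1 - 2 \<rho> c + \<rho>^2 K^2, which bounds the squared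
    contraction factor; the minimal value is 1 - \<rho> c.\<close>
  define \<rho> where "\<rho> = c / K\<^sup>2"
  have \<rho>: "\<rho> > 0" using c K by (simp add: \<rho>_def)
  define q where "q = sqrt (1 - \<rho> * c)"
  have "c * c \<le> K * K" using K c by (intro mult_mono) auto
  then have rc: "\<rho> * c \<le> 1" "\<rho> * c > 0" using K c by (auto simp: \<rho>_def power2_eq_square field_simps)
  have q: "0 \<le> q" "q < 1" using rc by (auto simp: q_def)
  have contr: "norm (x - \<rho> *\<^sub>R Q x) \<le> q * norm x" for x
  proof -
    have 1: "norm (Q x) \<le> K * norm x"
      by (rule order_trans[OF norm_blinfun]) (use c in \<open>auto simp: K_def intro!: mult_right_mono\<close>)
    have "(norm (x - \<rho> *\<^sub>R Q x))\<^sup>2 = (norm x)\<^sup>2 - 2 * \<rho> * (Q x \<bullet> x) + \<rho>\<^sup>2 * (norm (Q x))\<^sup>2"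
      unfolding power2_norm_eq_inner by (simp add: inner_simps algebra_simps power2_eq_square inner_commute)
    also have "\<dots> \<le> (norm x)\<^sup>2 - 2 * \<rho> * (c * (norm x)\<^sup>2) + \<rho>\<^sup>2 * (K * norm x)\<^sup>2"
      using \<rho> 1 Q[of x] by (intro add_mono diff_mono mult_left_mono power_mono) auto
    also have "\<rho>\<^sup>2 * (K * norm x)\<^sup>2 = \<rho> * c * (norm x)\<^sup>2"
      using K by (simp add: \<rho>_def power2_eq_square)
    also have "(norm x)\<^sup>2 - 2 * \<rho> * (c * (norm x)\<^sup>2) + \<rho> * c * (norm x)\<^sup>2 = (q * norm x)\<^sup>2"
      using rc by (simp add: q_def power_mult_distrib algebra_simps)
    finally show ?thesis by (rule power2_le_imp_le) (use q in auto)
  qed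
  have surj: "\<exists>x. Q x = y" for y
  proof -
    have "\<exists>!x. (x - \<rho> *\<^sub>R Q x) + \<rho> *\<^sub>R y = x"
    proof (rule banach_fix_type[OF q], intro allI)
      fix a b :: 'a
      have "dist (a - \<rho> *\<^sub>R Q a + \<rho> *\<^sub>R y) (b - \<rho> *\<^sub>R Q b + \<rho> *\<^sub>R y) = norm ((a - b) - \<rho> *\<^sub>R Q (a - b))"
        by (simp add: dist_norm blinfun.diff_right algebra_simps)
      also have "\<dots> \<le> q * dist a b" using contr[of "a - b"] by (simp add: dist_norm)
      finally show "dist (a - \<rho> *\<^sub>R Q a + \<rho> *\<^sub>R y) (b - \<rho> *\<^sub>R Q b + \<rho> *\<^sub>R y) \<le> q * dist a b" .
    qed
    then obtain x where "(x - \<rho> *\<^sub>R Q x) + \<rho> *\<^sub>R y = x" by blast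
    then have "\<rho> *\<^sub>R y = \<rho> *\<^sub>R Q x" by (simp add: algebra_simps)
    then have "y = Q x" using \<rho> by (metis less_irrefl scaleR_cancel_left)
    then show ?thesis by blast
  qed
  have lb: "c * norm x \<le> norm (Q x)" for x
  proof (cases "x = 0")
    case False
    have "c * norm x * norm x \<le> norm (Q x) * norm x"
      using Q[of x] norm_cauchy_schwarz[of "Q x" x] by (simp add: power2_eq_square mult.assoc)
    then show ?thesis using False by simp
  qed auto
  have inj: "Q a = Q b \<Longrightarrow> a = b" for a b
    using lb[of "a - b"] c by (simp add: blinfun.diff_right mult_le_0_iff)
  define g where "g y = (THE x. Q x = y)" for y
  have Qg: "Q (g y) = y" for y
    unfolding g_def by (rule theI') (use surj[of y] inj in blast)
  have gQ: "g (Q x) = x" for x by (rule inj) (rule Qg)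
  have "bounded_linear g"
  proof (rule bounded_linear_intro[where K = "1 / c"])
    fix x y :: 'a and r :: real
    show "g (x + y) = g x + g y" by (rule inj) (simp add: Qg blinfun.add_right)
    show "g (r *\<^sub>R x) = r *\<^sub>R g x" by (rule inj) (simp add: Qg blinfun.scaleR_right)
    show "norm (g x) \<le> norm x * (1 / c)" using lb[of "g x"] c by (simp add: Qg field_simps)
  qed
  then have "blinfun_apply (Blinfun g) = g" by (rule bounded_linear_Blinfun_apply)
  then show ?thesis unfolding op_invertible_def
    by (intro exI[of _ "Blinfun g"] conjI blinfun_eqI) (simp_all add: Qg gQ)
qed

section \<open>The exponential series of a bounded operator\<close>

lemma op_pow_0 [simp]: "op_pow A 0 = id_blinfun" and op_pow_Suc: "op_pow A (Suc n) = A o\<^sub>L op_pow A n"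
  by (simp_all add: op_pow_def)

lemma op_pow_Suc2: "op_pow A (Suc n) = op_pow A n o\<^sub>L A"
  by (induction n) (simp_all add: op_pow_Suc flip: blinfun_compose_assoc)

lemma norm_op_pow_le: "norm (op_pow A n) \<le> norm A ^ n"
proof (induction n)
  case 0
  then show ?case by (simp add: norm_blinfun_id_le)
next
  case (Suc n)
  have "norm (op_pow A (Suc n)) \<le> norm A * norm (op_pow A n)"
    by (simp add: op_pow_Suc norm_blinfun_compose)
  also have "\<dots> \<le> norm A * norm A ^ n" by (intro mult_left_mono Suc) auto
  finally show ?case by simp
qed

lemma op_pow_scaleR: "op_pow (r *\<^sub>R A) n = r ^ n *\<^sub>R op_pow A n"
  by (induction n) (auto simp: op_pow_Suc blinfun.bilinear_simps intro!: blinfun_eqI)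

lemma summable_op_exp: "summable (\<lambda>n. (1 / fact n) *\<^sub>R op_pow A n)"
  for A :: "'a::banach \<Rightarrow>\<^sub>L 'a"
proof (rule summable_comparison_test'[where N = 0])
  show "summable (\<lambda>n. inverse (fact n) * norm A ^ n)" by (rule summable_exp)
  show "norm ((1 / fact n) *\<^sub>R op_pow A n) \<le> inverse (fact n) * norm A ^ n" for n
    using norm_op_pow_le[of A n] by (simp add: field_simps divide_right_mono)
qed

lemma op_exp_sums: "(\<lambda>n. (1 / fact n) *\<^sub>R op_pow A n) sums op_exp A"
  for A :: "'a::banach \<Rightarrow>\<^sub>L 'a"
  unfolding op_exp_def by (rule summable_sums[OF summable_op_exp])

lemma op_exp_0 [simp]: "op_exp 0 = (id_blinfun :: 'a::banach \<Rightarrow>\<^sub>L 'a)"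
proof -
  have "(\<lambda>n. (1 / fact n) *\<^sub>R op_pow (0::'a \<Rightarrow>\<^sub>L 'a) n) = (\<lambda>n. if n = 0 then id_blinfun else 0)"
  proof
    fix n show "(1 / fact n) *\<^sub>R op_pow (0::'a \<Rightarrow>\<^sub>L 'a) n = (if n = 0 then id_blinfun else 0)"
      by (cases n) (auto simp: op_pow_Suc)
  qed
  then show ?thesis using op_exp_sums[of "0::'a \<Rightarrow>\<^sub>L 'a"] sums_single[of 0 "\<lambda>_. id_blinfun :: 'a \<Rightarrow>\<^sub>L 'a"]
    by (simp add: sums_iff)
qed

lemma op_exp_commute: "A o\<^sub>L op_exp (t *\<^sub>R A) = op_exp (t *\<^sub>R A) o\<^sub>L A"
  for A :: "'a::banach \<Rightarrow>\<^sub>L 'a"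
proof -
  have "(\<lambda>n. A o\<^sub>L ((1 / fact n) *\<^sub>R op_pow (t *\<^sub>R A) n)) sums (A o\<^sub>L op_exp (t *\<^sub>R A))"
    by (intro bounded_linear.sums[OF _ op_exp_sums] bounded_linear_intros)
  moreover have "(\<lambda>n. ((1 / fact n) *\<^sub>R op_pow (t *\<^sub>R A) n) o\<^sub>L A) sums (op_exp (t *\<^sub>R A) o\<^sub>L A)"
    by (rule bounded_linear.sums[OF bounded_bilinear.bounded_linear_left[OF bounded_bilinear_blinfun_compose] op_exp_sums])
  moreover have "A o\<^sub>L ((1 / fact n) *\<^sub>R op_pow (t *\<^sub>R A) n) = ((1 / fact n) *\<^sub>R op_pow (t *\<^sub>R A) n) o\<^sub>L A" for n
    using op_pow_Suc[of A n] op_pow_Suc2[of A n]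
    by (simp add: op_pow_scaleR bounded_bilinear.scaleR_left[OF bounded_bilinear_blinfun_compose] bounded_bilinear.scaleR_right[OF bounded_bilinear_blinfun_compose])
  ultimately show ?thesis by (simp add: sums_iff)
qed

lemma op_exp_adj: "op_adj (op_exp A) = op_exp (op_adj A)"
  for A :: "'a::{real_inner,banach} \<Rightarrow>\<^sub>L 'a"
proof -
  have *: "op_adj (op_pow A n) = op_pow (op_adj A) n" for n
  proof (induction n)
    case 0 show ?case by (simp, rule op_adj_eqI) simp
  next
    case (Suc n)
    have "op_adj (op_pow A (Suc n)) = op_adj (op_pow A n o\<^sub>L A)" by (simp only: op_pow_Suc2)
    also have "\<dots> = op_pow (op_adj A) (Suc n)" by (simp only: op_adj_compose Suc op_pow_Suc)
    finally show ?case .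
  qed
  have "(\<lambda>n. op_adj ((1 / fact n) *\<^sub>R op_pow A n)) sums op_adj (op_exp A)"
    by (intro bounded_linear.sums[OF bounded_linear_op_adj op_exp_sums])
  then have "(\<lambda>n. (1 / fact n) *\<^sub>R op_pow (op_adj A) n) sums op_adj (op_exp A)"
    by (simp add: * linear.scaleR[OF bounded_linear.linear[OF bounded_linear_op_adj]] linear_simps[OF bounded_linear_op_adj])
  then show ?thesis using op_exp_sums[of "op_adj A"] by (simp add: sums_iff)
qed

text \<open>Termwise differentiation. The derivative of the n-th term is \<open>A\<close> composed
  with the term of index n - 1, so uniform convergence of the differentiated series on a ball around
  t is inherited from that of the exponential series itself.\<close>

lemma op_exp_has_vector_derivative:
  fixes A :: "'a::banach \<Rightarrow>\<^sub>L 'a"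
  shows "((\<lambda>t. op_exp (t *\<^sub>R A)) has_vector_derivative (A o\<^sub>L op_exp (t *\<^sub>R A))) (at t)"
proof -
  define R where "R = \<bar>t\<bar> + 1"
  define S where "S = ball (0::real) R"
  define f where "f n (t::real) = (1 / fact n) *\<^sub>R op_pow (t *\<^sub>R A) n" for n t
  define f' where "f' n (t::real) (h::real) = h *\<^sub>R (if n = 0 then 0 else A o\<^sub>L f (n - 1) t)" for n t h
  have fsums: "(\<lambda>n. f n t) sums op_exp (t *\<^sub>R A)" for t unfolding f_def by (rule op_exp_sums)
  have ul: "uniform_limit S (\<lambda>n t. \<Sum>i<n. f i t) (\<lambda>t. \<Sum>i. f i t) sequentially"
  proof (rule Weierstrass_m_test)
    show "summable (\<lambda>n. inverse (fact n) * (R * norm A) ^ n)" by (rule summable_exp)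
    fix n and t assume "t \<in> S"
    then have t: "\<bar>t\<bar> \<le> R" by (auto simp: S_def)
    have "norm (op_pow (t *\<^sub>R A) n) \<le> norm (t *\<^sub>R A) ^ n" by (rule norm_op_pow_le)
    also have "\<dots> \<le> (R * norm A) ^ n" using t by (intro power_mono) (auto intro: mult_right_mono)
    finally show "norm (f n t) \<le> inverse (fact n) * (R * norm A) ^ n"
      by (simp add: f_def field_simps divide_right_mono)
  qed
  have "\<exists>g. \<forall>t\<in>S. (\<lambda>n. f n t) sums (g t) \<and> (g has_derivative (\<lambda>h. h *\<^sub>R (A o\<^sub>L op_exp (t *\<^sub>R A)))) (at t within S)"
  proof (rule has_derivative_series[where f' = f' and x = t])
    show "convex S" by (simp add: S_def)
    show "t \<in> S" by (simp add: S_def R_def)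
    show "(\<lambda>n. f n t) sums op_exp (t *\<^sub>R A)" by (rule fsums)
  next
    fix n and t :: real
    show "(f n has_derivative f' n t) (at t within S)"
    proof (cases n)
      case 0
      then have "f n = (\<lambda>t. id_blinfun)" "f' n t = (\<lambda>h. 0)" by (auto simp: f_def f'_def)
      then show ?thesis by simp
    next
      case (Suc k)
      have "((\<lambda>t. (t ^ Suc k / fact (Suc k)) *\<^sub>R op_pow A (Suc k)) has_derivative
             (\<lambda>h. (h * (t ^ k / fact k)) *\<^sub>R op_pow A (Suc k))) (at t within S)"
      proof -
        have "((\<lambda>t. t ^ Suc k / fact (Suc k)) has_real_derivative (t ^ k / fact k)) (at t within S)"
          using DERIV_cdivide[OF DERIV_pow[of "Suc k" t S], of "fact (Suc k)"]
          unfolding fact_Suc of_nat_mult by (simp add: nonzero_mult_divide_mult_cancel_left del: of_nat_Suc)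
        then have "((\<lambda>t. t ^ Suc k / fact (Suc k)) has_derivative (\<lambda>h. h * (t ^ k / fact k))) (at t within S)"
          unfolding has_field_derivative_def by (rule has_derivative_eq_rhs) (auto simp: fun_eq_iff)
        then show ?thesis by (rule has_derivative_scaleR_left)
      qed
      moreover have "f n = (\<lambda>t. (t ^ Suc k / fact (Suc k)) *\<^sub>R op_pow A (Suc k))"
        by (auto simp: f_def Suc op_pow_scaleR)
      moreover have "f' n t = (\<lambda>h. (h * (t ^ k / fact k)) *\<^sub>R op_pow A (Suc k))"
        by (auto simp: f'_def f_def Suc op_pow_scaleR op_pow_Suc blinfun.bilinear_simps intro!: blinfun_eqI)
      ultimately show ?thesis by simp
    qed
  next
    fix e :: real assume e: "e > 0"
    \<comment> \<open>The added 1 keeps the denominator positive when \<open>A\<close> = 0.\<close>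
    define e' where "e' = e / (norm A + 1)"
    have e': "e' > 0" using e by (auto simp: e'_def intro!: divide_pos_pos add_nonneg_pos)
    have "\<forall>\<^sub>F n in sequentially. \<forall>t\<in>S. dist (\<Sum>i<n. f i t) (\<Sum>i. f i t) < e'"
      using uniform_limitD[OF ul e'] .
    then obtain n0 where n0: "\<And>n t. n \<ge> n0 \<Longrightarrow> t \<in> S \<Longrightarrow> dist (\<Sum>i<n. f i t) (\<Sum>i. f i t) < e'"
      by (auto simp: eventually_sequentially)
    have "norm ((\<Sum>i<n. f' i t h) - h *\<^sub>R (A o\<^sub>L op_exp (t *\<^sub>R A))) \<le> e * norm h"
      if n: "n \<ge> Suc n0" and t: "t \<in> S" for n t h
    proof -
      \<comment> \<open>The term of index 0 has derivative 0, so a differentiated partial sum of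
        length n is \<open>A\<close> composed with the partial sum of length n - 1; hence the
        threshold \<open>Suc n0\<close>.\<close>
      obtain k where k: "n = Suc k" "k \<ge> n0" using n by (cases n) auto
      have "(\<Sum>i<n. f' i t h) = h *\<^sub>R (A o\<^sub>L (\<Sum>i<k. f i t))"
        by (simp add: k sum.lessThan_Suc_shift f'_def scaleR_sum_right bounded_bilinear.sum_right[OF bounded_bilinear_blinfun_compose] del: sum.lessThan_Suc)
      moreover have "op_exp (t *\<^sub>R A) = (\<Sum>i. f i t)" using fsums by (simp add: sums_iff)
      ultimately have "(\<Sum>i<n. f' i t h) - h *\<^sub>R (A o\<^sub>L op_exp (t *\<^sub>R A)) = h *\<^sub>R (A o\<^sub>L ((\<Sum>i<k. f i t) - (\<Sum>i. f i t)))"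
        by (simp add: bounded_bilinear.diff_right[OF bounded_bilinear_blinfun_compose] scaleR_diff_right)
      then have "norm ((\<Sum>i<n. f' i t h) - h *\<^sub>R (A o\<^sub>L op_exp (t *\<^sub>R A))) \<le> \<bar>h\<bar> * (norm A * norm ((\<Sum>i<k. f i t) - (\<Sum>i. f i t)))"
        by (auto intro!: mult_left_mono norm_blinfun_compose)
      also have "\<dots> \<le> \<bar>h\<bar> * ((norm A + 1) * e')"
        using n0[OF k(2) t] by (intro mult_left_mono mult_mono) (auto simp: dist_norm)
      also have "(norm A + 1) * e' = e"
      proof -
        have "norm A + 1 \<noteq> 0" using norm_ge_zero[of A] by linarith
        then show ?thesis by (simp add: e'_def)
      qed
      finally show ?thesis by (simp add: mult.commute)
    qed
    then show "\<forall>\<^sub>F n in sequentially. \<forall>t\<in>S. \<forall>h. norm ((\<Sum>i<n. f' i t h) - h *\<^sub>R (A o\<^sub>L op_exp (t *\<^sub>R A))) \<le> e * norm h"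
      by (auto simp: eventually_sequentially)
  qed
  then obtain g where g: "\<And>t. t \<in> S \<Longrightarrow> (\<lambda>n. f n t) sums (g t)"
    "\<And>t. t \<in> S \<Longrightarrow> (g has_derivative (\<lambda>h. h *\<^sub>R (A o\<^sub>L op_exp (t *\<^sub>R A)))) (at t within S)" by blast
  have tS: "t \<in> S" "open S" by (auto simp: S_def R_def)
  have geq: "op_exp (u *\<^sub>R A) = g u" if "u \<in> S" for u using sums_unique2[OF fsums g(1)[OF that]] .
  have "((\<lambda>t. op_exp (t *\<^sub>R A)) has_derivative (\<lambda>h. h *\<^sub>R (A o\<^sub>L op_exp (t *\<^sub>R A)))) (at t within S)"
    by (rule has_derivative_transform[OF tS(1) _ g(2)[OF tS(1)]], rule geq)
  then show ?thesis unfolding has_vector_derivative_def at_within_open[OF tS] .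
qed

lemma continuous_on_op_exp: "continuous_on S (\<lambda>t. op_exp (t *\<^sub>R A))"
  for A :: "'a::banach \<Rightarrow>\<^sub>L 'a"
  by (intro continuous_at_imp_continuous_on ballI has_vector_derivative_continuous[OF op_exp_has_vector_derivative])

text \<open>The product has derivative 0 because \<open>A\<close> commutes with its exponentials, so
  it keeps its value at t = 0. A left inverse suffices later: it bounds the exponentials from below,
  which gives the coercivity of \<open>Qop\<close>.\<close>

lemma op_exp_neg_compose:
  fixes A :: "'a::banach \<Rightarrow>\<^sub>L 'a"
  shows "op_exp ((- t) *\<^sub>R A) o\<^sub>L op_exp (t *\<^sub>R A) = id_blinfun"
proof -
  define F where "F t = op_exp ((- t) *\<^sub>R A) o\<^sub>L op_exp (t *\<^sub>R A)" for t
  have d1: "((\<lambda>t. op_exp ((- t) *\<^sub>R A)) has_vector_derivative - (A o\<^sub>L op_exp ((- t) *\<^sub>R A))) (at t)" for t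
    using vector_diff_chain_at[of uminus "-1" t "\<lambda>t. op_exp (t *\<^sub>R A)", OF _ op_exp_has_vector_derivative]
    by (simp add: o_def has_vector_derivative_minus[OF has_vector_derivative_id, unfolded id_def])
  have "(F has_vector_derivative 0) (at t)" for t
  proof -
    have "(F has_vector_derivative ((op_exp ((- t) *\<^sub>R A) o\<^sub>L (A o\<^sub>L op_exp (t *\<^sub>R A))) + ((- (A o\<^sub>L op_exp ((- t) *\<^sub>R A))) o\<^sub>L op_exp (t *\<^sub>R A)))) (at t)"
      unfolding F_def
      by (rule bounded_bilinear.has_vector_derivative[OF bounded_bilinear_blinfun_compose d1 op_exp_has_vector_derivative[of A t]])
    moreover have "(op_exp ((- t) *\<^sub>R A) o\<^sub>L (A o\<^sub>L op_exp (t *\<^sub>R A))) + ((- (A o\<^sub>L op_exp ((- t) *\<^sub>R A))) o\<^sub>L op_exp (t *\<^sub>R A)) = 0"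
      by (subst op_exp_commute[of A "- t"])
         (simp add: bounded_bilinear.minus_left[OF bounded_bilinear_blinfun_compose] blinfun_compose_assoc)
    ultimately show ?thesis by simp
  qed
  then obtain c where "\<And>t. F t = c"
    using has_vector_derivative_zero_constant[of UNIV F] by auto
  then have "F t = F 0" by simp
  then show ?thesis by (simp add: F_def)
qed

section \<open>Strongly continuous semigroups\<close>

text \<open>Uniform boundedness by Baire category: each orbit is continuous and therefore bounded on
  the compact interval, so the closed sets \<open>F n\<close> cover the space and one of them
  contains a ball.\<close>

lemma c0_semigroup_locally_bounded:
  fixes S :: "real \<Rightarrow> ('a::banach \<Rightarrow>\<^sub>L 'a)"
  assumes S: "c0_semigroup S"
  shows "\<exists>C>0. \<forall>t\<in>{0..T}. norm (S t) \<le> C"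
proof -
  define F where "F n = {x. \<forall>t\<in>{0..T}. norm (S t x) \<le> real n}" for n :: nat
  have cont: "continuous_on {0..} (\<lambda>t. S t x)" for x using S by (auto simp: c0_semigroup_def)
  have closed: "closed (F n)" for n
  proof -
    have "F n = (\<Inter>t\<in>{0..T}. {x. norm (S t x) \<le> real n})" by (auto simp: F_def)
    moreover have "closed {x. norm (S t x) \<le> real n}" for t
      by (intro closed_Collect_le continuous_intros)
    ultimately show ?thesis by auto
  qed
  have Un: "(\<Union>n. F n) = UNIV"
  proof -
    have "\<exists>n. x \<in> F n" for x
    proof -
      have "compact ((\<lambda>t. S t x) ` {0..T})"
        by (rule compact_continuous_image[OF continuous_on_subset[OF cont]]) auto
      then obtain b where b: "\<And>t. t \<in> {0..T} \<Longrightarrow> norm (S t x) \<le> b"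
        by (meson bounded_iff compact_imp_bounded imageI)
      obtain n where n: "b \<le> real n" using real_arch_simple by blast
      have "x \<in> F n" using order_trans[OF b n] by (simp add: F_def)
      then show ?thesis by blast
    qed
    then show ?thesis by auto
  qed
  have "\<exists>n. interior (F n) \<noteq> {}"
  proof (rule ccontr)
    assume "\<not> ?thesis"
    then have "euclidean interior_of \<Union>(range F) = {}"
      by (intro Baire_category_alt) (auto simp: completely_metrizable_space_euclidean closed)
    then show False by (simp add: Un)
  qed
  then obtain n x0 where "x0 \<in> interior (F n)" by auto
  then obtain e where e: "e > 0" "ball x0 e \<subseteq> F n" unfolding mem_interior by blast
  \<comment> \<open>A vector x is rescaled to length e/2 and added to the centre \<open>x0\<close>.
    Both points lie in the ball, so the image of the rescaled vector has norm at most 2n, which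
    gives the factor 2n / (e/2).\<close>
  have "norm (S t) \<le> 4 * real n / e" if t: "t \<in> {0..T}" for t
  proof (rule norm_blinfun_bound)
    show "0 \<le> 4 * real n / e" using e by auto
    fix x
    show "norm (S t x) \<le> 4 * real n / e * norm x"
    proof (cases "x = 0")
      case False
      define c where "c = e / (2 * norm x)"
      have c: "c > 0" "c * norm x < e" using False e by (auto simp: c_def)
      have "norm (S t (x0 + c *\<^sub>R x)) \<le> real n" "norm (S t x0) \<le> real n"
        using e t c by (auto simp: F_def subset_iff dist_norm)
      then have "norm (S t (x0 + c *\<^sub>R x) - S t x0) \<le> 2 * real n"
        using norm_triangle_ineq4[of "S t (x0 + c *\<^sub>R x)" "S t x0"] by linarith
      then have "c * norm (S t x) \<le> 2 * real n" using c by (simp add: blinfun.bilinear_simps)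
      then show ?thesis using c e False by (simp add: c_def field_simps)
    qed auto
  qed
  then have "norm (S t) \<le> 4 * real n / e + 1" if "t \<in> {0..T}" for t
    using that by (meson add_increasing2 zero_le_one)
  moreover have "4 * real n / e + 1 > 0" using e by (auto intro: add_nonneg_pos)
  ultimately show ?thesis by blast
qed

text \<open>Joint continuity follows from strong continuity in t together with local boundedness of
  the norms. The clamp \<open>max 0\<close> makes the map total, so that random times and random
  vectors can be inserted without a side condition in the measurability lemma that follows.\<close>

lemma c0_semigroup_continuous:
  fixes S :: "real \<Rightarrow> ('a::banach \<Rightarrow>\<^sub>L 'a)"
  assumes S: "c0_semigroup S"
  shows "continuous_on UNIV (\<lambda>p. S (max 0 (fst p)) (snd p))"
  unfolding continuous_on_eq_continuous_at[OF open_UNIV]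
proof (intro ballI)
  fix p :: "real \<times> 'a"
  obtain t x where p: "p = (t, x)" by (cases p)
  obtain C where C: "C > 0" "\<And>u. u \<in> {0..max 0 t + 1} \<Longrightarrow> norm (S u) \<le> C"
    using c0_semigroup_locally_bounded[OF S] by blast
  have cont: "continuous_on {0..} (\<lambda>t. S t x)" using S by (auto simp: c0_semigroup_def)
  have "continuous_on UNIV (\<lambda>p. S (max 0 (fst p)) x)"
    by (rule continuous_on_compose2[OF cont, where f = "\<lambda>p. max 0 (fst p)"]) (auto intro!: continuous_intros)
  then have 1: "((\<lambda>q. S (max 0 (fst q)) x) \<longlongrightarrow> S (max 0 t) x) (at p)"
    by (auto simp: continuous_on_def p)
  have snd: "(snd \<longlongrightarrow> x) (at p)" using tendsto_snd[OF tendsto_ident_at, of p UNIV] by (simp add: p)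
  have fst: "(fst \<longlongrightarrow> t) (at p)" using tendsto_fst[OF tendsto_ident_at, of p UNIV] by (simp add: p)
  have 2: "((\<lambda>q. S (max 0 (fst q)) (snd q - x)) \<longlongrightarrow> 0) (at p)"
  proof (rule Lim_null_comparison)
    have "\<forall>\<^sub>F q in at p. fst q < t + 1" using fst by (rule order_tendstoD) simp
    then show "\<forall>\<^sub>F q in at p. norm (S (max 0 (fst q)) (snd q - x)) \<le> C * norm (snd q - x)"
    proof eventually_elim
      case (elim q)
      have "norm (S (max 0 (fst q))) \<le> C" using elim by (intro C) auto
      then show ?case by (intro order_trans[OF norm_blinfun] mult_right_mono) auto
    qed
    show "((\<lambda>q. C * norm (snd q - x)) \<longlongrightarrow> 0) (at p)"
      using tendsto_mult[OF tendsto_const[of C] tendsto_norm[OF tendsto_diff[OF snd tendsto_const[of x]]]] by simp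
  qed
  show "isCont (\<lambda>p. S (max 0 (fst p)) (snd p)) p"
    unfolding isCont_def using tendsto_add[OF 1 2] by (simp add: p blinfun.bilinear_simps)
qed

lemma c0_semigroup_measurable:
  fixes S :: "real \<Rightarrow> ('a::{banach,second_countable_topology} \<Rightarrow>\<^sub>L 'a)"
  assumes S: "c0_semigroup S" and "t \<in> borel_measurable M" "x \<in> borel_measurable M"
  shows "(\<lambda>\<omega>. S (max 0 (t \<omega>)) (x \<omega>)) \<in> borel_measurable M"
  using borel_measurable_continuous_on[OF c0_semigroup_continuous[OF S] borel_measurable_Pair[OF assms(2,3)]]
  by simp

text \<open>The orbit u of e solves u' = - l u, so e^{lr} u(r) is constant. The generator supplies
  only a right derivative at time 0; the semigroup law transports it to every time, and the local
  bound on the norms makes the left difference quotients converge as well.\<close>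

lemma c0_semigroup_eigenvector:
  fixes S :: "real \<Rightarrow> ('a::banach \<Rightarrow>\<^sub>L 'a)"
  assumes S: "c0_semigroup S" and gen: "sg_gen S e (- (l *\<^sub>R e))" and t: "t \<ge> 0"
  shows "S t e = exp (- l * t) *\<^sub>R e"
proof -
  define u where "u t = S t e" for t
  have S0: "S 0 = id_blinfun" and Sadd: "\<And>t u. 0 \<le> t \<Longrightarrow> 0 \<le> u \<Longrightarrow> S (t + u) = S t o\<^sub>L S u"
    and cont: "continuous_on {0..} u" using S by (auto simp: c0_semigroup_def u_def[abs_def])
  obtain C where C: "C > 0" "\<And>r. r \<in> {0..t} \<Longrightarrow> norm (S r) \<le> C"
    using c0_semigroup_locally_bounded[OF S] by blast
  define \<psi> where "\<psi> h = norm ((1 / h) *\<^sub>R (S h e - e) + l *\<^sub>R e)" for h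
  have \<psi>: "(\<psi> \<longlongrightarrow> 0) (at_right 0)"
    using tendsto_norm[OF tendsto_add[OF gen[unfolded sg_gen_def] tendsto_const[of "l *\<^sub>R e"]]]
    by (simp add: \<psi>_def[abs_def])
  have der: "(u has_vector_derivative - (l *\<^sub>R u r)) (at r within {0..t})" if r: "r \<in> {0..t}" for r
    unfolding has_vector_derivative_def has_derivative_within
  proof (intro conjI bounded_linear_intros)
    have eq: "norm ((1 / norm (y - r)) *\<^sub>R (u y - (u r + (y - r) *\<^sub>R - (l *\<^sub>R u r))))
      \<le> C * \<psi> \<bar>y - r\<bar> + \<bar>l\<bar> * norm (u (min y r) - u r)" if y: "y \<in> {0..t}" "y \<noteq> r" for y
    proof -
      \<comment> \<open>Both quotients are written from the left end point: u(b) - u(a) = S(a) (S(h)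
        e - e). For y < r this point moves with y, which is why the bound contains the difference
        u(min y r) - u(r).\<close>
      define a b h where "a = min y r" and "b = max y r" and "h = \<bar>y - r\<bar>"
      have ab: "0 \<le> a" "h > 0" "b = a + h" "a \<in> {0..t}" using y r by (auto simp: a_def b_def h_def)
      define w where "w = (1 / h) *\<^sub>R (S h e - e) + l *\<^sub>R e"
      have "u b - u a = h *\<^sub>R S a (w - l *\<^sub>R e)"
        using ab Sadd[of a h] by (simp add: u_def w_def blinfun.bilinear_simps)
      then have E: "(1 / h) *\<^sub>R (u b - u a) = S a w - l *\<^sub>R u a"
        using ab by (simp add: blinfun.bilinear_simps u_def)
      have "norm ((1 / norm (y - r)) *\<^sub>R (u y - (u r + (y - r) *\<^sub>R - (l *\<^sub>R u r))))
         = norm ((1 / h) *\<^sub>R (u b - u a) + l *\<^sub>R u r)"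
      proof (cases "y > r")
        case True
        have "(1 / h) *\<^sub>R ((y - r) *\<^sub>R (l *\<^sub>R u r)) = l *\<^sub>R u r" using True by (simp add: h_def)
        then show ?thesis using True by (simp add: a_def b_def h_def scaleR_diff_right scaleR_add_right diff_diff_eq2 diff_add_eq)
      next
        case False
        then have yr: "y < r" using y by auto
        have "(1 / norm (y - r)) *\<^sub>R (u y - (u r + (y - r) *\<^sub>R - (l *\<^sub>R u r))) = - ((1 / h) *\<^sub>R (u b - u a) + l *\<^sub>R u r)"
        proof -
          have "(1 / h) *\<^sub>R ((y - r) *\<^sub>R (l *\<^sub>R u r)) = - (l *\<^sub>R u r)"
          proof -
            have "(1 / h) * (y - r) = - 1" using yr by (simp add: h_def field_simps)
            then show ?thesis by (metis scaleR_minus1_left scaleR_scaleR)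
          qed
          then show ?thesis using yr by (simp add: a_def b_def h_def scaleR_diff_right scaleR_add_right)
        qed
        then show ?thesis by (metis norm_minus_cancel)
      qed
      also have "(1 / h) *\<^sub>R (u b - u a) + l *\<^sub>R u r = S a w - l *\<^sub>R (u a - u r)"
        unfolding E by (simp add: algebra_simps)
      also have "norm \<dots> \<le> norm (S a w) + norm (l *\<^sub>R (u a - u r))" by (rule norm_triangle_ineq4)
      also have "\<dots> \<le> C * norm w + \<bar>l\<bar> * norm (u a - u r)"
        using C(2)[OF ab(4)] by (auto intro!: order_trans[OF norm_blinfun] mult_right_mono)
      finally show ?thesis by (simp add: w_def \<psi>_def h_def a_def)
    qed
    have abs: "filterlim (\<lambda>y. \<bar>y - r\<bar>) (at_right 0) (at r within {0..t})"
      unfolding filterlim_at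
      by (auto simp: eventually_at_filter intro!: tendsto_eq_intros)
    have u1: "((\<lambda>y. u (min y r)) \<longlongrightarrow> u r) (at r within {0..t})"
    proof -
      have "continuous_on {0..t} (\<lambda>y. u (min y r))"
        by (rule continuous_on_compose2[OF cont, where f = "\<lambda>y. min y r"]) (use r in \<open>auto intro!: continuous_intros\<close>)
      then show ?thesis using r by (auto simp: continuous_on_def dest!: bspec[where x = r])
    qed
    have lim: "((\<lambda>y. C * \<psi> \<bar>y - r\<bar> + \<bar>l\<bar> * norm (u (min y r) - u r)) \<longlongrightarrow> C * 0 + \<bar>l\<bar> * norm (u r - u r)) (at r within {0..t})"
      by (intro tendsto_intros filterlim_compose[OF \<psi> abs] u1)
    show "((\<lambda>y. (1 / norm (y - r)) *\<^sub>R (u y - (u r + (y - r) *\<^sub>R - (l *\<^sub>R u r)))) \<longlongrightarrow> 0) (at r within {0..t})"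
      by (rule Lim_null_comparison[OF _ lim[simplified]])
         (use eq in \<open>auto simp: eventually_at_filter\<close>)
  qed
  have "((\<lambda>r. exp (l * r) *\<^sub>R u r) has_vector_derivative 0) (at r within {0..t})" if r: "r \<in> {0..t}" for r
  proof -
    have "((\<lambda>r. exp (l * r)) has_real_derivative (l * exp (l * r))) (at r within {0..t})"
      by (auto intro!: derivative_eq_intros)
    from has_vector_derivative_scaleR[OF this der[OF r]] show ?thesis by (simp add: mult.commute)
  qed
  then obtain c where "\<And>r. r \<in> {0..t} \<Longrightarrow> exp (l * r) *\<^sub>R u r = c"
    using has_vector_derivative_zero_constant[of "{0..t}" "\<lambda>r. exp (l * r) *\<^sub>R u r"] by auto
  from this[of 0] this[of t] have "exp (l * t) *\<^sub>R u t = e" using t by (simp add: u_def S0)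
  then have "exp (- l * t) *\<^sub>R (exp (l * t) *\<^sub>R u t) = exp (- l * t) *\<^sub>R e" by simp
  then show ?thesis by (simp add: u_def flip: exp_add)
qed

lemma bounded_linear_eq_on_dense_span:
  assumes "bounded_linear f" "bounded_linear g" "closure (span E) = UNIV" "\<And>e. e \<in> E \<Longrightarrow> f e = g e"
  shows "f x = g x"
proof -
  have "closed {x. f x = g x}"
    by (intro closed_Collect_eq linear_continuous_on assms)
  moreover have "span E \<subseteq> {x. f x = g x}"
    using linear_eq_on_span[of f g E] assms by (auto simp: bounded_linear.linear)
  ultimately have "closure (span E) \<subseteq> {x. f x = g x}" by (metis closure_minimal)
  then show ?thesis using assms by auto
qed

text \<open>Symmetry is checked on pairs of eigenvectors and extended by density, one argument at a
  time. It allows \<open>op_adj (S2 t)\<close> to be replaced by \<open>S2 t\<close>, whose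
  dependence on t is strongly continuous by assumption.\<close>

lemma op_adj_diagonal:
  fixes A :: "'a::{real_inner,banach} \<Rightarrow>\<^sub>L 'a"
  assumes orth: "\<forall>e\<in>E. \<forall>e'\<in>E. e \<noteq> e' \<longrightarrow> e \<bullet> e' = 0" and dense: "closure (span E) = UNIV"
    and diag: "\<And>e. e \<in> E \<Longrightarrow> A e = l e *\<^sub>R e"
  shows "op_adj A = A"
proof (rule op_adj_eqI)
  have 1: "A e \<bullet> y = e \<bullet> A y" if e: "e \<in> E" for e y
  proof (rule bounded_linear_eq_on_dense_span[where f = "\<lambda>y. A e \<bullet> y" and g = "\<lambda>y. e \<bullet> A y", OF _ _ dense])
    show "bounded_linear (\<lambda>y. A e \<bullet> y)" "bounded_linear (\<lambda>y. e \<bullet> A y)" by (intro bounded_linear_intros)+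
    show "A e \<bullet> e' = e \<bullet> A e'" if "e' \<in> E" for e'
      using orth e that by (cases "e = e'") (auto simp: diag)
  qed
  fix x y
  show "A x \<bullet> y = x \<bullet> A y"
    by (rule bounded_linear_eq_on_dense_span[where f = "\<lambda>x. A x \<bullet> y" and g = "\<lambda>x. x \<bullet> A y", OF _ _ dense 1])
       (intro bounded_linear_intros)+
qed

section \<open>Characteristic functions on separable inner product spaces\<close>

lemma borel_measurable_cis [measurable (raw)]:
  "f \<in> borel_measurable M \<Longrightarrow> (\<lambda>x. cis (f x)) \<in> borel_measurable M"
  by (rule borel_measurable_continuous_on[where f = cis]) (intro continuous_intros)

text \<open>Levy's uniqueness theorem for finite measures, after normalising the total mass. Real
  cosines with a phase replace the complex exponential because products of such cosines are again
  sums of such cosines, which the weighted induction further on exploits; the phase -pi/2 recovers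
  the sine.\<close>

lemma finite_measure_eqI_cos:
  fixes M1 M2 :: "real measure"
  assumes fin: "finite_measure M1" "finite_measure M2" and sets: "sets M1 = sets borel" "sets M2 = sets borel"
    and eq: "\<And>t \<phi>. (\<integral>x. cos (t * x + \<phi>) \<partial>M1) = (\<integral>x. cos (t * x + \<phi>) \<partial>M2)"
  shows "M1 = M2"
proof -
  interpret M1: finite_measure M1 by fact
  interpret M2: finite_measure M2 by fact
  have sp: "space M1 = UNIV" "space M2 = UNIV" using sets by (auto dest: sets_eq_imp_space_eq)
  define c where "c = measure M1 UNIV"
  have c2: "measure M2 UNIV = c" using eq[of 0 0] by (simp add: sp c_def)
  show ?thesis
  proof (cases "c = 0")
    case True
    have "emeasure M1 A = emeasure M2 A" if "A \<in> sets borel" for A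
    proof -
      have "emeasure M1 A \<le> emeasure M1 UNIV" "emeasure M2 A \<le> emeasure M2 UNIV"
        using that by (auto intro!: emeasure_mono simp: sets)
      then show ?thesis using True c2 by (simp add: M1.emeasure_eq_measure M2.emeasure_eq_measure c_def measure_le_0_iff)
    qed
    then show ?thesis by (intro measure_eqI) (auto simp: sets)
  next
    case False
    then have c: "c > 0" by (auto simp: c_def less_le)
    define N where "N M = density M (\<lambda>_. ennreal (1 / c))" for M :: "real measure"
    have dist: "real_distribution (N M)" if "sets M = sets borel" "measure M UNIV = c" "finite_measure M" for M
    proof -
      interpret finite_measure M by fact
      have sp: "space M = UNIV" using that by (auto dest: sets_eq_imp_space_eq)
      have "emeasure (N M) (space (N M)) = ennreal (1 / c) * ennreal c"
        unfolding N_def using that by (simp add: emeasure_density sp emeasure_eq_measure nn_integral_cmult)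
      also have "\<dots> = 1" using c by (simp flip: ennreal_mult)
      finally have "prob_space (N M)" by (rule prob_spaceI)
      then show ?thesis
        by (auto simp: real_distribution_def real_distribution_axioms_def N_def that sp)
    qed
    have ch: "char (N M) t = complex_of_real (1 / c) * (complex_of_real (\<integral>x. cos (t * x + 0) \<partial>M) + \<i> * complex_of_real (\<integral>x. cos (t * x + (- pi / 2)) \<partial>M))"
      if "sets M = sets borel" "finite_measure M" for M t
    proof -
      interpret finite_measure M by fact
      have meas: "f \<in> borel_measurable borel \<Longrightarrow> f \<in> borel_measurable M" for f :: "real \<Rightarrow> 'd::topological_space"
        using that by (simp cong: measurable_cong_sets)
      have int: "integrable M (\<lambda>x. cis (t * x))"
        by (rule integrable_const_bound[where B = 1]) (auto intro!: meas)
      have "char (N M) t = (\<integral>x. (1 / c) *\<^sub>R cis (t * x) \<partial>M)"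
        unfolding char_def N_def using c
        by (subst integral_density) (auto simp: cis_conv_exp intro!: meas)
      also have "\<dots> = (1 / c) *\<^sub>R (\<integral>x. cis (t * x) \<partial>M)" by simp
      also have "(\<integral>x. cis (t * x) \<partial>M) = Complex (Re (\<integral>x. cis (t * x) \<partial>M)) (Im (\<integral>x. cis (t * x) \<partial>M))" by simp
      also have "\<dots> = Complex (\<integral>x. cos (t * x) \<partial>M) (\<integral>x. sin (t * x) \<partial>M)"
        using int by (simp flip: integral_Re integral_Im)
      also have "(\<lambda>x. sin (t * x)) = (\<lambda>x. cos (t * x + (- pi / 2)))" by (auto simp: cos_diff)
      finally show ?thesis by (simp add: complex_eq_iff scaleR_conv_of_real)
    qed
    have "N M1 = N M2"
    proof (rule Levy_uniqueness)
      show "char (N M1) = char (N M2)" by (rule ext) (simp only: ch[OF sets(1) fin(1)] ch[OF sets(2) fin(2)] eq)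
    qed (auto intro!: dist sets fin simp: c2 c_def)
    then have *: "emeasure (N M1) A = emeasure (N M2) A" for A by simp
    have "emeasure M1 A = emeasure M2 A" if A: "A \<in> sets borel" for A
    proof -
      have "ennreal (1 / c) * emeasure M1 A = ennreal (1 / c) * emeasure M2 A"
        using *[of A] A by (simp add: N_def emeasure_density nn_integral_cmult_indicator sets)
      then have "ennreal c * (ennreal (1 / c) * emeasure M1 A) = ennreal c * (ennreal (1 / c) * emeasure M2 A)" by simp
      then show ?thesis using c by (simp add: mult.assoc[symmetric] flip: ennreal_mult)
    qed
    then show ?thesis by (intro measure_eqI) (auto simp: sets)
  qed
qed

text \<open>One-dimensional uniqueness applied to the image under x \<mapsto>
  \<open>k \<bullet> x\<close> of the measure with density \<open>g\<close>. Nonnegativity of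
  \<open>g\<close> makes this a measure, and the bound \<open>C\<close> makes it finite.\<close>

lemma integral_weight_indicator_eq:
  fixes \<mu> \<nu> :: "'a::{real_inner,second_countable_topology} measure" and g :: "'a \<Rightarrow> real"
  assumes fin: "finite_measure \<mu>" "finite_measure \<nu>" and sets: "sets \<mu> = sets borel" "sets \<nu> = sets borel"
    and g: "g \<in> borel_measurable borel" "\<And>x. 0 \<le> g x" "\<And>x. g x \<le> C"
    and eq: "\<And>t \<phi>. (\<integral>x. g x * cos (t * (k \<bullet> x) + \<phi>) \<partial>\<mu>) = (\<integral>x. g x * cos (t * (k \<bullet> x) + \<phi>) \<partial>\<nu>)"
    and A: "A \<in> sets borel"
  shows "(\<integral>x. g x * indicator A (k \<bullet> x) \<partial>\<mu>) = (\<integral>x. g x * indicator A (k \<bullet> x) \<partial>\<nu>)"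
proof -
  define D where "D M = distr (density M (\<lambda>x. ennreal (g x))) borel (\<lambda>x. k \<bullet> x)" for M :: "'a measure"
  have meas: "f \<in> borel_measurable M \<longleftrightarrow> f \<in> borel_measurable borel"
    if "sets M = sets borel" for M :: "'a measure" and f :: "'a \<Rightarrow> 'd::topological_space"
    using that by (simp cong: measurable_cong_sets)
  have int: "(\<integral>y. h y \<partial>D M) = (\<integral>x. g x * h (k \<bullet> x) \<partial>M)"
    if M: "sets M = sets borel" and h: "h \<in> borel_measurable borel" for M and h :: "real \<Rightarrow> real"
  proof -
    have "(\<lambda>x. k \<bullet> x) \<in> density M (\<lambda>x. ennreal (g x)) \<rightarrow>\<^sub>M borel" using M by (simp add: meas[OF M])
    moreover have "(\<lambda>x. h (k \<bullet> x)) \<in> borel_measurable M" using h M by (simp add: meas[OF M])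
    ultimately show ?thesis unfolding D_def using h g M
      by (simp add: integral_distr integral_density meas[OF M])
  qed
  have finD: "finite_measure (D M)" if M: "sets M = sets borel" "finite_measure M" for M
  proof -
    interpret finite_measure M by fact
    have k: "(\<lambda>x. k \<bullet> x) \<in> density M (\<lambda>x. ennreal (g x)) \<rightarrow>\<^sub>M borel" using M by (simp add: meas[OF M(1)])
    have "emeasure (D M) (space (D M)) = (\<integral>\<^sup>+x. ennreal (g x) \<partial>M)"
      unfolding D_def using k M g sets_eq_imp_space_eq[OF M(1)]
      by (simp add: emeasure_distr emeasure_density meas[OF M(1)] cong: nn_integral_cong)
    also have "\<dots> \<le> (\<integral>\<^sup>+x. ennreal C \<partial>M)" by (intro nn_integral_mono ennreal_leI g)
    also have "\<dots> < \<infinity>" by (simp add: ennreal_mult_less_top emeasure_eq_measure)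
    finally show ?thesis by (intro finite_measureI) auto
  qed
  have "D \<mu> = D \<nu>"
    by (rule finite_measure_eqI_cos) (auto intro!: finD fin sets simp: int sets eq, auto simp: D_def)
  then have "(\<integral>y. indicator A y \<partial>D \<mu>) = (\<integral>y. indicator A y \<partial>D \<nu> :: real)" by simp
  then show ?thesis using A by (simp add: int sets del: integral_indicator Bochner_Integration.integral_indicator)
qed

text \<open>The weights \<open>1 + cos (\<langle>l, x\<rangle> + \<theta>)\<close> are nonnegative, so uniqueness on the real line applies to the
  weighted image measures; this allows one more coordinate to be localised in each induction step.\<close>

lemma integral_cylinder_cos_eq:
  fixes \<mu> \<nu> :: "'a::{real_inner,second_countable_topology} measure"
  assumes fin: "finite_measure \<mu>" "finite_measure \<nu>" and sets: "sets \<mu> = sets borel" "sets \<nu> = sets borel"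
    and eq: "\<And>l \<theta>. (\<integral>x. cos (l \<bullet> x + \<theta>) \<partial>\<mu>) = (\<integral>x. cos (l \<bullet> x + \<theta>) \<partial>\<nu>)"
    and ps: "\<forall>(k, A)\<in>set ps. A \<in> sets borel"
  shows "(\<integral>x. indicator {x. \<forall>(k, A)\<in>set ps. k \<bullet> x \<in> A} x * cos (l \<bullet> x + \<theta>) \<partial>\<mu>)
       = (\<integral>x. indicator {x. \<forall>(k, A)\<in>set ps. k \<bullet> x \<in> A} x * cos (l \<bullet> x + \<theta>) \<partial>\<nu>)"
  using ps
proof (induction ps arbitrary: l \<theta>)
  case Nil
  then show ?case using eq by simp
next
  case (Cons p ps)
  obtain k A where p: "p = (k, A)" by (cases p)
  have A: "A \<in> sets borel" using Cons.prems by (simp add: p)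
  define w :: "'a \<Rightarrow> real" where "w = indicator {x. \<forall>(k, A)\<in>set ps. k \<bullet> x \<in> A}"
  have wset: "{x. \<forall>(k, A)\<in>set ps. k \<bullet> x \<in> A} \<in> sets borel"
  proof -
    have "{x. \<forall>(k, A)\<in>set ps. k \<bullet> x \<in> A} = (\<Inter>p\<in>set ps. (\<lambda>x. fst p \<bullet> x) -` snd p) \<inter> UNIV" by auto
    moreover have "(\<lambda>x. fst p \<bullet> x) -` snd p \<in> sets borel" if "p \<in> set ps" for p :: "'a \<times> real set"
    proof -
      have 1: "(\<lambda>x. fst p \<bullet> x) \<in> borel_measurable borel" by measurable
      have 2: "snd p \<in> sets borel" using Cons.prems that by auto
      show ?thesis using measurable_sets[OF 1 2] by simp
    qed
    ultimately show ?thesis by (cases "ps = []") (auto intro!: sets.finite_INT)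
  qed
  have w [measurable]: "w \<in> borel_measurable borel" unfolding w_def using wset by simp
  have w01: "0 \<le> w x" "w x \<le> 1" for x by (auto simp: w_def indicator_def)
  have IH: "(\<integral>x. w x * cos (l \<bullet> x + \<theta>) \<partial>\<mu>) = (\<integral>x. w x * cos (l \<bullet> x + \<theta>) \<partial>\<nu>)" for l \<theta>
    unfolding w_def using Cons.prems by (intro Cons.IH) auto
  have meas: "f \<in> borel_measurable M \<longleftrightarrow> f \<in> borel_measurable borel"
    if "sets M = sets borel" for M :: "'a measure" and f :: "'a \<Rightarrow> 'd::topological_space"
    using that by (simp cong: measurable_cong_sets)
  have intg: "integrable M (\<lambda>x. w x * h x)"
    if "sets M = sets borel" "finite_measure M" "h \<in> borel_measurable borel" "\<And>x. \<bar>h x\<bar> \<le> 2" for M h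
    using that w01 mult_mono[of "w _" 1 "\<bar>h _\<bar>" 2]
    by (intro finite_measure.integrable_const_bound[where B = 2]) (auto simp: meas[OF that(1)] abs_mult)
  \<comment> \<open>The product-to-sum formula turns the weighted integral into three integrals
    covered by the induction hypothesis, with functionals tk, tk + l and tk - l.\<close>
  have expand: "(\<integral>x. w x * (1 + cos (l \<bullet> x + \<theta>)) * cos (t * (k \<bullet> x) + \<phi>) \<partial>M)
     = (\<integral>x. w x * cos ((t *\<^sub>R k) \<bullet> x + \<phi>) \<partial>M)
       + (\<integral>x. w x * cos ((t *\<^sub>R k + l) \<bullet> x + (\<phi> + \<theta>)) \<partial>M) / 2
       + (\<integral>x. w x * cos ((t *\<^sub>R k - l) \<bullet> x + (\<phi> - \<theta>)) \<partial>M) / 2"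
    if M: "sets M = sets borel" "finite_measure M" for M t \<phi> l \<theta>
  proof -
    have e: "w x * (1 + cos (l \<bullet> x + \<theta>)) * cos (t * (k \<bullet> x) + \<phi>) =
      w x * cos ((t *\<^sub>R k) \<bullet> x + \<phi>) + w x * cos ((t *\<^sub>R k + l) \<bullet> x + (\<phi> + \<theta>)) / 2
       + w x * cos ((t *\<^sub>R k - l) \<bullet> x + (\<phi> - \<theta>)) / 2" for x
    proof -
      have "cos a * cos b = cos (a + b) / 2 + cos (a - b) / 2" for a b :: real by (simp add: cos_add cos_diff field_simps)
      from this[of "t * (k \<bullet> x) + \<phi>" "l \<bullet> x + \<theta>"]
      have *: "cos (t * (k \<bullet> x) + \<phi>) * cos (l \<bullet> x + \<theta>) = cos ((t *\<^sub>R k + l) \<bullet> x + (\<phi> + \<theta>)) / 2 + cos ((t *\<^sub>R k - l) \<bullet> x + (\<phi> - \<theta>)) / 2"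
        by (simp add: inner_simps algebra_simps)
      have "w x * (1 + cos (l \<bullet> x + \<theta>)) * cos (t * (k \<bullet> x) + \<phi>) = w x * cos (t * (k \<bullet> x) + \<phi>) + w x * (cos (t * (k \<bullet> x) + \<phi>) * cos (l \<bullet> x + \<theta>))"
        by (simp add: algebra_simps)
      then show ?thesis unfolding * by (simp add: algebra_simps)
    qed
    have c2: "\<bar>cos z\<bar> \<le> 2" for z :: real using abs_cos_le_one[of z] by linarith
    have i: "integrable M (\<lambda>x. w x * cos (l \<bullet> x + \<theta>))" for l \<theta>
      by (rule intg[OF M _ c2]) measurable
    show ?thesis unfolding e
      using i[of "t *\<^sub>R k" \<phi>] i[of "t *\<^sub>R k + l" "\<phi> + \<theta>"] i[of "t *\<^sub>R k - l" "\<phi> - \<theta>"]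
      by (simp only: Bochner_Integration.integral_add Bochner_Integration.integrable_add integrable_divide integral_divide_zero)
  qed
  have key: "(\<integral>x. w x * (1 + cos (l \<bullet> x + \<theta>)) * indicator A (k \<bullet> x) \<partial>\<mu>) = (\<integral>x. w x * (1 + cos (l \<bullet> x + \<theta>)) * indicator A (k \<bullet> x) \<partial>\<nu>)" for l \<theta>
  proof (rule integral_weight_indicator_eq[OF fin sets _ _ _ _ A])
    fix x
    have *: "0 \<le> 1 + cos (l \<bullet> x + \<theta>)" "1 + cos (l \<bullet> x + \<theta>) \<le> 2"
      using cos_ge_minus_one[of "l \<bullet> x + \<theta>"] cos_le_one[of "l \<bullet> x + \<theta>"] by linarith+
    show "0 \<le> w x * (1 + cos (l \<bullet> x + \<theta>))" using w01[of x] * by simp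
    show "w x * (1 + cos (l \<bullet> x + \<theta>)) \<le> 2" using mult_mono[OF w01(2)[of x] *(2)] * by simp
  next
    show "(\<lambda>x. w x * (1 + cos (l \<bullet> x + \<theta>))) \<in> borel_measurable borel" by measurable
    fix t \<phi>
    show "(\<integral>x. w x * (1 + cos (l \<bullet> x + \<theta>)) * cos (t * (k \<bullet> x) + \<phi>) \<partial>\<mu>) = (\<integral>x. w x * (1 + cos (l \<bullet> x + \<theta>)) * cos (t * (k \<bullet> x) + \<phi>) \<partial>\<nu>)"
      unfolding expand[OF sets(1) fin(1)] expand[OF sets(2) fin(2)] IH ..
  qed
  \<comment> \<open>For l = 0 and phase 0 the weight is the constant 2. Half of that instance is the
    integral of the bare indicator, and subtracting it leaves the cosine alone.\<close>
  have split: "(\<integral>x. w x * (1 + cos (l \<bullet> x + \<theta>)) * indicator A (k \<bullet> x) \<partial>M) =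
     (\<integral>x. w x * (1 + cos (0 \<bullet> x + 0)) * indicator A (k \<bullet> x) \<partial>M) / 2 + (\<integral>x. w x * indicator A (k \<bullet> x) * cos (l \<bullet> x + \<theta>) \<partial>M)"
    if M: "sets M = sets borel" "finite_measure M" for M
  proof -
    have Am: "(\<lambda>x. indicator A (k \<bullet> x) :: real) \<in> borel_measurable borel" using A by measurable
    have i1: "integrable M (\<lambda>x. w x * indicator A (k \<bullet> x))"
      by (rule intg[OF M Am]) (auto simp: indicator_def)
    have i2: "integrable M (\<lambda>x. w x * (indicator A (k \<bullet> x) * cos (l \<bullet> x + \<theta>)))"
    proof (rule intg[OF M])
      show "(\<lambda>x. indicator A (k \<bullet> x) * cos (l \<bullet> x + \<theta>)) \<in> borel_measurable borel" using Am by measurable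
      fix x show "\<bar>indicator A (k \<bullet> x) * cos (l \<bullet> x + \<theta>)\<bar> \<le> 2"
        by (auto simp: indicator_def intro: order_trans[OF abs_cos_le_one])
    qed
    have "(\<integral>x. w x * (1 + cos (l \<bullet> x + \<theta>)) * indicator A (k \<bullet> x) \<partial>M) = (\<integral>x. w x * indicator A (k \<bullet> x) + w x * (indicator A (k \<bullet> x) * cos (l \<bullet> x + \<theta>)) \<partial>M)"
      by (intro Bochner_Integration.integral_cong) (auto simp: algebra_simps)
    also have "\<dots> = (\<integral>x. w x * indicator A (k \<bullet> x) \<partial>M) + (\<integral>x. w x * (indicator A (k \<bullet> x) * cos (l \<bullet> x + \<theta>)) \<partial>M)"
      by (rule Bochner_Integration.integral_add[OF i1 i2])
    also have "(\<integral>x. w x * (1 + cos (0 \<bullet> x + 0)) * indicator A (k \<bullet> x) \<partial>M) = 2 * (\<integral>x. w x * indicator A (k \<bullet> x) \<partial>M)"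
      by (simp flip: integral_mult_right_zero) (simp add: mult_ac)
    then have "(\<integral>x. w x * indicator A (k \<bullet> x) \<partial>M) = (\<integral>x. w x * (1 + cos (0 \<bullet> x + 0)) * indicator A (k \<bullet> x) \<partial>M) / 2" by linarith
    finally show ?thesis by (simp only: mult.assoc)
  qed
  have ind: "indicator {x. \<forall>(k, A)\<in>set (p # ps). k \<bullet> x \<in> A} x = w x * indicator A (k \<bullet> x)" for x
    by (auto simp: w_def p indicator_def)
  show ?case unfolding ind
    using key[of l \<theta>] key[of 0 0] split[OF sets(1) fin(1)] split[OF sets(2) fin(2)] by linarith
qed

text \<open>The weak and the norm topology have the same Borel sets on a separable space: a closed
  ball is a countable intersection of half-spaces with normals in a dense set, and an open set is a
  countable union of closed balls.\<close>

lemma sets_borel_eq_inner_cylinders: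
  "sets (borel :: 'a::{real_inner,second_countable_topology} measure)
     = sigma_sets UNIV {{x. \<forall>(k, A)\<in>set ps. k \<bullet> x \<in> A} | ps. \<forall>(k, A)\<in>set ps. A \<in> sets borel}"
  (is "_ = sigma_sets UNIV ?G")
proof (rule antisym)
  have in_borel: "{x. \<forall>(k, A)\<in>set ps. k \<bullet> x \<in> A} \<in> sets borel" if "\<forall>(k, A)\<in>set ps. A \<in> sets borel" for ps :: "('a \<times> real set) list"
  proof -
    have "{x. \<forall>(k, A)\<in>set ps. k \<bullet> x \<in> A} = (\<Inter>p\<in>set ps. (\<lambda>x. fst p \<bullet> x) -` snd p)" by auto
    moreover have "(\<lambda>x. fst p \<bullet> x) -` snd p \<in> sets borel" if p: "p \<in> set ps" for p :: "'a \<times> real set"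
    proof -
      have 1: "(\<lambda>x. fst p \<bullet> x) \<in> borel_measurable borel" by measurable
      have 2: "snd p \<in> sets borel" using \<open>\<forall>(k, A)\<in>set ps. A \<in> sets borel\<close> p by auto
      show ?thesis using measurable_sets[OF 1 2] by simp
    qed
    ultimately show ?thesis by (cases "ps = []") (auto intro!: sets.finite_INT)
  qed
  then show "sigma_sets UNIV ?G \<subseteq> sets borel"
    using sets.sigma_sets_subset[of ?G "borel :: 'a measure"] by auto
  interpret sigma_algebra UNIV "sigma_sets UNIV ?G" by (rule sigma_algebra_sigma_sets) auto
  obtain D :: "'a set" where D: "countable D" "\<And>X. open X \<Longrightarrow> X \<noteq> {} \<Longrightarrow> \<exists>d\<in>D. d \<in> X"
    using countable_dense_exists by blast
  have closD: "closure D = UNIV"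
  proof -
    have "x \<in> closure D" for x
      unfolding closure_iff_nhds_not_empty using D(2) by blast
    then show ?thesis by auto
  qed
  have half: "{x. d \<bullet> x \<le> r} \<in> sigma_sets UNIV ?G" for d r
  proof (rule sigma_sets.Basic)
    have "{x. d \<bullet> x \<le> r} = {x. \<forall>(k, A)\<in>set [(d, {..r})]. k \<bullet> x \<in> A}" by auto
    moreover have "\<forall>(k::'a, A)\<in>set [(d, {..r})]. A \<in> sets borel" by simp
    ultimately show "{x. d \<bullet> x \<le> r} \<in> ?G" by blast
  qed
  have cball: "cball a r \<in> sigma_sets UNIV ?G" if r: "r \<ge> 0" for a r
  proof -
    have "cball a r = (\<Inter>d\<in>D. {x. d \<bullet> x \<le> r * norm d + d \<bullet> a})"
    proof (intro set_eqI iffI)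
      fix x assume "x \<in> cball a r"
      then have "norm (x - a) \<le> r" by (simp add: dist_norm norm_minus_commute)
      then have "d \<bullet> (x - a) \<le> norm d * r" for d
        using norm_cauchy_schwarz[of d "x - a"] by (meson mult_left_mono norm_ge_zero order_trans)
      then show "x \<in> (\<Inter>d\<in>D. {x. d \<bullet> x \<le> r * norm d + d \<bullet> a})"
        by (auto simp: inner_simps algebra_simps)
    next
      fix x assume x: "x \<in> (\<Inter>d\<in>D. {x. d \<bullet> x \<le> r * norm d + d \<bullet> a})"
      have "closed {d. d \<bullet> x \<le> r * norm d + d \<bullet> a}" by (intro closed_Collect_le continuous_intros)
      moreover have "D \<subseteq> {d. d \<bullet> x \<le> r * norm d + d \<bullet> a}" using x by auto
      ultimately have "UNIV \<subseteq> {d. d \<bullet> x \<le> r * norm d + d \<bullet> a}" using closD by (metis closure_minimal)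
      \<comment> \<open>The inequality for dense normals extends to all by closedness; taken at the
        normal x - a it yields the bound on the distance.\<close>
      then have "(x - a) \<bullet> x \<le> r * norm (x - a) + (x - a) \<bullet> a" by auto
      moreover have "(x - a) \<bullet> x - (x - a) \<bullet> a = norm (x - a) * norm (x - a)"
        by (simp add: inner_diff_right[symmetric] power2_norm_eq_inner[symmetric] power2_eq_square del: inner_diff_right)
      ultimately have "norm (x - a) * norm (x - a) \<le> r * norm (x - a)" by linarith
      then have "norm (x - a) \<le> r" using r by (cases "norm (x - a) = 0") auto
      then show "x \<in> cball a r" by (simp add: dist_norm norm_minus_commute)
    qed
    moreover have "D \<noteq> {}" using D(2)[of UNIV] by auto
    ultimately show ?thesis using half D(1) by (auto intro!: countable_INT'')
  qed
  have opn: "U \<in> sigma_sets UNIV ?G" if U: "open U" for U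
  proof -
    define I where "I = {(a, r). a \<in> D \<and> r \<in> \<rat> \<and> 0 \<le> r \<and> cball a r \<subseteq> U}"
    have "I \<subseteq> D \<times> \<rat>" by (auto simp: I_def)
    then have cI: "countable I" using D(1) countable_rat by (meson countable_SIGMA countable_subset)
    have "U = (\<Union>(a, r)\<in>I. cball a r)"
    proof (intro set_eqI iffI)
      fix x assume "x \<in> U"
      then obtain e where e: "e > 0" "ball x e \<subseteq> U" using U open_contains_ball by blast
      obtain a where a: "a \<in> D" "a \<in> ball x (e / 3)" using D(2)[of "ball x (e / 3)"] e by auto
      \<comment> \<open>The radius exceeds e/3, so the ball around a still contains x; since e/3 +
        e/2 < e it stays inside \<open>ball x e\<close>.\<close>
      obtain r where r: "r \<in> \<rat>" "e / 3 < r" "r < e / 2" using Rats_dense_in_real[of "e / 3" "e / 2"] e by auto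
      have "cball a r \<subseteq> ball x e"
      proof
        fix y assume "y \<in> cball a r"
        then show "y \<in> ball x e" using a r dist_triangle[of x y a] e by simp
      qed
      then have "(a, r) \<in> I" using e a r by (auto simp: I_def)
      moreover have "x \<in> cball a r" using a r by (simp add: dist_commute)
      ultimately show "x \<in> (\<Union>(a, r)\<in>I. cball a r)" by blast
    qed (auto simp: I_def)
    moreover have "(\<Union>p\<in>I. case p of (a, r) \<Rightarrow> cball a r) \<in> sigma_sets UNIV ?G"
      by (rule countable_UN''[OF cI]) (auto simp: I_def intro!: cball)
    ultimately show ?thesis by metis
  qed
  show "sets borel \<subseteq> sigma_sets UNIV ?G"
  proof -
    have "sets (borel :: 'a measure) = sigma_sets UNIV {S. open S}" by (simp add: borel_def)
    also have "\<dots> \<subseteq> sigma_sets UNIV ?G" by (rule sigma_sets_mono) (use opn in auto)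
    finally show ?thesis .
  qed
qed

text \<open>Cylinders given by lists are stable under intersection, by appending the lists, and they
  generate the Borel sets. Their measures agree by the cosine identity with functional 0 and phase
  0, where the cosine is 1.\<close>

lemma finite_measure_eqI_charfun:
  fixes \<mu> \<nu> :: "'a::{real_inner,second_countable_topology} measure"
  assumes fin: "finite_measure \<mu>" "finite_measure \<nu>" and sets: "sets \<mu> = sets borel" "sets \<nu> = sets borel"
    and eq: "\<And>k. (\<integral>x. cis (k \<bullet> x) \<partial>\<mu>) = (\<integral>x. cis (k \<bullet> x) \<partial>\<nu>)"
  shows "\<mu> = \<nu>"
proof -
  let ?G = "{{x::'a. \<forall>(k, A)\<in>set ps. k \<bullet> x \<in> A} | ps. \<forall>(k, A)\<in>set ps. A \<in> sets borel}"
  have meas: "f \<in> borel_measurable M \<longleftrightarrow> f \<in> borel_measurable borel"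
    if "sets M = sets borel" for M :: "'a measure" and f :: "'a \<Rightarrow> 'd::topological_space"
    using that by (simp cong: measurable_cong_sets)
  have cs: "(\<integral>x. cos (l \<bullet> x + \<theta>) \<partial>M) = Re (cis \<theta> * (\<integral>x. cis (l \<bullet> x) \<partial>M))"
    if M: "sets M = sets borel" "finite_measure M" for M and l :: 'a and \<theta>
  proof -
    have "(\<lambda>x. cis (l \<bullet> x)) \<in> borel_measurable borel" by measurable
    then have "integrable M (\<lambda>x. cis (l \<bullet> x))"
      by (intro finite_measure.integrable_const_bound[OF M(2), where B = 1]) (auto simp: meas[OF M(1)])
    then have "integrable M (\<lambda>x. cis \<theta> * cis (l \<bullet> x))" by simp
    then have "(\<integral>x. Re (cis \<theta> * cis (l \<bullet> x)) \<partial>M) = Re (\<integral>x. cis \<theta> * cis (l \<bullet> x) \<partial>M)" by (rule integral_Re)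
    also have "(\<integral>x. cis \<theta> * cis (l \<bullet> x) \<partial>M) = cis \<theta> * (\<integral>x. cis (l \<bullet> x) \<partial>M)" by (rule integral_mult_right_zero)
    also have "(\<lambda>x. Re (cis \<theta> * cis (l \<bullet> x))) = (\<lambda>x. cos (l \<bullet> x + \<theta>))"
      by (simp only: cis_mult cis.sel add.commute)
    finally show ?thesis .
  qed
  have eq': "(\<integral>x. cos (l \<bullet> x + \<theta>) \<partial>\<mu>) = (\<integral>x. cos (l \<bullet> x + \<theta>) \<partial>\<nu>)" for l \<theta>
    by (simp only: cs[OF sets(1) fin(1)] cs[OF sets(2) fin(2)] eq)
  have emeq: "emeasure \<mu> X = emeasure \<nu> X" if X: "X \<in> ?G" for X
  proof -
    obtain ps where ps: "X = {x. \<forall>(k, A)\<in>set ps. k \<bullet> x \<in> A}" "\<forall>(k, A)\<in>set ps. A \<in> sets borel" using X by blast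
    have "X \<in> sets borel"
      by (rule subsetD[OF equalityD2[OF sets_borel_eq_inner_cylinders] sigma_sets.Basic[OF X]])
    moreover have "(\<integral>x. indicator X x * cos (0 \<bullet> x + 0) \<partial>\<mu>) = (\<integral>x. indicator X x * cos (0 \<bullet> x + 0) \<partial>\<nu>)"
      unfolding ps(1) by (rule integral_cylinder_cos_eq[OF fin sets eq' ps(2)])
    ultimately have "measure \<mu> X = measure \<nu> X" using sets sets_eq_imp_space_eq[OF sets(1)] sets_eq_imp_space_eq[OF sets(2)] by simp
    then show ?thesis by (simp add: finite_measure.emeasure_eq_measure[OF fin(1)] finite_measure.emeasure_eq_measure[OF fin(2)])
  qed
  show ?thesis
  proof (rule measure_eqI_generator_eq[where E = ?G and \<Omega> = UNIV and A = "\<lambda>_. UNIV"])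
    show "Int_stable ?G"
    proof (rule Int_stableI)
      fix a b assume "a \<in> ?G" "b \<in> ?G"
      then obtain ps qs where "a = {x. \<forall>(k, A)\<in>set ps. k \<bullet> x \<in> A}" "b = {x. \<forall>(k, A)\<in>set qs. k \<bullet> x \<in> A}"
        and *: "\<forall>(k, A)\<in>set ps. A \<in> sets borel" "\<forall>(k, A)\<in>set qs. A \<in> sets borel" by blast
      then have "a \<inter> b = {x. \<forall>(k, A)\<in>set (ps @ qs). k \<bullet> x \<in> A}" by auto
      moreover have "\<forall>(k, A)\<in>set (ps @ qs). A \<in> sets borel" using * by auto
      ultimately show "a \<inter> b \<in> ?G" by blast
    qed
    show "range (\<lambda>_::nat. UNIV) \<subseteq> ?G" by (auto intro!: exI[of _ "[]"])
    show "emeasure \<mu> UNIV \<noteq> \<infinity>" by (simp add: finite_measure.emeasure_eq_measure[OF fin(1)])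
    show "sets \<mu> = sigma_sets UNIV ?G" "sets \<nu> = sigma_sets UNIV ?G"
      by (rule trans[OF sets(1) sets_borel_eq_inner_cylinders], rule trans[OF sets(2) sets_borel_eq_inner_cylinders])
  qed (rule emeq | simp)+
qed

section \<open>The Cameron--Martin shift\<close>

text \<open>The one-dimensional Cameron--Martin formula: completing the square shows that the
  exponential factor is the quotient of the shifted normal density by the original one.\<close>

lemma std_normal_shift:
  fixes G :: "real \<Rightarrow> real"
  assumes [measurable]: "G \<in> borel_measurable borel"
  shows "(\<integral>z. G z * exp (\<delta> * z - \<delta>\<^sup>2 / 2) \<partial>std_normal_distribution) = (\<integral>z. G (z + \<delta>) \<partial>std_normal_distribution)"
proof -
  have *: "std_normal_density z * exp (\<delta> * z - \<delta>\<^sup>2 / 2) = std_normal_density (z - \<delta>)" for z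
    by (simp add: std_normal_density_def flip: exp_add) (simp add: power2_eq_square field_simps)
  have "(\<integral>z. G z * exp (\<delta> * z - \<delta>\<^sup>2 / 2) \<partial>std_normal_distribution) = (\<integral>z. std_normal_density (z - \<delta>) * G z \<partial>lborel)"
    by (subst integral_density) (auto simp: mult_ac simp flip: *)
  also have "\<dots> = (\<integral>z. std_normal_density z * G (z + \<delta>) \<partial>lborel)"
    by (subst lborel_integral_real_affine[where t = \<delta> and c = 1]) (auto simp: add.commute)
  also have "\<dots> = (\<integral>z. G (z + \<delta>) \<partial>std_normal_distribution)"
    by (subst integral_density) auto
  finally show ?thesis .
qed

lemma std_normal_exp_integrable: "integrable std_normal_distribution (\<lambda>z. exp (\<delta> * z - \<delta>\<^sup>2 / 2))"
proof -
  have *: "std_normal_density z * exp (\<delta> * z - \<delta>\<^sup>2 / 2) = std_normal_density (z - \<delta>)" for z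
    by (simp add: std_normal_density_def flip: exp_add) (simp add: power2_eq_square field_simps)
  have "integrable lborel (\<lambda>z. std_normal_density (- \<delta> + 1 * z))"
    by (subst lborel_integrable_real_affine_iff) (auto intro: integrable_std_normal_moment[of 0, simplified])
  then show ?thesis by (subst integrable_density) (auto simp: *)
qed

text \<open>Here \<open>p k\<close>, \<open>m\<close> and \<open>q\<close> are the variance of
  \<open>k \<bullet> \<xi>\<close>, the covariance of \<xi> with \<open>Z\<close> and the variance
  of \<open>Z\<close>. They enter only through the joint characteristic function, so no moments have
  to be known beforehand; the exponential moments of \<open>Z\<close> are part of the
  conclusion.\<close>

lemma gaussian_shift:
  fixes M :: "'w measure" and \<xi> :: "'w \<Rightarrow> 'h::{real_inner,second_countable_topology}"
  assumes M: "prob_space M" and \<xi> [measurable]: "\<xi> \<in> borel_measurable M" and Z [measurable]: "Z \<in> borel_measurable M"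
    and char: "\<And>k b. (\<integral>\<omega>. cis (k \<bullet> \<xi> \<omega> + b * Z \<omega>) \<partial>M) = complex_of_real (exp (- (p k + 2 * b * (k \<bullet> m) + b\<^sup>2 * q) / 2))"
    and q: "q > 0"
    and f [measurable]: "f \<in> borel_measurable borel" and C: "\<And>z. \<bar>f z\<bar> \<le> C"
  shows "integrable M (\<lambda>\<omega>. exp (\<epsilon> * Z \<omega>))"
    and "(\<integral>\<omega>. f (\<xi> \<omega> + \<epsilon> *\<^sub>R m) \<partial>M) = (\<integral>\<omega>. f (\<xi> \<omega>) * exp (\<epsilon> * Z \<omega> - \<epsilon>\<^sup>2 * q / 2) \<partial>M)"
proof -
  interpret prob_space M by fact
  define a where "a = sqrt q"
  have a: "a > 0" "a\<^sup>2 = q" using q by (auto simp: a_def)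
  define Z' where "Z' \<omega> = Z \<omega> / a" for \<omega>
  define \<eta> where "\<eta> \<omega> = \<xi> \<omega> - (Z \<omega> / q) *\<^sub>R m" for \<omega>
  define n where "n = (1 / a) *\<^sub>R m"
  have [measurable]: "Z' \<in> borel_measurable M" "\<eta> \<in> borel_measurable M"
    unfolding Z'_def[abs_def] \<eta>_def[abs_def] by measurable
  have \<xi>_eq: "\<xi> \<omega> = \<eta> \<omega> + Z' \<omega> *\<^sub>R n" for \<omega>
    using a by (simp add: \<eta>_def Z'_def n_def a(2)[symmetric] power2_eq_square)
  have Z_eq: "Z \<omega> = a * Z' \<omega>" for \<omega> using a by (simp add: Z'_def)
  \<comment> \<open>The variance of \<open>k \<bullet> \<eta>\<close>: removing the component along
    \<open>Z\<close> lowers \<open>p k\<close> by the explained part. In the joint characteristic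
    function the cross term disappears, which is the independence of \<eta> and
    \<open>Z'\<close>.\<close>
  define r where "r k = p k - (k \<bullet> m)\<^sup>2 / q" for k
  have char': "(\<integral>\<omega>. cis (k \<bullet> \<eta> \<omega> + b * Z' \<omega>) \<partial>M) = complex_of_real (exp (- (r k + b\<^sup>2) / 2))" for k b
  proof -
    have "k \<bullet> \<eta> \<omega> + b * Z' \<omega> = k \<bullet> \<xi> \<omega> + (b / a - (k \<bullet> m) / q) * Z \<omega>" for \<omega>
      by (simp add: \<eta>_def Z'_def inner_simps algebra_simps)
    moreover have "p k + 2 * (b / a - (k \<bullet> m) / q) * (k \<bullet> m) + (b / a - (k \<bullet> m) / q)\<^sup>2 * q = r k + b\<^sup>2"
    proof -
      have e1: "(b / a)\<^sup>2 * q = b\<^sup>2" using a by (simp add: power_divide a(2)[symmetric])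
      have "(\<beta> - c / q)\<^sup>2 * q = \<beta>\<^sup>2 * q - 2 * \<beta> * c + c\<^sup>2 / q" for \<beta> c :: real
        using q by (simp add: power2_diff field_simps power2_eq_square)
      from this[of "b / a" "k \<bullet> m"] show ?thesis unfolding e1 r_def using q by (simp add: field_simps power2_eq_square)
    qed
    ultimately show ?thesis using char[of k "b / a - (k \<bullet> m) / q"] by simp
  qed
  have charZ: "(\<integral>\<omega>. cis (b * Z' \<omega>) \<partial>M) = complex_of_real (exp (- (b\<^sup>2) / 2))" for b
  proof -
    \<comment> \<open>Total mass 1 at k = 0 and b = 0 forces \<open>r 0\<close> to vanish, so the
      slice k = 0 is exactly the standard normal characteristic function.\<close>
    have "complex_of_real (exp (- (r 0 / 2))) = complex_of_real 1" using char'[of 0 0] by (simp add: prob_space)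
    then have "r 0 = 0" unfolding of_real_eq_iff by simp
    then show ?thesis using char'[of 0 b] by simp
  qed
  have charE: "(\<integral>\<omega>. cis (k \<bullet> \<eta> \<omega>) \<partial>M) = complex_of_real (exp (- r k / 2))" for k
    using char'[of k 0] by simp
  have lawZ: "distr M borel Z' = std_normal_distribution"
  proof (rule Levy_uniqueness)
    show "real_distribution (distr M borel Z')" by (simp add: real_distribution_distr)
    show "real_distribution std_normal_distribution" by (rule real_dist_normal_dist)
    show "Characteristic_Functions.char (distr M borel Z') = Characteristic_Functions.char std_normal_distribution"
      unfolding char_std_normal_distribution
      using charZ by (intro ext) (simp add: Characteristic_Functions.char_def integral_distr cis_conv_exp)
  qed
  define L where "L = distr M borel \<eta>"
  interpret L: prob_space L unfolding L_def by (rule prob_space_distr) simp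
  interpret N: prob_space std_normal_distribution by (rule prob_space_normal_density) simp
  interpret LN: pair_prob_space L std_normal_distribution ..
  have setsL [measurable_cong]: "sets L = sets borel" by (simp add: L_def)
  have setsN: "sets std_normal_distribution = sets borel" by simp
  have setsP: "sets (L \<Otimes>\<^sub>M std_normal_distribution) = sets borel"
    unfolding borel_prod[symmetric] by (rule sets_pair_measure_cong[OF setsL setsN])
  have law: "distr M borel (\<lambda>\<omega>. (\<eta> \<omega>, Z' \<omega>)) = L \<Otimes>\<^sub>M std_normal_distribution"
  proof (rule finite_measure_eqI_charfun)
    show "finite_measure (distr M borel (\<lambda>\<omega>. (\<eta> \<omega>, Z' \<omega>)))"
      by (intro prob_space.finite_measure prob_space_distr) simp
    show "finite_measure (L \<Otimes>\<^sub>M std_normal_distribution)" by (rule LN.finite_measure)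
    fix kb :: "'h \<times> real"
    obtain k b where kb: "kb = (k, b)" by (cases kb)
    have "(\<integral>x. cis (kb \<bullet> x) \<partial>distr M borel (\<lambda>\<omega>. (\<eta> \<omega>, Z' \<omega>))) = (\<integral>\<omega>. cis (k \<bullet> \<eta> \<omega> + b * Z' \<omega>) \<partial>M)"
      by (subst integral_distr) (simp_all add: kb inner_Pair)
    also have "\<dots> = (\<integral>\<omega>. cis (k \<bullet> \<eta> \<omega>) \<partial>M) * (\<integral>\<omega>. cis (b * Z' \<omega>) \<partial>M)"
      unfolding char' charZ charE by (simp add: add_divide_distrib exp_add[symmetric] flip: of_real_mult)
    also have "\<dots> = (\<integral>x. cis (k \<bullet> x) \<partial>L) * (\<integral>z. cis (b * z) \<partial>std_normal_distribution)"
      unfolding L_def lawZ[symmetric] by (simp add: integral_distr)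
    also have "\<dots> = (\<integral>x. (\<integral>z. cis (k \<bullet> x) * cis (b * z) \<partial>std_normal_distribution) \<partial>L)"
      by simp
    also have "\<dots> = (\<integral>y. cis (k \<bullet> fst y) * cis (b * snd y) \<partial>(L \<Otimes>\<^sub>M std_normal_distribution))"
    proof -
      have "integrable (L \<Otimes>\<^sub>M std_normal_distribution) (\<lambda>y. cis (k \<bullet> fst y) * cis (b * snd y))"
        by (rule LN.integrable_const_bound[where B = 1]) (auto simp: norm_mult)
      from LN.integral_fst'[OF this] show ?thesis by simp
    qed
    also have "\<dots> = (\<integral>x. cis (kb \<bullet> x) \<partial>(L \<Otimes>\<^sub>M std_normal_distribution))"
      by (intro Bochner_Integration.integral_cong) (auto simp: kb inner_Pair cis_mult split: prod.splits)
    finally show "(\<integral>x. cis (kb \<bullet> x) \<partial>distr M borel (\<lambda>\<omega>. (\<eta> \<omega>, Z' \<omega>))) = (\<integral>x. cis (kb \<bullet> x) \<partial>(L \<Otimes>\<^sub>M std_normal_distribution))" .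
  qed (rule setsP | simp)+
  have trans: "(\<integral>\<omega>. h (\<eta> \<omega>, Z' \<omega>) \<partial>M) = (\<integral>x. (\<integral>z. h (x, z) \<partial>std_normal_distribution) \<partial>L)"
    if h [measurable]: "h \<in> borel_measurable borel" and int: "integrable M (\<lambda>\<omega>. h (\<eta> \<omega>, Z' \<omega>))" for h :: "'h \<times> real \<Rightarrow> real"
  proof -
    have "integrable (L \<Otimes>\<^sub>M std_normal_distribution) h"
      unfolding law[symmetric] using int by (subst integrable_distr_eq) auto
    from LN.integral_fst'[OF this] have "(\<integral>x. (\<integral>z. h (x, z) \<partial>std_normal_distribution) \<partial>L) = (\<integral>y. h y \<partial>distr M borel (\<lambda>\<omega>. (\<eta> \<omega>, Z' \<omega>)))"
      unfolding law by simp
    also have "\<dots> = (\<integral>\<omega>. h (\<eta> \<omega>, Z' \<omega>) \<partial>M)" by (rule integral_distr) auto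
    finally show ?thesis by simp
  qed
  have exp_int: "integrable M (\<lambda>\<omega>. exp (\<delta> * Z' \<omega> - \<delta>\<^sup>2 / 2))" for \<delta>
    using std_normal_exp_integrable[of \<delta>] unfolding lawZ[symmetric] by (subst (asm) integrable_distr_eq) auto
  show "integrable M (\<lambda>\<omega>. exp (\<epsilon> * Z \<omega>))"
  proof -
    have "integrable M (\<lambda>\<omega>. exp ((\<epsilon> * a)\<^sup>2 / 2) * exp ((\<epsilon> * a) * Z' \<omega> - (\<epsilon> * a)\<^sup>2 / 2))"
      by (intro integrable_mult_right exp_int)
    then show ?thesis by (simp add: Z_eq mult.assoc flip: exp_add)
  qed
  \<comment> \<open>Shifting \<xi> by \<epsilon> m is shifting the normalised coordinate
    \<open>Z'\<close> by this amount, because m = a n; \<eta> is left alone.\<close>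
  define \<delta> where "\<delta> = \<epsilon> * a"
  have [measurable]: "fst \<in> borel_measurable (borel :: ('h \<times> real) measure)" "snd \<in> borel_measurable (borel :: ('h \<times> real) measure)"
    by (intro borel_measurable_continuous_onI continuous_intros)+
  have fb: "integrable M (\<lambda>\<omega>. f (g \<omega>))" if "g \<in> borel_measurable M" for g
    using that C by (intro integrable_const_bound[where B = C]) auto
  have "(\<integral>\<omega>. f (\<xi> \<omega>) * exp (\<epsilon> * Z \<omega> - \<epsilon>\<^sup>2 * q / 2) \<partial>M) = (\<integral>\<omega>. f (\<eta> \<omega> + Z' \<omega> *\<^sub>R n) * exp (\<delta> * Z' \<omega> - \<delta>\<^sup>2 / 2) \<partial>M)"
    by (simp add: \<xi>_eq Z_eq \<delta>_def a(2)[symmetric] power_mult_distrib mult.assoc)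
  also have "\<dots> = (\<integral>x. (\<integral>z. f (x + z *\<^sub>R n) * exp (\<delta> * z - \<delta>\<^sup>2 / 2) \<partial>std_normal_distribution) \<partial>L)"
  proof (subst trans[of "\<lambda>(x, z). f (x + z *\<^sub>R n) * exp (\<delta> * z - \<delta>\<^sup>2 / 2)", simplified])
    have b: "\<bar>f z * exp t\<bar> \<le> C * exp t" for z t using C[of z] by (simp add: abs_mult mult_right_mono)
    show "integrable M (\<lambda>\<omega>. f (\<eta> \<omega> + Z' \<omega> *\<^sub>R n) * exp (\<delta> * Z' \<omega> - \<delta>\<^sup>2 / 2))"
      by (rule Bochner_Integration.integrable_bound[OF integrable_mult_right[OF exp_int[of \<delta>], of C]])
         (auto intro!: AE_I2 order_trans[OF b])
  qed (auto simp: split_beta')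
  also have "\<dots> = (\<integral>x. (\<integral>z. f (x + (z + \<delta>) *\<^sub>R n) \<partial>std_normal_distribution) \<partial>L)"
    by (intro Bochner_Integration.integral_cong refl std_normal_shift) measurable
  also have "\<dots> = (\<integral>\<omega>. f (\<eta> \<omega> + (Z' \<omega> + \<delta>) *\<^sub>R n) \<partial>M)"
    by (subst trans[of "\<lambda>(x, z). f (x + (z + \<delta>) *\<^sub>R n)", simplified]) (auto simp: split_beta' intro!: fb)
  also have "\<dots> = (\<integral>\<omega>. f (\<xi> \<omega> + \<epsilon> *\<^sub>R m) \<partial>M)"
    using a by (simp add: \<xi>_eq \<delta>_def n_def add_divide_distrib scaleR_add_left add.assoc)
  finally show "(\<integral>\<omega>. f (\<xi> \<omega> + \<epsilon> *\<^sub>R m) \<partial>M) = (\<integral>\<omega>. f (\<xi> \<omega>) * exp (\<epsilon> * Z \<omega> - \<epsilon>\<^sup>2 * q / 2) \<partial>M)" ..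
qed

text \<open>A second order remainder with a majorant that depends on z only through exp(2z) and
  exp(-2z), both integrable for Gaussian z. It serves to differentiate the Cameron--Martin density
  at \<epsilon> = 0 under the expectation.\<close>

lemma exp_remainder_bound:
  fixes z \<epsilon> q :: real
  assumes "\<bar>\<epsilon>\<bar> \<le> 1" "q \<ge> 0"
  shows "\<bar>exp (\<epsilon> * z - \<epsilon>\<^sup>2 * q / 2) - 1 - \<epsilon> * z\<bar> \<le> \<epsilon>\<^sup>2 * ((1 + q / 2) * (exp (2 * z) + exp (- 2 * z)))"
proof -
  define R where "R = exp (2 * z) + exp (- 2 * z)"
  define c where "c = \<epsilon>\<^sup>2 * q / 2"
  have c: "0 \<le> c" using assms by (simp add: c_def)
  have R: "exp (2 * \<bar>z\<bar>) \<le> R" by (cases "z \<ge> 0") (auto simp: R_def)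
  have e1: "\<bar>exp (\<epsilon> * z) - 1 - \<epsilon> * z\<bar> \<le> \<epsilon>\<^sup>2 * R"
  proof -
    obtain t where t: "\<bar>t\<bar> \<le> \<bar>\<epsilon> * z\<bar>" "exp (\<epsilon> * z) = (\<Sum>m<2. (\<epsilon> * z) ^ m / fact m) + exp t / fact 2 * (\<epsilon> * z) ^ 2"
      using Maclaurin_exp_le[of "\<epsilon> * z" 2] by blast
    have z2: "z\<^sup>2 / 2 \<le> exp \<bar>z\<bar>" using exp_lower_Taylor_quadratic[of "\<bar>z\<bar>"] by simp
    have "\<bar>\<epsilon> * z\<bar> \<le> \<bar>z\<bar>" using assms(1) by (simp add: abs_mult mult_left_le_one_le)
    then have "exp t \<le> exp \<bar>z\<bar>" using t by simp
    have sum2: "(\<Sum>m<2. x ^ m / fact m) = 1 + x" for x :: real by (simp add: numeral_2_eq_2)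
    have "\<bar>exp (\<epsilon> * z) - 1 - \<epsilon> * z\<bar> = \<epsilon>\<^sup>2 * (exp t * (z\<^sup>2 / 2))"
      unfolding t(2) sum2 by (simp add: abs_mult power_mult_distrib)
    also have "\<dots> \<le> \<epsilon>\<^sup>2 * (exp \<bar>z\<bar> * exp \<bar>z\<bar>)"
      using z2 \<open>exp t \<le> exp \<bar>z\<bar>\<close> by (intro mult_left_mono mult_mono) auto
    also have "exp \<bar>z\<bar> * exp \<bar>z\<bar> = exp (2 * \<bar>z\<bar>)" by (simp flip: exp_add)
    finally show ?thesis using R by (meson mult_left_mono order_trans zero_le_power2)
  qed
  have e2: "\<bar>exp (- c) - 1\<bar> \<le> c" using exp_ge_add_one_self[of "- c"] c by auto
  have e3: "\<bar>1 + \<epsilon> * z\<bar> \<le> R"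
  proof -
    have "\<bar>1 + \<epsilon> * z\<bar> \<le> 1 + \<bar>\<epsilon> * z\<bar>" by linarith
    also have "\<dots> \<le> 1 + 2 * \<bar>z\<bar>" using mult_right_mono[OF assms(1), of "\<bar>z\<bar>"] by (simp add: abs_mult)
    also have "\<dots> \<le> exp (2 * \<bar>z\<bar>)" by (rule exp_ge_add_one_self)
    finally show ?thesis using R by linarith
  qed
  \<comment> \<open>The normalising factor e^{-c} is separated from the Taylor remainder of
    e^{\<epsilon>z}; since c is of order \<epsilon>^2, each summand carries a factor
    \<epsilon>^2.\<close>
  have "exp (\<epsilon> * z - c) - 1 - \<epsilon> * z = exp (- c) * (exp (\<epsilon> * z) - 1 - \<epsilon> * z) + (exp (- c) - 1) * (1 + \<epsilon> * z)"
    by (simp add: algebra_simps exp_diff exp_minus field_simps)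
  also have "\<bar>\<dots>\<bar> \<le> exp (- c) * \<bar>exp (\<epsilon> * z) - 1 - \<epsilon> * z\<bar> + \<bar>exp (- c) - 1\<bar> * \<bar>1 + \<epsilon> * z\<bar>"
    by (rule order_trans[OF abs_triangle_ineq]) (simp add: abs_mult)
  also have "\<dots> \<le> 1 * (\<epsilon>\<^sup>2 * R) + c * R"
    using e1 e2 e3 c by (intro add_mono mult_mono) auto
  also have "\<dots> = \<epsilon>\<^sup>2 * ((1 + q / 2) * R)" by (simp add: c_def algebra_simps)
  finally show ?thesis by (simp add: R_def c_def)
qed

text \<open>For q > 0 the increment differs from its linear part by at most a constant times
  \<epsilon>^2. For q = 0 both sides vanish: a nonzero covariance with a variable of variance 0
  would make the characteristic function exceed 1 in modulus.\<close>

lemma gaussian_shift_derivative: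
  fixes M :: "'w measure" and \<xi> :: "'w \<Rightarrow> 'h::{real_inner,second_countable_topology}"
  assumes M: "prob_space M" and \<xi> [measurable]: "\<xi> \<in> borel_measurable M" and Z [measurable]: "Z \<in> borel_measurable M"
    and char: "\<And>k b. (\<integral>\<omega>. cis (k \<bullet> \<xi> \<omega> + b * Z \<omega>) \<partial>M) = complex_of_real (exp (- (p k + 2 * b * (k \<bullet> m) + b\<^sup>2 * q) / 2))"
    and q: "q \<ge> 0" and Z0: "q = 0 \<Longrightarrow> AE \<omega> in M. Z \<omega> = 0"
    and f [measurable]: "f \<in> borel_measurable borel" and C: "\<And>z. \<bar>f z\<bar> \<le> C"
  shows "((\<lambda>\<epsilon>. \<integral>\<omega>. f (\<xi> \<omega> + \<epsilon> *\<^sub>R m) \<partial>M) has_real_derivative (\<integral>\<omega>. f (\<xi> \<omega>) * Z \<omega> \<partial>M)) (at 0)"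
proof (cases "q = 0")
  case True
  interpret prob_space M by fact
  have "m = 0"
  proof (rule ccontr)
    assume "m \<noteq> 0"
    \<comment> \<open>Chosen to make the exponent's quadratic form equal to -1 at k = m, so that the
      modulus would be exp(1/2) > 1.\<close>
    define b where "b = - (p m + 1) / (2 * (m \<bullet> m))"
    have "p m + 2 * b * (m \<bullet> m) + b\<^sup>2 * q = - 1" using \<open>m \<noteq> 0\<close> True by (simp add: b_def field_simps)
    then have "norm (\<integral>\<omega>. cis (m \<bullet> \<xi> \<omega> + b * Z \<omega>) \<partial>M) = exp (1 / 2)" by (simp add: char)
    moreover have "norm (\<integral>\<omega>. cis (m \<bullet> \<xi> \<omega> + b * Z \<omega>) \<partial>M) \<le> (\<integral>\<omega>. norm (cis (m \<bullet> \<xi> \<omega> + b * Z \<omega>)) \<partial>M)"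
      by (rule integral_norm_bound)
    ultimately show False by (simp add: prob_space)
  qed
  moreover have "(\<integral>\<omega>. f (\<xi> \<omega>) * Z \<omega> \<partial>M) = 0"
    using Z0[OF True] by (intro integral_eq_zero_AE) auto
  ultimately show ?thesis by simp
next
  case False
  then have q: "q > 0" using q by simp
  interpret prob_space M by fact
  note gs = gaussian_shift[OF M \<xi> Z char q f C]
  define R where "R \<omega> = (1 + q / 2) * (exp (2 * Z \<omega>) + exp (- 2 * Z \<omega>))" for \<omega>
  have Rint: "integrable M R" unfolding R_def[abs_def]
    using gs(1)[of 2] gs(1)[of "-2"] by (intro integrable_mult_right Bochner_Integration.integrable_add) auto
  define K where "K = C * (\<integral>\<omega>. R \<omega> \<partial>M)"
  have C0: "C \<ge> 0" using C[of 0] by linarith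
  have Zint: "integrable M Z"
  proof (rule Bochner_Integration.integrable_bound[OF Rint], simp, rule AE_I2)
    fix \<omega>
    have "\<bar>Z \<omega>\<bar> \<le> exp (2 * \<bar>Z \<omega>\<bar>)" using exp_ge_add_one_self[of "2 * \<bar>Z \<omega>\<bar>"] by linarith
    also have "\<dots> \<le> exp (2 * Z \<omega>) + exp (- 2 * Z \<omega>)" by (cases "Z \<omega> \<ge> 0") auto
    also have "\<dots> \<le> R \<omega>" unfolding R_def
      using q mult_right_mono[of 1 "1 + q / 2" "exp (2 * Z \<omega>) + exp (- 2 * Z \<omega>)"] by simp
    finally show "norm (Z \<omega>) \<le> norm (R \<omega>)" by simp
  qed
  have fb: "integrable M (\<lambda>\<omega>. f (\<xi> \<omega>) * g \<omega>)" if g: "integrable M g" for g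
  proof (rule Bochner_Integration.integrable_bound[OF integrable_mult_right[OF g, of C]])
    show "(\<lambda>\<omega>. f (\<xi> \<omega>) * g \<omega>) \<in> borel_measurable M" using g by measurable
    show "AE \<omega> in M. norm (f (\<xi> \<omega>) * g \<omega>) \<le> norm (C * g \<omega>)"
      using C C0 by (auto simp: abs_mult intro!: AE_I2 mult_right_mono)
  qed
  define D where "D = (\<integral>\<omega>. f (\<xi> \<omega>) * Z \<omega> \<partial>M)"
  define \<psi> where "\<psi> \<epsilon> = (\<integral>\<omega>. f (\<xi> \<omega> + \<epsilon> *\<^sub>R m) \<partial>M)" for \<epsilon>
  have main: "\<bar>\<psi> \<epsilon> - \<psi> 0 - \<epsilon> * D\<bar> \<le> K * \<epsilon>\<^sup>2" if \<epsilon>: "\<bar>\<epsilon>\<bar> \<le> 1" for \<epsilon>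
  proof -
    have ei: "integrable M (\<lambda>\<omega>. exp (\<epsilon> * Z \<omega> - \<epsilon>\<^sup>2 * q / 2))"
      using integrable_mult_left[OF gs(1)[of \<epsilon>], of "exp (- (\<epsilon>\<^sup>2 * q / 2))"]
      by (simp flip: exp_add)
    have i1: "integrable M (\<lambda>\<omega>. f (\<xi> \<omega>) * exp (\<epsilon> * Z \<omega> - \<epsilon>\<^sup>2 * q / 2))" "integrable M (\<lambda>\<omega>. f (\<xi> \<omega>) * 1)" "integrable M (\<lambda>\<omega>. \<epsilon> * (f (\<xi> \<omega>) * Z \<omega>))"
      by (intro fb ei integrable_mult_right Zint integrable_const)+
    have "\<psi> \<epsilon> - \<psi> 0 - \<epsilon> * D = (\<integral>\<omega>. f (\<xi> \<omega>) * exp (\<epsilon> * Z \<omega> - \<epsilon>\<^sup>2 * q / 2) \<partial>M) - (\<integral>\<omega>. f (\<xi> \<omega>) * 1 \<partial>M) - (\<integral>\<omega>. \<epsilon> * (f (\<xi> \<omega>) * Z \<omega>) \<partial>M)"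
      unfolding \<psi>_def D_def gs(2) by simp
    also have "\<dots> = (\<integral>\<omega>. f (\<xi> \<omega>) * exp (\<epsilon> * Z \<omega> - \<epsilon>\<^sup>2 * q / 2) - f (\<xi> \<omega>) * 1 - \<epsilon> * (f (\<xi> \<omega>) * Z \<omega>) \<partial>M)"
      using i1 by (simp only: Bochner_Integration.integral_diff Bochner_Integration.integrable_diff)
    also have "\<dots> = (\<integral>\<omega>. f (\<xi> \<omega>) * (exp (\<epsilon> * Z \<omega> - \<epsilon>\<^sup>2 * q / 2) - 1 - \<epsilon> * Z \<omega>) \<partial>M)"
      by (intro Bochner_Integration.integral_cong) (auto simp: algebra_simps)
    finally have eq: "\<psi> \<epsilon> - \<psi> 0 - \<epsilon> * D = \<dots>" .
    have "\<bar>\<psi> \<epsilon> - \<psi> 0 - \<epsilon> * D\<bar> \<le> (\<integral>\<omega>. C * (\<epsilon>\<^sup>2 * R \<omega>) \<partial>M)"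
      unfolding eq
    proof (rule order_trans[OF integral_abs_bound], rule integral_mono)
      have "integrable M (\<lambda>\<omega>. f (\<xi> \<omega>) * (exp (\<epsilon> * Z \<omega> - \<epsilon>\<^sup>2 * q / 2) - 1 - \<epsilon> * Z \<omega>))"
        by (intro fb Bochner_Integration.integrable_diff ei integrable_const integrable_mult_right Zint)
      then show "integrable M (\<lambda>\<omega>. \<bar>f (\<xi> \<omega>) * (exp (\<epsilon> * Z \<omega> - \<epsilon>\<^sup>2 * q / 2) - 1 - \<epsilon> * Z \<omega>)\<bar>)"
        by (rule integrable_abs)
      show "integrable M (\<lambda>\<omega>. C * (\<epsilon>\<^sup>2 * R \<omega>))" by (intro integrable_mult_right Rint)
      fix \<omega>
      show "\<bar>f (\<xi> \<omega>) * (exp (\<epsilon> * Z \<omega> - \<epsilon>\<^sup>2 * q / 2) - 1 - \<epsilon> * Z \<omega>)\<bar> \<le> C * (\<epsilon>\<^sup>2 * R \<omega>)"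
        using exp_remainder_bound[OF \<epsilon>, of q "Z \<omega>"] C[of "\<xi> \<omega>"] q C0 unfolding abs_mult R_def
        by (intro mult_mono) auto
    qed
    also have "\<dots> = K * \<epsilon>\<^sup>2" by (simp add: K_def)
    finally show ?thesis .
  qed
  have "((\<lambda>h. (\<psi> (0 + h) - \<psi> 0) / h) \<longlongrightarrow> D) (at 0)"
  proof (rule Lim_transform[OF tendsto_const[of D]], rule Lim_null_comparison)
    show "((\<lambda>h. K * \<bar>h\<bar>) \<longlongrightarrow> 0) (at 0)" by (auto intro!: tendsto_eq_intros)
    have "\<forall>\<^sub>F h::real in at 0. h \<noteq> 0 \<and> \<bar>h\<bar> \<le> 1"
      unfolding eventually_at by (intro exI[of _ 1]) auto
    then show "\<forall>\<^sub>F h in at 0. norm ((\<psi> (0 + h) - \<psi> 0) / h - D) \<le> K * \<bar>h\<bar>"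
    proof eventually_elim
      case (elim h)
      have "(\<psi> (0 + h) - \<psi> 0) / h - D = (\<psi> h - \<psi> 0 - h * D) / h" using elim by (simp add: field_simps)
      then have "norm ((\<psi> (0 + h) - \<psi> 0) / h - D) = \<bar>\<psi> h - \<psi> 0 - h * D\<bar> / \<bar>h\<bar>" by simp
      also have "\<dots> \<le> (K * h\<^sup>2) / \<bar>h\<bar>" using main[of h] elim by (intro divide_right_mono) auto
      also have "\<dots> = K * \<bar>h\<bar>" using elim by (simp add: power2_eq_square field_simps abs_if)
      finally show ?case .
    qed
  qed
  then show ?thesis unfolding has_field_derivative_def[symmetric] DERIV_def \<psi>_def D_def .
qed

section \<open>Wiener integrals\<close>

text \<open>The law is identified by Levy's theorem, as a point mass if q = 0 and as a scaled
  standard normal law otherwise. The nonnegative integral is used because square integrability of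
  \<open>X\<close> is a consequence, not an assumption.\<close>

lemma gaussian_second_moment:
  assumes M: "prob_space M" and X [measurable]: "X \<in> borel_measurable M" and q: "q \<ge> 0"
    and char: "\<And>b. (\<integral>\<omega>. cis (b * X \<omega>) \<partial>M) = complex_of_real (exp (- (b\<^sup>2 * q) / 2))"
  shows "(\<integral>\<^sup>+\<omega>. ennreal ((X \<omega>)\<^sup>2) \<partial>M) = ennreal q"
proof -
  interpret prob_space M by fact
  show ?thesis
  proof (cases "q = 0")
    case True
    have "distr M borel X = return borel 0"
    proof (rule Levy_uniqueness)
      show "real_distribution (distr M borel X)" by (simp add: real_distribution_distr)
      show "real_distribution (return borel 0)"
        by (auto simp: real_distribution_def real_distribution_axioms_def prob_space_return)
      show "Characteristic_Functions.char (distr M borel X) = Characteristic_Functions.char (return borel 0)"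
        using char True by (intro ext) (simp add: Characteristic_Functions.char_def integral_distr integral_return cis_conv_exp)
    qed
    then have "(\<integral>\<^sup>+x. ennreal (x\<^sup>2) \<partial>distr M borel X) = (\<integral>\<^sup>+x. ennreal (x\<^sup>2) \<partial>return borel 0)" by simp
    then show ?thesis by (simp add: nn_integral_distr nn_integral_return True)
  next
    case False
    then have q: "q > 0" using q by simp
    define a where "a = sqrt q"
    have a: "a > 0" "a\<^sup>2 = q" using q by (auto simp: a_def)
    define Y where "Y \<omega> = X \<omega> / a" for \<omega>
    have [measurable]: "Y \<in> borel_measurable M" unfolding Y_def[abs_def] by measurable
    have "distr M borel Y = std_normal_distribution"
    proof (rule Levy_uniqueness)
      show "real_distribution (distr M borel Y)" by (simp add: real_distribution_distr)
      show "real_distribution std_normal_distribution" by (rule real_dist_normal_dist)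
      have "(\<integral>\<omega>. cis (b * Y \<omega>) \<partial>M) = complex_of_real (exp (- (b\<^sup>2) / 2))" for b
        using char[of "b / a"] a q by (simp add: Y_def power_divide)
      then show "Characteristic_Functions.char (distr M borel Y) = Characteristic_Functions.char std_normal_distribution"
        unfolding char_std_normal_distribution
        by (intro ext) (simp add: Characteristic_Functions.char_def integral_distr cis_conv_exp)
    qed
    then have "(\<integral>\<^sup>+x. ennreal (x\<^sup>2) \<partial>distr M borel Y) = (\<integral>\<^sup>+x. ennreal (x\<^sup>2) \<partial>std_normal_distribution)" by simp
    also have "\<dots> = ennreal (\<integral>x. x\<^sup>2 \<partial>std_normal_distribution)"
      by (intro nn_integral_eq_integral integrable_std_normal_distribution_moment) auto
    also have "(\<integral>x. x\<^sup>2 \<partial>std_normal_distribution) = 1"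
      using std_normal_distribution_even_moments(1)[of 1] by (simp add: fact_2)
    finally have 1: "(\<integral>\<^sup>+\<omega>. ennreal ((Y \<omega>)\<^sup>2) \<partial>M) = 1" by (simp add: nn_integral_distr)
    have "(\<integral>\<^sup>+\<omega>. ennreal ((X \<omega>)\<^sup>2) \<partial>M) = (\<integral>\<^sup>+\<omega>. ennreal q * ennreal ((Y \<omega>)\<^sup>2) \<partial>M)"
      using a by (intro nn_integral_cong) (auto simp: Y_def power_divide simp flip: ennreal_mult)
    also have "\<dots> = ennreal q" by (simp add: nn_integral_cmult 1)
    finally show ?thesis .
  qed
qed

text \<open>Step functions with real weights: \<open>W t\<close> is linear in \<open>h\<close> only almost surely, so a scalar multiple of
  a \<open>stepint\<close> is not literally a \<open>stepint\<close>.\<close>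

definition wstepfun :: "(real \<times> real \<times> 'c::real_vector \<times> real) list \<Rightarrow> real \<Rightarrow> 'c" where
  "wstepfun rs r = (\<Sum>(a, b, h, \<alpha>) \<leftarrow> rs. if a \<le> r \<and> r < b then \<alpha> *\<^sub>R h else 0)"

definition wstepint :: "(real \<Rightarrow> 'c \<Rightarrow> 'w \<Rightarrow> real) \<Rightarrow> (real \<times> real \<times> 'c \<times> real) list \<Rightarrow> 'w \<Rightarrow> real" where
  "wstepint W rs \<omega> = (\<Sum>(a, b, h, \<alpha>) \<leftarrow> rs. \<alpha> * (W b h \<omega> - W a h \<omega>))"

definition wscale :: "real \<Rightarrow> (real \<times> real \<times> 'c) list \<Rightarrow> (real \<times> real \<times> 'c \<times> real) list" where
  "wscale c ps = map (\<lambda>(a, b, h). (a, b, h, c)) ps"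

lemma wstep_append:
  "wstepfun (rs @ rs') r = wstepfun rs r + wstepfun rs' r"
  "wstepint W (rs @ rs') \<omega> = wstepint W rs \<omega> + wstepint W rs' \<omega>"
  by (simp_all add: wstepfun_def wstepint_def)

lemma wstep_wscale:
  "wstepfun (wscale c ps) r = c *\<^sub>R stepfun ps r"
  "wstepint W (wscale c ps) \<omega> = c * stepint W ps \<omega>"
  by (induction ps) (auto simp: wscale_def wstepfun_def wstepint_def stepfun_def stepint_def algebra_simps)

lemma stepfun_append: "stepfun (ps @ qs) r = stepfun ps r + stepfun qs r"
  and stepint_append: "stepint W (ps @ qs) \<omega> = stepint W ps \<omega> + stepint W qs \<omega>"
  by (simp_all add: stepfun_def stepint_def)

section \<open>The isometry on step functions\<close>

text \<open>The left side is the covariance of the Brownian increments over [a, b] and [c, d]; the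
  right side is the length of the overlap of the intervals.\<close>

lemma interval_overlap:
  fixes a b c d :: real
  assumes "a \<le> b" "c \<le> d"
  shows "min b d - min b c - min a d + min a c = max 0 (min b d - max a c)"
  using assms by (auto simp: min_def max_def)

lemma integral_interval_overlap:
  fixes a b c d :: real
  shows "integrable lborel (\<lambda>r. (if a \<le> r \<and> r < b then 1 else 0) * (if c \<le> r \<and> r < d then 1 else 0 :: real))"
    and "(\<integral>r. (if a \<le> r \<and> r < b then 1 else 0) * (if c \<le> r \<and> r < d then 1 else 0 :: real) \<partial>lborel) = max 0 (min b d - max a c)"
proof -
  have eq: "(\<lambda>r. (if a \<le> r \<and> r < b then 1 else 0) * (if c \<le> r \<and> r < d then 1 else 0 :: real)) = indicator {max a c..<min b d}"
    by (auto simp: fun_eq_iff indicator_def)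
  have "emeasure lborel {max a c..<min b d} < \<infinity>"
    by (cases "max a c \<le> min b d") auto
  then show "integrable lborel (\<lambda>r. (if a \<le> r \<and> r < b then 1 else 0) * (if c \<le> r \<and> r < d then 1 else 0 :: real))"
    unfolding eq by simp
  show "(\<integral>r. (if a \<le> r \<and> r < b then 1 else 0) * (if c \<le> r \<and> r < d then 1 else 0 :: real) \<partial>lborel) = max 0 (min b d - max a c)"
    unfolding eq by (cases "max a c \<le> min b d") auto
qed

lemma sum_list_nth: "sum_list (map f xs) = (\<Sum>i<length xs. f (xs ! i))"
  by (simp add: sum_list_sum_nth atLeast0LessThan)

text \<open>The intervals in the list may overlap, so the squared norm expands into a double sum
  over pairs. It is left in the form with minima in which the covariance of a cylindrical Brownian
  motion presents it.\<close>

lemma wstepfun_norm2: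
  fixes rs :: "(real \<times> real \<times> 'c::{real_inner,second_countable_topology} \<times> real) list"
  assumes rs: "\<forall>(a, b, h, \<alpha>)\<in>set rs. 0 \<le> a \<and> a \<le> b"
  shows "integrable lborel (\<lambda>r. (norm (wstepfun rs r))\<^sup>2)"
    and "(\<integral>r. (norm (wstepfun rs r))\<^sup>2 \<partial>lborel) =
      (\<Sum>(a, b, h, \<alpha>)\<leftarrow>rs. \<Sum>(a', b', h', \<alpha>')\<leftarrow>rs. \<alpha> * \<alpha>' * (min b b' - min b a' - min a b' + min a a') * (h \<bullet> h'))"
proof -
  define n where "n = length rs"
  define a b h \<alpha> where "a i = fst (rs ! i)" and "b i = fst (snd (rs ! i))" and "h i = fst (snd (snd (rs ! i)))"
    and "\<alpha> i = snd (snd (snd (rs ! i)))" for i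
  have ab: "a i \<le> b i" if "i < n" for i
    using bspec[OF rs nth_mem[of i rs]] that by (auto simp: a_def b_def n_def split: prod.splits)
  have sf: "wstepfun rs r = (\<Sum>i<n. (if a i \<le> r \<and> r < b i then 1 else 0) *\<^sub>R (\<alpha> i *\<^sub>R h i))" for r
    unfolding wstepfun_def sum_list_nth n_def
    by (intro sum.cong) (auto simp: a_def b_def h_def \<alpha>_def split: prod.splits)
  have nrm: "(norm (wstepfun rs r))\<^sup>2 = (\<Sum>i<n. \<Sum>j<n. ((if a i \<le> r \<and> r < b i then 1 else 0) * (if a j \<le> r \<and> r < b j then 1 else 0)) * (\<alpha> i * \<alpha> j * (h i \<bullet> h j)))" for r
    unfolding power2_norm_eq_inner sf inner_sum_left inner_sum_right
    by (intro sum.cong refl) (auto simp: mult_ac inner_commute)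
  show "integrable lborel (\<lambda>r. (norm (wstepfun rs r))\<^sup>2)"
    unfolding nrm by (intro Bochner_Integration.integrable_sum integrable_mult_left integral_interval_overlap)
  have "(\<integral>r. (norm (wstepfun rs r))\<^sup>2 \<partial>lborel) = (\<Sum>i<n. \<Sum>j<n. max 0 (min (b i) (b j) - max (a i) (a j)) * (\<alpha> i * \<alpha> j * (h i \<bullet> h j)))"
    unfolding nrm
    by (subst Bochner_Integration.integral_sum, intro Bochner_Integration.integrable_sum integrable_mult_left integral_interval_overlap)
       (simp add: Bochner_Integration.integral_sum integral_interval_overlap integrable_mult_left)
  also have "\<dots> = (\<Sum>i<n. \<Sum>j<n. \<alpha> i * \<alpha> j * (min (b i) (b j) - min (b i) (a j) - min (a i) (b j) + min (a i) (a j)) * (h i \<bullet> h j))"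
    by (intro sum.cong refl) (simp add: interval_overlap[OF ab ab])
  also have "\<dots> = (\<Sum>(a, b, h, \<alpha>)\<leftarrow>rs. \<Sum>(a', b', h', \<alpha>')\<leftarrow>rs. \<alpha> * \<alpha>' * (min b b' - min b a' - min a b' + min a a') * (h \<bullet> h'))"
    unfolding sum_list_nth n_def[symmetric]
    by (intro sum.cong refl) (simp add: a_def b_def h_def \<alpha>_def split_beta' sum_list_nth n_def)
  finally show "(\<integral>r. (norm (wstepfun rs r))\<^sup>2 \<partial>lborel) =
      (\<Sum>(a, b, h, \<alpha>)\<leftarrow>rs. \<Sum>(a', b', h', \<alpha>')\<leftarrow>rs. \<alpha> * \<alpha>' * (min b b' - min b a' - min a b' + min a a') * (h \<bullet> h'))" .
qed

lemma borel_measurable_sum_list [measurable (raw)]: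
  fixes f :: "'i \<Rightarrow> 'a \<Rightarrow> 'b::{second_countable_topology,real_normed_vector}"
  shows "(\<And>i. i \<in> set xs \<Longrightarrow> f i \<in> borel_measurable M) \<Longrightarrow> (\<lambda>x. \<Sum>i\<leftarrow>xs. f i x) \<in> borel_measurable M"
  by (induction xs) auto

lemma wstepfun_measurable [measurable]:
  "wstepfun (rs :: (real \<times> real \<times> 'c::{real_inner,second_countable_topology} \<times> real) list) \<in> borel_measurable borel"
  unfolding wstepfun_def[abs_def] split_beta' by measurable

lemma stepfun_measurable [measurable]:
  "stepfun (ps :: (real \<times> real \<times> 'c::{real_inner,second_countable_topology}) list) \<in> borel_measurable borel"
  unfolding stepfun_def[abs_def] split_beta' by measurable

lemma cyl_BM_prob_space: "cyl_BM M W \<Longrightarrow> prob_space M"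
  unfolding cyl_BM_def by (rule conjunct1)

context
  fixes M :: "'w measure" and W :: "real \<Rightarrow> 'c::{real_inner,second_countable_topology} \<Rightarrow> 'w \<Rightarrow> real"
  assumes W: "cyl_BM M W"
begin

interpretation prob_space M by (rule cyl_BM_prob_space[OF W])

lemma cyl_BM_measurable: "W t h \<in> borel_measurable M"
  using W by (auto simp: cyl_BM_def)

lemma wstepint_measurable: "wstepint W rs \<in> borel_measurable M"
  unfolding wstepint_def[abs_def] split_beta'
  by (intro borel_measurable_sum_list borel_measurable_times borel_measurable_diff borel_measurable_const cyl_BM_measurable)

lemma stepint_measurable: "stepint W ps \<in> borel_measurable M"
  unfolding stepint_def[abs_def] split_beta'
  by (intro borel_measurable_sum_list borel_measurable_diff cyl_BM_measurable)

lemma wstepint_char: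
  assumes rs: "\<forall>(a, b, h, \<alpha>)\<in>set rs. 0 \<le> a \<and> a \<le> b"
  shows "(\<integral>\<omega>. cis (\<beta> * wstepint W rs \<omega>) \<partial>M) = complex_of_real (exp (- (\<beta>\<^sup>2 * (\<integral>r. (norm (wstepfun rs r))\<^sup>2 \<partial>lborel)) / 2))"
proof -
  \<comment> \<open>Every increment is split into its two time points with opposite weights, which
    is the format of the characteristic function in \<open>cyl_BM\<close>; the factor \<beta> is
    absorbed into the weights.\<close>
  define qs where "qs = concat (map (\<lambda>(a, b, h, \<alpha>). [(b, h, \<beta> * \<alpha>), (a, h, - (\<beta> * \<alpha>))]) rs)"
  have sum_qs: "(\<Sum>(t, h, \<alpha>)\<leftarrow>qs. F t h \<alpha>) = (\<Sum>(a, b, h, \<alpha>)\<leftarrow>rs. F b h (\<beta> * \<alpha>) + F a h (- (\<beta> * \<alpha>)))"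
    for F :: "real \<Rightarrow> 'c \<Rightarrow> real \<Rightarrow> real"
    unfolding qs_def by (induction rs) (auto simp: add.assoc)
  have pos: "\<forall>(t, h, a)\<in>set qs. 0 \<le> t" using rs by (fastforce simp: qs_def)
  have lin: "(\<Sum>(t, h, a)\<leftarrow>qs. a * W t h \<omega>) = \<beta> * wstepint W rs \<omega>" for \<omega>
    unfolding sum_qs wstepint_def sum_list_const_mult[symmetric]
    by (rule arg_cong[where f = sum_list]) (auto simp: algebra_simps)
  have quad: "(\<Sum>(t, h, a)\<leftarrow>qs. \<Sum>(t', h', a')\<leftarrow>qs. a * a' * min t t' * (h \<bullet> h')) = \<beta>\<^sup>2 * (\<integral>r. (norm (wstepfun rs r))\<^sup>2 \<partial>lborel)"
    unfolding sum_qs wstepfun_norm2(2)[OF rs] sum_list_const_mult[symmetric]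
    by (intro arg_cong[where f = sum_list] map_cong refl)
       (auto simp: algebra_simps power2_eq_square split_beta' simp flip: sum_list_const_mult sum_list_addf intro!: arg_cong[where f = sum_list] map_cong)
  show ?thesis
    using W pos unfolding cyl_BM_def lin[symmetric] quad[symmetric] by auto
qed

text \<open>The isometry, read off from the Gaussian law rather than computed from moments of
  \<open>W\<close>, about which \<open>cyl_BM\<close> speaks only through characteristic
  functions.\<close>

lemma wstepint_second_moment:
  assumes rs: "\<forall>(a, b, h, \<alpha>)\<in>set rs. 0 \<le> a \<and> a \<le> b"
  shows "(\<integral>\<^sup>+\<omega>. ennreal ((wstepint W rs \<omega>)\<^sup>2) \<partial>M) = (\<integral>\<^sup>+r. ennreal ((norm (wstepfun rs r))\<^sup>2) \<partial>lborel)"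
proof -
  have "(\<integral>\<^sup>+\<omega>. ennreal ((wstepint W rs \<omega>)\<^sup>2) \<partial>M) = ennreal (\<integral>r. (norm (wstepfun rs r))\<^sup>2 \<partial>lborel)"
    by (rule gaussian_second_moment[OF prob_space_axioms wstepint_measurable _ wstepint_char[OF rs]]) auto
  then show ?thesis by (subst nn_integral_eq_integral[OF wstepfun_norm2(1)[OF rs]]) auto
qed

end

section \<open>Passing to mean square limits\<close>

lemma norm_add_power2_le: "(norm (u + v))\<^sup>2 \<le> 2 * (norm u)\<^sup>2 + 2 * (norm v)\<^sup>2"
proof -
  have "(norm (u + v))\<^sup>2 \<le> (norm u + norm v)\<^sup>2" by (intro power_mono norm_triangle_ineq) auto
  also have "\<dots> \<le> 2 * (norm u)\<^sup>2 + 2 * (norm v)\<^sup>2"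
    using sum_squares_bound[of "norm u" "norm v"] by (simp add: power2_sum)
  finally show ?thesis .
qed

lemma nn_integral_norm_add_power2_le:
  fixes u v :: "'x \<Rightarrow> 'c::{real_normed_vector,second_countable_topology}"
  assumes [measurable]: "u \<in> borel_measurable M" "v \<in> borel_measurable M"
  shows "(\<integral>\<^sup>+x. ennreal ((norm (u x + v x))\<^sup>2) \<partial>M) \<le> 2 * (\<integral>\<^sup>+x. ennreal ((norm (u x))\<^sup>2) \<partial>M) + 2 * (\<integral>\<^sup>+x. ennreal ((norm (v x))\<^sup>2) \<partial>M)"
proof -
  have "(\<integral>\<^sup>+x. ennreal ((norm (u x + v x))\<^sup>2) \<partial>M) \<le> (\<integral>\<^sup>+x. ennreal (2 * (norm (u x))\<^sup>2 + 2 * (norm (v x))\<^sup>2) \<partial>M)"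
    by (intro nn_integral_mono ennreal_leI norm_add_power2_le)
  also have "\<dots> = (\<integral>\<^sup>+x. 2 * ennreal ((norm (u x))\<^sup>2) + 2 * ennreal ((norm (v x))\<^sup>2) \<partial>M)"
    by (intro nn_integral_cong) (simp add: ennreal_plus ennreal_mult)
  also have "\<dots> = 2 * (\<integral>\<^sup>+x. ennreal ((norm (u x))\<^sup>2) \<partial>M) + 2 * (\<integral>\<^sup>+x. ennreal ((norm (v x))\<^sup>2) \<partial>M)"
    by (simp add: nn_integral_add nn_integral_cmult)
  finally show ?thesis .
qed

lemma nn_integral_norm_add_power2_finite:
  fixes u v :: "'x \<Rightarrow> 'c::{real_normed_vector,second_countable_topology}"
  assumes "u \<in> borel_measurable M" "v \<in> borel_measurable M"
    and "(\<integral>\<^sup>+x. ennreal ((norm (u x))\<^sup>2) \<partial>M) < \<infinity>" "(\<integral>\<^sup>+x. ennreal ((norm (v x))\<^sup>2) \<partial>M) < \<infinity>"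
  shows "(\<integral>\<^sup>+x. ennreal ((norm (u x + v x))\<^sup>2) \<partial>M) < \<infinity>"
  by (rule le_less_trans[OF nn_integral_norm_add_power2_le[OF assms(1,2)]])
     (use assms(3,4) in \<open>auto simp: ennreal_mult_less_top\<close>)

lemma nn_integral_norm_scaleR_power2:
  fixes u :: "'x \<Rightarrow> 'c::{real_normed_vector,second_countable_topology}"
  assumes [measurable]: "u \<in> borel_measurable M"
  shows "(\<integral>\<^sup>+x. ennreal ((norm (c *\<^sub>R u x))\<^sup>2) \<partial>M) = ennreal (c\<^sup>2) * (\<integral>\<^sup>+x. ennreal ((norm (u x))\<^sup>2) \<partial>M)"
  by (subst nn_integral_cmult[symmetric]) (auto simp: power_mult_distrib ennreal_mult intro!: nn_integral_cong)

lemma integrable_norm_power2_iff: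
  fixes u :: "'x \<Rightarrow> 'c::{real_normed_vector,second_countable_topology}"
  assumes "u \<in> borel_measurable M"
  shows "integrable M (\<lambda>x. (norm (u x))\<^sup>2) \<longleftrightarrow> (\<integral>\<^sup>+x. ennreal ((norm (u x))\<^sup>2) \<partial>M) < \<infinity>"
  using assms by (simp add: integrable_iff_bounded)

lemma ennreal_tendsto_0_lincomb:
  fixes f g :: "nat \<Rightarrow> ennreal"
  assumes "f \<longlonglongrightarrow> 0" "g \<longlonglongrightarrow> 0" "c < \<infinity>" "d < \<infinity>"
  shows "(\<lambda>k. c * f k + d * g k) \<longlonglongrightarrow> 0"
proof -
  have "(\<lambda>k. c * f k + d * g k) \<longlonglongrightarrow> c * 0 + d * 0"
    using assms by (intro tendsto_add tendsto_mult_ennreal tendsto_const) auto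
  then show ?thesis by simp
qed

text \<open>Pointwise, the squares of the norms of a and b differ by at most \<delta> |b|^2 + (1 +
  1/\<delta>) |b - a|^2. Integrating, the first term is small by the choice of \<delta> and the
  second by the assumed convergence.\<close>

lemma integral_norm_power2_tendsto:
  fixes u :: "nat \<Rightarrow> 'x \<Rightarrow> 'c::{real_normed_vector,second_countable_topology}"
  assumes u [measurable]: "\<And>k. u k \<in> borel_measurable M" and v [measurable]: "v \<in> borel_measurable M"
    and fin: "(\<integral>\<^sup>+x. ennreal ((norm (v x))\<^sup>2) \<partial>M) < \<infinity>"
    and finu: "\<And>k. (\<integral>\<^sup>+x. ennreal ((norm (u k x))\<^sup>2) \<partial>M) < \<infinity>"
    and lim: "(\<lambda>k. \<integral>\<^sup>+x. ennreal ((norm (v x - u k x))\<^sup>2) \<partial>M) \<longlonglongrightarrow> 0"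
  shows "(\<lambda>k. \<integral>x. (norm (u k x))\<^sup>2 \<partial>M) \<longlonglongrightarrow> (\<integral>x. (norm (v x))\<^sup>2 \<partial>M)"
proof -
  have iv: "integrable M (\<lambda>x. (norm (v x))\<^sup>2)" and iu: "integrable M (\<lambda>x. (norm (u k x))\<^sup>2)" for k
    using fin finu by (auto simp: integrable_norm_power2_iff)
  have finm: "(\<integral>\<^sup>+x. ennreal ((norm (v x - u k x))\<^sup>2) \<partial>M) < \<infinity>" for k
    using nn_integral_norm_add_power2_finite[of v M "\<lambda>x. - u k x"] fin finu by simp
  then have id: "integrable M (\<lambda>x. (norm (v x - u k x))\<^sup>2)" for k
    by (auto simp: integrable_norm_power2_iff)
  define d where "d k = (\<integral>x. (norm (v x - u k x))\<^sup>2 \<partial>M)" for k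
  define V where "V = (\<integral>x. (norm (v x))\<^sup>2 \<partial>M)"
  have V0: "V \<ge> 0" by (simp add: V_def)
  have "(\<lambda>k. ennreal (d k)) \<longlonglongrightarrow> ennreal 0"
    using lim by (simp add: nn_integral_eq_integral[OF id] d_def)
  then have d: "d \<longlonglongrightarrow> 0" by (subst (asm) tendsto_ennreal_iff) (auto simp: d_def)
  have bound: "\<bar>(\<integral>x. (norm (u k x))\<^sup>2 \<partial>M) - V\<bar> \<le> \<delta> * V + (1 + 1 / \<delta>) * d k" if \<delta>: "\<delta> > 0" for k \<delta>
  proof -
    have pt: "\<bar>(norm a)\<^sup>2 - (norm b)\<^sup>2\<bar> \<le> \<delta> * (norm b)\<^sup>2 + (1 + 1 / \<delta>) * (norm (b - a))\<^sup>2" for a b :: 'c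
    proof -
      define x y where "x = norm b" and "y = norm (b - a)"
      have xy: "x \<ge> 0" "y \<ge> 0" by (auto simp: x_def y_def)
      have "\<bar>norm a - x\<bar> \<le> y" using norm_triangle_ineq3[of a b] by (simp add: x_def y_def norm_minus_commute)
      moreover have "norm a \<le> x + y" using norm_triangle_ineq2[of a b] by (simp add: x_def y_def norm_minus_commute)
      ultimately have "\<bar>norm a - x\<bar> * (norm a + x) \<le> y * (2 * x + y)"
        using xy by (intro mult_mono) auto
      moreover have "\<bar>(norm a)\<^sup>2 - x\<^sup>2\<bar> = \<bar>norm a - x\<bar> * (norm a + x)"
        using xy by (simp add: power2_eq_square square_diff_square_factored abs_mult mult.commute)
      moreover have "2 * x * y \<le> \<delta> * x\<^sup>2 + (1 / \<delta>) * y\<^sup>2"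
      proof -
        \<comment> \<open>Young's inequality for the cross term 2xy, with weight \<delta>.\<close>
        have "0 \<le> (\<delta> * x - y)\<^sup>2 / \<delta>" using \<delta> by simp
        also have "\<dots> = \<delta> * x\<^sup>2 + (1 / \<delta>) * y\<^sup>2 - 2 * x * y"
          using \<delta> by (simp add: power2_diff field_simps power2_eq_square)
        finally show ?thesis by simp
      qed
      ultimately have "\<bar>(norm a)\<^sup>2 - x\<^sup>2\<bar> \<le> \<delta> * x\<^sup>2 + (1 + 1 / \<delta>) * y\<^sup>2"
        by (simp add: algebra_simps power2_eq_square)
      then show ?thesis by (simp add: x_def y_def)
    qed
    have "(\<integral>x. (norm (u k x))\<^sup>2 \<partial>M) - V = (\<integral>x. (norm (u k x))\<^sup>2 - (norm (v x))\<^sup>2 \<partial>M)"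
      using iu iv by (simp add: V_def)
    also have "\<bar>\<dots>\<bar> \<le> (\<integral>x. \<delta> * (norm (v x))\<^sup>2 + (1 + 1 / \<delta>) * (norm (v x - u k x))\<^sup>2 \<partial>M)"
      by (rule order_trans[OF integral_abs_bound], rule integral_mono)
         (intro integrable_abs Bochner_Integration.integrable_diff Bochner_Integration.integrable_add integrable_mult_right iu iv id pt)+
    also have "\<dots> = \<delta> * V + (1 + 1 / \<delta>) * d k"
      using iv id by (simp add: V_def d_def)
    finally show ?thesis .
  qed
  show ?thesis unfolding V_def[symmetric]
  proof (rule LIMSEQ_I)
    fix e :: real assume e: "e > 0"
    \<comment> \<open>Half of the tolerance e is spent on \<open>\<delta> * V\<close>; the added 1
      covers \<open>V\<close> = 0.\<close>
    define \<delta> where "\<delta> = e / (2 * (V + 1))"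
    have \<delta>: "\<delta> > 0" using e V0 by (auto simp: \<delta>_def)
    have dV: "\<delta> * V < e / 2" using e V0 by (simp add: \<delta>_def field_simps)
    have "(\<lambda>k. (1 + 1 / \<delta>) * d k) \<longlonglongrightarrow> 0" using tendsto_mult_right_zero[OF d] by simp
    then have "\<forall>\<^sub>F k in sequentially. (1 + 1 / \<delta>) * d k < e / 2"
      by (rule order_tendstoD(2)) (use e in simp)
    then obtain k0 where k0: "\<And>k. k \<ge> k0 \<Longrightarrow> (1 + 1 / \<delta>) * d k < e / 2" by (auto simp: eventually_sequentially)
    have "norm ((\<integral>x. (norm (u k x))\<^sup>2 \<partial>M) - V) < e" if "k \<ge> k0" for k
      using bound[OF \<delta>, of k] dV k0[OF that] unfolding real_norm_def by linarith
    then show "\<exists>no. \<forall>n\<ge>no. norm ((\<integral>x. (norm (u n x))\<^sup>2 \<partial>M) - V) < e" by blast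
  qed
qed

lemma norm_cis_diff_le: "norm (cis a - cis b) \<le> \<bar>a - b\<bar>"
proof -
  have "cis a - cis b = cis b * (cis (a - b) - 1)" by (simp add: algebra_simps cis_mult)
  then have "norm (cis a - cis b) = norm (cis (a - b) - 1)" by (simp add: norm_mult)
  also have "\<dots> \<le> \<bar>a - b\<bar>" using iexp_approx1[of "a - b" 0] by (simp add: cis_conv_exp)
  finally show ?thesis .
qed

text \<open>The exponential is 1-Lipschitz, and t \<le> \<delta> + t^2/\<delta> trades the first
  moment of the difference for its second moment, the quantity that \<open>wiener_int\<close>
  controls.\<close>

lemma integral_cis_tendsto:
  fixes X :: "'w \<Rightarrow> real"
  assumes M: "prob_space M" and [measurable]: "\<And>k. Y k \<in> borel_measurable M" "X \<in> borel_measurable M"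
    and lim: "(\<lambda>k. \<integral>\<^sup>+\<omega>. ennreal ((X \<omega> - Y k \<omega>)\<^sup>2) \<partial>M) \<longlonglongrightarrow> 0"
  shows "(\<lambda>k. \<integral>\<omega>. cis (\<beta> * Y k \<omega>) \<partial>M) \<longlonglongrightarrow> (\<integral>\<omega>. cis (\<beta> * X \<omega>) \<partial>M)"
proof -
  interpret prob_space M by fact
  have int: "integrable M (\<lambda>\<omega>. cis (f \<omega>))" if "f \<in> borel_measurable M" for f
    using that by (intro integrable_const_bound[where B = 1]) auto
  have bound: "ennreal (norm ((\<integral>\<omega>. cis (\<beta> * Y k \<omega>) \<partial>M) - (\<integral>\<omega>. cis (\<beta> * X \<omega>) \<partial>M)))
      \<le> ennreal \<delta> + ennreal (\<beta>\<^sup>2 / \<delta>) * (\<integral>\<^sup>+\<omega>. ennreal ((X \<omega> - Y k \<omega>)\<^sup>2) \<partial>M)" if \<delta>: "\<delta> > 0" for k \<delta>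
  proof -
    have pt: "norm (cis (\<beta> * Y k \<omega>) - cis (\<beta> * X \<omega>)) \<le> \<delta> + \<beta>\<^sup>2 / \<delta> * (X \<omega> - Y k \<omega>)\<^sup>2" for \<omega>
    proof -
      define t where "t = \<bar>\<beta> * (X \<omega> - Y k \<omega>)\<bar>"
      have "norm (cis (\<beta> * Y k \<omega>) - cis (\<beta> * X \<omega>)) \<le> t"
        using norm_cis_diff_le[of "\<beta> * Y k \<omega>" "\<beta> * X \<omega>"] by (simp add: t_def algebra_simps abs_minus_commute)
      also have "t \<le> \<delta> + t\<^sup>2 / \<delta>"
      proof (cases "t \<le> \<delta>")
        case True
        then show ?thesis using \<delta> by (simp add: add_increasing2)
      next
        case False
        then have "t * \<delta> \<le> t * t" using \<delta> by (intro mult_left_mono) auto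
        then have "t \<le> t\<^sup>2 / \<delta>" using \<delta> by (simp add: field_simps power2_eq_square)
        then show ?thesis using \<delta> by simp
      qed
      finally show ?thesis by (simp add: t_def power_mult_distrib)
    qed
    have "norm ((\<integral>\<omega>. cis (\<beta> * Y k \<omega>) \<partial>M) - (\<integral>\<omega>. cis (\<beta> * X \<omega>) \<partial>M)) = norm (\<integral>\<omega>. cis (\<beta> * Y k \<omega>) - cis (\<beta> * X \<omega>) \<partial>M)"
      by (subst Bochner_Integration.integral_diff) (auto intro!: int)
    also have "ennreal \<dots> \<le> (\<integral>\<^sup>+\<omega>. norm (cis (\<beta> * Y k \<omega>) - cis (\<beta> * X \<omega>)) \<partial>M)"
      by (rule integral_norm_bound_ennreal) (intro Bochner_Integration.integrable_diff int, auto)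
    also have "\<dots> \<le> (\<integral>\<^sup>+\<omega>. ennreal (\<delta> + \<beta>\<^sup>2 / \<delta> * (X \<omega> - Y k \<omega>)\<^sup>2) \<partial>M)"
      by (intro nn_integral_mono ennreal_leI pt)
    also have "\<dots> = (\<integral>\<^sup>+\<omega>. ennreal \<delta> + ennreal (\<beta>\<^sup>2 / \<delta>) * ennreal ((X \<omega> - Y k \<omega>)\<^sup>2) \<partial>M)"
      using \<delta> by (intro nn_integral_cong) (simp flip: ennreal_mult ennreal_plus)
    also have "\<dots> = ennreal \<delta> + ennreal (\<beta>\<^sup>2 / \<delta>) * (\<integral>\<^sup>+\<omega>. ennreal ((X \<omega> - Y k \<omega>)\<^sup>2) \<partial>M)"
      by (simp add: nn_integral_add nn_integral_cmult emeasure_space_1)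
    finally show ?thesis .
  qed
  show ?thesis
  proof (rule LIMSEQ_I)
    fix e :: real assume e: "e > 0"
    have "(\<lambda>k. ennreal (\<beta>\<^sup>2 / (e / 2)) * (\<integral>\<^sup>+\<omega>. ennreal ((X \<omega> - Y k \<omega>)\<^sup>2) \<partial>M)) \<longlonglongrightarrow> ennreal (\<beta>\<^sup>2 / (e / 2)) * 0"
      by (intro tendsto_mult_ennreal tendsto_const lim) auto
    then have "\<forall>\<^sub>F k in sequentially. ennreal (\<beta>\<^sup>2 / (e / 2)) * (\<integral>\<^sup>+\<omega>. ennreal ((X \<omega> - Y k \<omega>)\<^sup>2) \<partial>M) < ennreal (e / 2)"
      using e by (intro order_tendstoD(2)) auto
    then obtain k0 where k0: "\<And>k. k \<ge> k0 \<Longrightarrow> ennreal (\<beta>\<^sup>2 / (e / 2)) * (\<integral>\<^sup>+\<omega>. ennreal ((X \<omega> - Y k \<omega>)\<^sup>2) \<partial>M) < ennreal (e / 2)"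
      by (auto simp: eventually_sequentially)
    have "norm ((\<integral>\<omega>. cis (\<beta> * Y k \<omega>) \<partial>M) - (\<integral>\<omega>. cis (\<beta> * X \<omega>) \<partial>M)) < e" if k: "k \<ge> k0" for k
    proof -
      have "ennreal (norm ((\<integral>\<omega>. cis (\<beta> * Y k \<omega>) \<partial>M) - (\<integral>\<omega>. cis (\<beta> * X \<omega>) \<partial>M))) < ennreal (e / 2) + ennreal (e / 2)"
        by (rule le_less_trans[OF bound[of "e / 2"]]) (use e k0[OF k] in \<open>auto simp: ennreal_add_left_cancel_less\<close>)
      also have "\<dots> = ennreal e" using e by (simp flip: ennreal_plus)
      finally show ?thesis by (simp add: ennreal_less_iff)
    qed
    then show "\<exists>no. \<forall>n\<ge>no. norm ((\<integral>\<omega>. cis (\<beta> * Y n \<omega>) \<partial>M) - (\<integral>\<omega>. cis (\<beta> * X \<omega>) \<partial>M)) < e" by blast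
  qed
qed

text \<open>Concatenating the two approximating lists adds both the step functions and their
  integrals, so no linearity of \<open>W\<close> in h is involved.\<close>

lemma wiener_int_add:
  fixes W :: "real \<Rightarrow> 'c::{real_inner,second_countable_topology} \<Rightarrow> 'w \<Rightarrow> real"
  assumes W: "cyl_BM M W" and 1: "wiener_int M W g1 Z1" and 2: "wiener_int M W g2 Z2"
    and [measurable]: "g1 \<in> borel_measurable borel" "g2 \<in> borel_measurable borel"
  shows "wiener_int M W (\<lambda>r. g1 r + g2 r) (\<lambda>\<omega>. Z1 \<omega> + Z2 \<omega>)"
proof -
  note [measurable] = stepint_measurable[OF W]
  have [measurable]: "Z1 \<in> borel_measurable M" "Z2 \<in> borel_measurable M" using 1 2 by (auto simp: wiener_int_def)
  obtain ps where ps: "\<And>k. \<forall>(a, b, h)\<in>set (ps k). 0 \<le> a \<and> a \<le> b"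
    "(\<lambda>k. \<integral>\<^sup>+r. ennreal ((norm (g1 r - stepfun (ps k) r))\<^sup>2) \<partial>lborel) \<longlonglongrightarrow> 0"
    "(\<lambda>k. \<integral>\<^sup>+\<omega>. ennreal ((Z1 \<omega> - stepint W (ps k) \<omega>)\<^sup>2) \<partial>M) \<longlonglongrightarrow> 0"
    using 1 unfolding wiener_int_def by blast
  obtain qs where qs: "\<And>k. \<forall>(a, b, h)\<in>set (qs k). 0 \<le> a \<and> a \<le> b"
    "(\<lambda>k. \<integral>\<^sup>+r. ennreal ((norm (g2 r - stepfun (qs k) r))\<^sup>2) \<partial>lborel) \<longlonglongrightarrow> 0"
    "(\<lambda>k. \<integral>\<^sup>+\<omega>. ennreal ((Z2 \<omega> - stepint W (qs k) \<omega>)\<^sup>2) \<partial>M) \<longlonglongrightarrow> 0"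
    using 2 unfolding wiener_int_def by blast
  have a: "(\<lambda>k. \<integral>\<^sup>+r. ennreal ((norm (g1 r + g2 r - stepfun (ps k @ qs k) r))\<^sup>2) \<partial>lborel) \<longlonglongrightarrow> 0"
  proof (rule tendsto_sandwich[OF _ _ tendsto_const ennreal_tendsto_0_lincomb[OF ps(2) qs(2), of 2 2]])
    have "(\<integral>\<^sup>+r. ennreal ((norm (g1 r + g2 r - stepfun (ps k @ qs k) r))\<^sup>2) \<partial>lborel)
      \<le> 2 * (\<integral>\<^sup>+r. ennreal ((norm (g1 r - stepfun (ps k) r))\<^sup>2) \<partial>lborel) + 2 * (\<integral>\<^sup>+r. ennreal ((norm (g2 r - stepfun (qs k) r))\<^sup>2) \<partial>lborel)" for k
      using nn_integral_norm_add_power2_le[of "\<lambda>r. g1 r - stepfun (ps k) r" lborel "\<lambda>r. g2 r - stepfun (qs k) r"]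
      by (simp add: stepfun_append algebra_simps)
    then show "\<forall>\<^sub>F k in sequentially. (\<integral>\<^sup>+r. ennreal ((norm (g1 r + g2 r - stepfun (ps k @ qs k) r))\<^sup>2) \<partial>lborel)
      \<le> 2 * (\<integral>\<^sup>+r. ennreal ((norm (g1 r - stepfun (ps k) r))\<^sup>2) \<partial>lborel) + 2 * (\<integral>\<^sup>+r. ennreal ((norm (g2 r - stepfun (qs k) r))\<^sup>2) \<partial>lborel)"
      by (rule always_eventually[OF allI])
  qed auto
  have b: "(\<lambda>k. \<integral>\<^sup>+\<omega>. ennreal ((Z1 \<omega> + Z2 \<omega> - stepint W (ps k @ qs k) \<omega>)\<^sup>2) \<partial>M) \<longlonglongrightarrow> 0"
  proof (rule tendsto_sandwich[OF _ _ tendsto_const ennreal_tendsto_0_lincomb[OF ps(3) qs(3), of 2 2]])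
    have "(\<integral>\<^sup>+\<omega>. ennreal ((Z1 \<omega> + Z2 \<omega> - stepint W (ps k @ qs k) \<omega>)\<^sup>2) \<partial>M)
      \<le> 2 * (\<integral>\<^sup>+\<omega>. ennreal ((Z1 \<omega> - stepint W (ps k) \<omega>)\<^sup>2) \<partial>M) + 2 * (\<integral>\<^sup>+\<omega>. ennreal ((Z2 \<omega> - stepint W (qs k) \<omega>)\<^sup>2) \<partial>M)" for k
      using nn_integral_norm_add_power2_le[of "\<lambda>\<omega>. Z1 \<omega> - stepint W (ps k) \<omega>" M "\<lambda>\<omega>. Z2 \<omega> - stepint W (qs k) \<omega>"]
      by (simp add: stepint_append algebra_simps)
    then show "\<forall>\<^sub>F k in sequentially. (\<integral>\<^sup>+\<omega>. ennreal ((Z1 \<omega> + Z2 \<omega> - stepint W (ps k @ qs k) \<omega>)\<^sup>2) \<partial>M)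
      \<le> 2 * (\<integral>\<^sup>+\<omega>. ennreal ((Z1 \<omega> - stepint W (ps k) \<omega>)\<^sup>2) \<partial>M) + 2 * (\<integral>\<^sup>+\<omega>. ennreal ((Z2 \<omega> - stepint W (qs k) \<omega>)\<^sup>2) \<partial>M)"
      by (rule always_eventually[OF allI])
  qed auto
  have v: "\<forall>k. \<forall>(a, b, h)\<in>set (ps k @ qs k). 0 \<le> a \<and> a \<le> b"
  proof
    fix k show "\<forall>(a, b, h)\<in>set (ps k @ qs k). 0 \<le> a \<and> a \<le> b"
      unfolding set_append using ps(1)[of k] qs(1)[of k] by (rule ball_Un[THEN iffD2, OF conjI])
  qed
  show ?thesis unfolding wiener_int_def
    using a b v by (intro conjI exI[of _ "\<lambda>k. ps k @ qs k"]) auto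
qed

lemma wiener_int_cong_AE:
  assumes 1: "wiener_int M W g Z" and Z': "Z' \<in> borel_measurable M" and AE: "AE \<omega> in M. Z \<omega> = Z' \<omega>"
  shows "wiener_int M W g Z'"
proof -
  have "(\<integral>\<^sup>+\<omega>. ennreal ((Z \<omega> - Y \<omega>)\<^sup>2) \<partial>M) = (\<integral>\<^sup>+\<omega>. ennreal ((Z' \<omega> - Y \<omega>)\<^sup>2) \<partial>M)" for Y
    by (rule nn_integral_cong_AE) (use AE in auto)
  then show ?thesis using 1 Z' unfolding wiener_int_def by simp
qed

text \<open>Every linear combination of two Wiener integrals is centred Gaussian with the expected
  variance, which is joint Gaussianity. Weighted step integrals approximate the combination, and
  both sides of their characteristic function identity pass to the limit.\<close>

lemma wiener_int_char:
  fixes W :: "real \<Rightarrow> 'c::{real_inner,second_countable_topology} \<Rightarrow> 'w \<Rightarrow> real"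
  assumes W: "cyl_BM M W" and 1: "wiener_int M W g1 Z1" and 2: "wiener_int M W g2 Z2"
    and [measurable]: "g1 \<in> borel_measurable borel" "g2 \<in> borel_measurable borel"
    and fin: "(\<integral>\<^sup>+r. ennreal ((norm (g1 r))\<^sup>2) \<partial>lborel) < \<infinity>" "(\<integral>\<^sup>+r. ennreal ((norm (g2 r))\<^sup>2) \<partial>lborel) < \<infinity>"
  shows "(\<integral>\<omega>. cis (\<beta> * (c1 * Z1 \<omega> + c2 * Z2 \<omega>)) \<partial>M)
    = complex_of_real (exp (- (\<beta>\<^sup>2 * (\<integral>r. (norm (c1 *\<^sub>R g1 r + c2 *\<^sub>R g2 r))\<^sup>2 \<partial>lborel)) / 2))"
proof -
  note [measurable] = stepint_measurable[OF W] wstepint_measurable[OF W]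
  note prob = cyl_BM_prob_space[OF W]
  have [measurable]: "Z1 \<in> borel_measurable M" "Z2 \<in> borel_measurable M" using 1 2 by (auto simp: wiener_int_def)
  obtain ps where ps: "\<And>k. \<forall>(a, b, h)\<in>set (ps k). 0 \<le> a \<and> a \<le> b"
    "(\<lambda>k. \<integral>\<^sup>+r. ennreal ((norm (g1 r - stepfun (ps k) r))\<^sup>2) \<partial>lborel) \<longlonglongrightarrow> 0"
    "(\<lambda>k. \<integral>\<^sup>+\<omega>. ennreal ((Z1 \<omega> - stepint W (ps k) \<omega>)\<^sup>2) \<partial>M) \<longlonglongrightarrow> 0"
    using 1 unfolding wiener_int_def by blast
  obtain qs where qs: "\<And>k. \<forall>(a, b, h)\<in>set (qs k). 0 \<le> a \<and> a \<le> b"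
    "(\<lambda>k. \<integral>\<^sup>+r. ennreal ((norm (g2 r - stepfun (qs k) r))\<^sup>2) \<partial>lborel) \<longlonglongrightarrow> 0"
    "(\<lambda>k. \<integral>\<^sup>+\<omega>. ennreal ((Z2 \<omega> - stepint W (qs k) \<omega>)\<^sup>2) \<partial>M) \<longlonglongrightarrow> 0"
    using 2 unfolding wiener_int_def by blast
  define rs where "rs k = wscale c1 (ps k) @ wscale c2 (qs k)" for k
  have rs: "\<forall>(a, b, h, \<alpha>)\<in>set (rs k). 0 \<le> a \<and> a \<le> b" for k
    using ps(1)[of k] qs(1)[of k] by (auto simp: rs_def wscale_def)
  have rf: "wstepfun (rs k) r = c1 *\<^sub>R stepfun (ps k) r + c2 *\<^sub>R stepfun (qs k) r" for k r
    by (simp add: rs_def wstep_append wstep_wscale)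
  have ri: "wstepint W (rs k) \<omega> = c1 * stepint W (ps k) \<omega> + c2 * stepint W (qs k) \<omega>" for k \<omega>
    by (simp add: rs_def wstep_append wstep_wscale)
  let ?v = "\<lambda>r. c1 *\<^sub>R g1 r + c2 *\<^sub>R g2 r"
  have a: "(\<lambda>k. \<integral>\<^sup>+r. ennreal ((norm (?v r - wstepfun (rs k) r))\<^sup>2) \<partial>lborel) \<longlonglongrightarrow> 0"
  proof (rule tendsto_sandwich[OF _ _ tendsto_const ennreal_tendsto_0_lincomb[OF ps(2) qs(2), of "2 * ennreal (c1\<^sup>2)" "2 * ennreal (c2\<^sup>2)"]])
    have "(\<integral>\<^sup>+r. ennreal ((norm (?v r - wstepfun (rs k) r))\<^sup>2) \<partial>lborel)
      \<le> 2 * ennreal (c1\<^sup>2) * (\<integral>\<^sup>+r. ennreal ((norm (g1 r - stepfun (ps k) r))\<^sup>2) \<partial>lborel) + 2 * ennreal (c2\<^sup>2) * (\<integral>\<^sup>+r. ennreal ((norm (g2 r - stepfun (qs k) r))\<^sup>2) \<partial>lborel)" for k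
    proof -
      have "?v r - wstepfun (rs k) r = c1 *\<^sub>R (g1 r - stepfun (ps k) r) + c2 *\<^sub>R (g2 r - stepfun (qs k) r)" for r
        by (simp add: rf algebra_simps)
      then show ?thesis
        using nn_integral_norm_add_power2_le[of "\<lambda>r. c1 *\<^sub>R (g1 r - stepfun (ps k) r)" lborel "\<lambda>r. c2 *\<^sub>R (g2 r - stepfun (qs k) r)"]
        by (simp add: nn_integral_norm_scaleR_power2 mult.assoc del: norm_scaleR)
    qed
    then show "\<forall>\<^sub>F k in sequentially. (\<integral>\<^sup>+r. ennreal ((norm (?v r - wstepfun (rs k) r))\<^sup>2) \<partial>lborel)
      \<le> 2 * ennreal (c1\<^sup>2) * (\<integral>\<^sup>+r. ennreal ((norm (g1 r - stepfun (ps k) r))\<^sup>2) \<partial>lborel) + 2 * ennreal (c2\<^sup>2) * (\<integral>\<^sup>+r. ennreal ((norm (g2 r - stepfun (qs k) r))\<^sup>2) \<partial>lborel)"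
      by (rule always_eventually[OF allI])
  qed (auto simp: ennreal_mult_less_top)
  have b: "(\<lambda>k. \<integral>\<^sup>+\<omega>. ennreal ((c1 * Z1 \<omega> + c2 * Z2 \<omega> - wstepint W (rs k) \<omega>)\<^sup>2) \<partial>M) \<longlonglongrightarrow> 0"
  proof (rule tendsto_sandwich[OF _ _ tendsto_const ennreal_tendsto_0_lincomb[OF ps(3) qs(3), of "2 * ennreal (c1\<^sup>2)" "2 * ennreal (c2\<^sup>2)"]])
    have "(\<integral>\<^sup>+\<omega>. ennreal ((c1 * Z1 \<omega> + c2 * Z2 \<omega> - wstepint W (rs k) \<omega>)\<^sup>2) \<partial>M)
      \<le> 2 * ennreal (c1\<^sup>2) * (\<integral>\<^sup>+\<omega>. ennreal ((Z1 \<omega> - stepint W (ps k) \<omega>)\<^sup>2) \<partial>M) + 2 * ennreal (c2\<^sup>2) * (\<integral>\<^sup>+\<omega>. ennreal ((Z2 \<omega> - stepint W (qs k) \<omega>)\<^sup>2) \<partial>M)" for k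
    proof -
      have e: "c1 * Z1 \<omega> + c2 * Z2 \<omega> - wstepint W (rs k) \<omega> = c1 *\<^sub>R (Z1 \<omega> - stepint W (ps k) \<omega>) + c2 *\<^sub>R (Z2 \<omega> - stepint W (qs k) \<omega>)" for \<omega>
        by (simp add: ri algebra_simps)
      have m: "(\<lambda>\<omega>. Z1 \<omega> - stepint W (ps k) \<omega>) \<in> borel_measurable M" "(\<lambda>\<omega>. Z2 \<omega> - stepint W (qs k) \<omega>) \<in> borel_measurable M"
        by measurable
      show ?thesis unfolding e
        using nn_integral_norm_add_power2_le[OF borel_measurable_scaleR[OF borel_measurable_const m(1), of c1] borel_measurable_scaleR[OF borel_measurable_const m(2), of c2]]
        unfolding nn_integral_norm_scaleR_power2[OF m(1)] nn_integral_norm_scaleR_power2[OF m(2)]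
        unfolding real_norm_def power2_abs mult.assoc .
    qed
    then show "\<forall>\<^sub>F k in sequentially. (\<integral>\<^sup>+\<omega>. ennreal ((c1 * Z1 \<omega> + c2 * Z2 \<omega> - wstepint W (rs k) \<omega>)\<^sup>2) \<partial>M)
      \<le> 2 * ennreal (c1\<^sup>2) * (\<integral>\<^sup>+\<omega>. ennreal ((Z1 \<omega> - stepint W (ps k) \<omega>)\<^sup>2) \<partial>M) + 2 * ennreal (c2\<^sup>2) * (\<integral>\<^sup>+\<omega>. ennreal ((Z2 \<omega> - stepint W (qs k) \<omega>)\<^sup>2) \<partial>M)"
      by (rule always_eventually[OF allI])
  qed (auto simp: ennreal_mult_less_top)
  have vfin: "(\<integral>\<^sup>+r. ennreal ((norm (?v r))\<^sup>2) \<partial>lborel) < \<infinity>"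
    by (rule nn_integral_norm_add_power2_finite)
       (use fin in \<open>simp_all add: nn_integral_norm_scaleR_power2 ennreal_mult_less_top del: norm_scaleR\<close>)
  have lim1: "(\<lambda>k. \<integral>\<omega>. cis (\<beta> * wstepint W (rs k) \<omega>) \<partial>M) \<longlonglongrightarrow> (\<integral>\<omega>. cis (\<beta> * (c1 * Z1 \<omega> + c2 * Z2 \<omega>)) \<partial>M)"
    by (rule integral_cis_tendsto[OF prob _ _ b]) auto
  have "(\<lambda>k. \<integral>r. (norm (wstepfun (rs k) r))\<^sup>2 \<partial>lborel) \<longlonglongrightarrow> (\<integral>r. (norm (?v r))\<^sup>2 \<partial>lborel)"
    by (rule integral_norm_power2_tendsto[OF _ _ vfin _ a])
       (use wstepfun_norm2(1)[OF rs] in \<open>auto simp: integrable_norm_power2_iff\<close>)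
  then have lim2: "(\<lambda>k. complex_of_real (exp (- (\<beta>\<^sup>2 * (\<integral>r. (norm (wstepfun (rs k) r))\<^sup>2 \<partial>lborel)) / 2)))
     \<longlonglongrightarrow> complex_of_real (exp (- (\<beta>\<^sup>2 * (\<integral>r. (norm (?v r))\<^sup>2 \<partial>lborel)) / 2))"
    by (intro tendsto_intros) auto
  show ?thesis using LIMSEQ_unique[OF lim1 lim2[folded wstepint_char[OF W rs]]] .
qed

lemma wiener_int_second_moment:
  fixes W :: "real \<Rightarrow> 'c::{real_inner,second_countable_topology} \<Rightarrow> 'w \<Rightarrow> real"
  assumes W: "cyl_BM M W" and 1: "wiener_int M W g1 Z1" and 2: "wiener_int M W g2 Z2"
    and g: "g1 \<in> borel_measurable borel" "g2 \<in> borel_measurable borel"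
    and fin: "(\<integral>\<^sup>+r. ennreal ((norm (g1 r))\<^sup>2) \<partial>lborel) < \<infinity>" "(\<integral>\<^sup>+r. ennreal ((norm (g2 r))\<^sup>2) \<partial>lborel) < \<infinity>"
  shows "integrable M (\<lambda>\<omega>. (c1 * Z1 \<omega> + c2 * Z2 \<omega>)\<^sup>2)"
    and "(\<integral>\<omega>. (c1 * Z1 \<omega> + c2 * Z2 \<omega>)\<^sup>2 \<partial>M) = (\<integral>r. (norm (c1 *\<^sub>R g1 r + c2 *\<^sub>R g2 r))\<^sup>2 \<partial>lborel)"
proof -
  note prob = cyl_BM_prob_space[OF W]
  have [measurable]: "Z1 \<in> borel_measurable M" "Z2 \<in> borel_measurable M" using 1 2 by (auto simp: wiener_int_def)
  have *: "(\<integral>\<^sup>+\<omega>. ennreal ((c1 * Z1 \<omega> + c2 * Z2 \<omega>)\<^sup>2) \<partial>M) = ennreal (\<integral>r. (norm (c1 *\<^sub>R g1 r + c2 *\<^sub>R g2 r))\<^sup>2 \<partial>lborel)"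
    by (rule gaussian_second_moment[OF prob _ _ wiener_int_char[OF W 1 2 g fin]]) auto
  show "integrable M (\<lambda>\<omega>. (c1 * Z1 \<omega> + c2 * Z2 \<omega>)\<^sup>2)"
    by (rule integrableI_nn_integral_finite[OF _ _ *]) auto
  then show "(\<integral>\<omega>. (c1 * Z1 \<omega> + c2 * Z2 \<omega>)\<^sup>2 \<partial>M) = (\<integral>r. (norm (c1 *\<^sub>R g1 r + c2 *\<^sub>R g2 r))\<^sup>2 \<partial>lborel)"
    using * by (simp add: nn_integral_eq_integral)
qed

text \<open>Polarisation of the isometry.\<close>

lemma wiener_int_covariance:
  fixes W :: "real \<Rightarrow> 'c::{real_inner,second_countable_topology} \<Rightarrow> 'w \<Rightarrow> real"
  assumes W: "cyl_BM M W" and 1: "wiener_int M W g1 Z1" and 2: "wiener_int M W g2 Z2"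
    and g [measurable]: "g1 \<in> borel_measurable borel" "g2 \<in> borel_measurable borel"
    and fin: "(\<integral>\<^sup>+r. ennreal ((norm (g1 r))\<^sup>2) \<partial>lborel) < \<infinity>" "(\<integral>\<^sup>+r. ennreal ((norm (g2 r))\<^sup>2) \<partial>lborel) < \<infinity>"
  shows "integrable M (\<lambda>\<omega>. Z1 \<omega> * Z2 \<omega>)"
    and "(\<integral>\<omega>. Z1 \<omega> * Z2 \<omega> \<partial>M) = (\<integral>r. g1 r \<bullet> g2 r \<partial>lborel)"
proof -
  note m = wiener_int_second_moment[OF W 1 2 g fin]
  have Z: "Z1 \<omega> * Z2 \<omega> = (1 / 4) * ((1 * Z1 \<omega> + 1 * Z2 \<omega>)\<^sup>2 - (1 * Z1 \<omega> + (-1) * Z2 \<omega>)\<^sup>2)" for \<omega>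
    by (simp add: power2_eq_square algebra_simps)
  show "integrable M (\<lambda>\<omega>. Z1 \<omega> * Z2 \<omega>)" unfolding Z
    by (intro integrable_mult_right Bochner_Integration.integrable_diff m)
  have i: "integrable lborel (\<lambda>r. (norm (c1 *\<^sub>R g1 r + c2 *\<^sub>R g2 r))\<^sup>2)" for c1 c2
    by (subst integrable_norm_power2_iff, simp, rule nn_integral_norm_add_power2_finite)
       (use fin in \<open>simp_all add: nn_integral_norm_scaleR_power2 ennreal_mult_less_top del: norm_scaleR\<close>)
  have G: "g1 r \<bullet> g2 r = (1 / 4) * ((norm (1 *\<^sub>R g1 r + 1 *\<^sub>R g2 r))\<^sup>2 - (norm (1 *\<^sub>R g1 r + (-1) *\<^sub>R g2 r))\<^sup>2)" for r
    unfolding power2_norm_eq_inner by (simp add: inner_simps inner_commute)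
  show "(\<integral>\<omega>. Z1 \<omega> * Z2 \<omega> \<partial>M) = (\<integral>r. g1 r \<bullet> g2 r \<partial>lborel)"
    unfolding Z G integral_mult_right_zero
    by (subst (1 2) Bochner_Integration.integral_diff, (rule m i)+) (simp only: m(2))
qed

section \<open>Density of step functions and existence of Wiener integrals\<close>

text \<open>The deterministic half of \<open>wiener_int\<close> with a tolerance in place of a
  sequence, a form that is closed under sums and mean square limits. End points are nonnegative
  because \<open>cyl_BM\<close> prescribes laws for nonnegative times only.\<close>

definition step_approximable :: "(real \<Rightarrow> 'c::real_normed_vector) \<Rightarrow> bool" where
  "step_approximable g \<longleftrightarrow> (\<forall>e>0. \<exists>ps. (\<forall>(a, b, h)\<in>set ps. 0 \<le> a \<and> a \<le> b)
     \<and> (\<integral>\<^sup>+r. ennreal ((norm (g r - stepfun ps r))\<^sup>2) \<partial>lborel) \<le> ennreal e)"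

lemma step_approximableE:
  assumes "step_approximable g" "e > 0"
  obtains ps where "\<forall>(a, b, h)\<in>set ps. 0 \<le> a \<and> a \<le> b" "(\<integral>\<^sup>+r. ennreal ((norm (g r - stepfun ps r))\<^sup>2) \<partial>lborel) \<le> ennreal e"
  using assms unfolding step_approximable_def by blast

lemma step_approximable_add:
  fixes g1 g2 :: "real \<Rightarrow> 'c::{real_inner,second_countable_topology}"
  assumes "step_approximable g1" "step_approximable g2"
    and [measurable]: "g1 \<in> borel_measurable borel" "g2 \<in> borel_measurable borel"
  shows "step_approximable (\<lambda>r. g1 r + g2 r)"
  unfolding step_approximable_def
proof (intro allI impI)
  fix e :: real assume e: "e > 0"
  then have e4: "e / 4 > 0" by simp
  obtain ps where ps: "\<forall>(a, b, h)\<in>set ps. 0 \<le> a \<and> a \<le> b" "(\<integral>\<^sup>+r. ennreal ((norm (g1 r - stepfun ps r))\<^sup>2) \<partial>lborel) \<le> ennreal (e / 4)"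
    by (rule step_approximableE[OF assms(1) e4])
  obtain qs where qs: "\<forall>(a, b, h)\<in>set qs. 0 \<le> a \<and> a \<le> b" "(\<integral>\<^sup>+r. ennreal ((norm (g2 r - stepfun qs r))\<^sup>2) \<partial>lborel) \<le> ennreal (e / 4)"
    by (rule step_approximableE[OF assms(2) e4])
  have "(\<integral>\<^sup>+r. ennreal ((norm (g1 r + g2 r - stepfun (ps @ qs) r))\<^sup>2) \<partial>lborel)
      = (\<integral>\<^sup>+r. ennreal ((norm ((g1 r - stepfun ps r) + (g2 r - stepfun qs r)))\<^sup>2) \<partial>lborel)"
    by (simp add: stepfun_append algebra_simps)
  also have "\<dots> \<le> 2 * (\<integral>\<^sup>+r. ennreal ((norm (g1 r - stepfun ps r))\<^sup>2) \<partial>lborel) + 2 * (\<integral>\<^sup>+r. ennreal ((norm (g2 r - stepfun qs r))\<^sup>2) \<partial>lborel)"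
    by (rule nn_integral_norm_add_power2_le) measurable
  also have "\<dots> \<le> ennreal 2 * ennreal (e / 4) + ennreal 2 * ennreal (e / 4)"
    using ps qs by (intro add_mono mult_mono) auto
  also have "\<dots> = ennreal e" using e by (simp flip: ennreal_mult ennreal_plus del: ennreal_numeral)
  finally show "\<exists>ps. (\<forall>(a, b, h)\<in>set ps. 0 \<le> a \<and> a \<le> b) \<and> (\<integral>\<^sup>+r. ennreal ((norm (g1 r + g2 r - stepfun ps r))\<^sup>2) \<partial>lborel) \<le> ennreal e"
    using ps(1) qs(1) by (intro exI[of _ "ps @ qs"] conjI) (auto simp: ball_Un)
qed

lemma step_approximable_limit:
  fixes g :: "real \<Rightarrow> 'c::{real_inner,second_countable_topology}"
  assumes approx: "\<And>k. step_approximable (G k)"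
    and [measurable]: "g \<in> borel_measurable borel" "\<And>k. G k \<in> borel_measurable borel"
    and lim: "(\<lambda>k::nat. \<integral>\<^sup>+r. ennreal ((norm (g r - G k r))\<^sup>2) \<partial>lborel) \<longlonglongrightarrow> 0"
  shows "step_approximable g"
  unfolding step_approximable_def
proof (intro allI impI)
  fix e :: real assume e: "e > 0"
  then have e4: "e / 4 > 0" by simp
  have "\<forall>\<^sub>F k in sequentially. (\<integral>\<^sup>+r. ennreal ((norm (g r - G k r))\<^sup>2) \<partial>lborel) < ennreal (e / 4)"
    using e by (intro order_tendstoD(2)[OF lim]) auto
  then obtain k where k: "(\<integral>\<^sup>+r. ennreal ((norm (g r - G k r))\<^sup>2) \<partial>lborel) \<le> ennreal (e / 4)"
    by (auto simp: eventually_sequentially intro: less_imp_le)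
  obtain qs where qs: "\<forall>(a, b, h)\<in>set qs. 0 \<le> a \<and> a \<le> b" "(\<integral>\<^sup>+r. ennreal ((norm (G k r - stepfun qs r))\<^sup>2) \<partial>lborel) \<le> ennreal (e / 4)"
    by (rule step_approximableE[OF approx[of k] e4])
  have "(\<integral>\<^sup>+r. ennreal ((norm (g r - stepfun qs r))\<^sup>2) \<partial>lborel)
      = (\<integral>\<^sup>+r. ennreal ((norm ((g r - G k r) + (G k r - stepfun qs r)))\<^sup>2) \<partial>lborel)"
    by simp
  also have "\<dots> \<le> 2 * (\<integral>\<^sup>+r. ennreal ((norm (g r - G k r))\<^sup>2) \<partial>lborel) + 2 * (\<integral>\<^sup>+r. ennreal ((norm (G k r - stepfun qs r))\<^sup>2) \<partial>lborel)"
    by (rule nn_integral_norm_add_power2_le) measurable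
  also have "\<dots> \<le> ennreal 2 * ennreal (e / 4) + ennreal 2 * ennreal (e / 4)"
    using k qs by (intro add_mono mult_mono) auto
  also have "\<dots> = ennreal e" using e by (simp flip: ennreal_mult ennreal_plus del: ennreal_numeral)
  finally show "\<exists>ps. (\<forall>(a, b, h)\<in>set ps. 0 \<le> a \<and> a \<le> b) \<and> (\<integral>\<^sup>+r. ennreal ((norm (g r - stepfun ps r))\<^sup>2) \<partial>lborel) \<le> ennreal e"
    using qs(1) by blast
qed

lemma step_approximable_stepfun:
  assumes "\<forall>(a, b, h)\<in>set ps. 0 \<le> a \<and> a \<le> b" "\<And>r. g r = stepfun ps r"
  shows "step_approximable g"
  unfolding step_approximable_def using assms by (intro allI impI exI[of _ ps]) auto

lemma step_approximable_uminus:
  assumes "step_approximable g"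
  shows "step_approximable (\<lambda>r. - g r)"
  unfolding step_approximable_def
proof (intro allI impI)
  fix e :: real assume "e > 0"
  then obtain ps where ps: "\<forall>(a, b, h)\<in>set ps. 0 \<le> a \<and> a \<le> b" "(\<integral>\<^sup>+r. ennreal ((norm (g r - stepfun ps r))\<^sup>2) \<partial>lborel) \<le> ennreal e"
    using assms unfolding step_approximable_def by blast
  define qs where "qs = map (\<lambda>(a, b, h). (a, b, - h)) ps"
  have "stepfun qs r = - stepfun ps r" for r
    unfolding qs_def by (induction ps) (auto simp: stepfun_def)
  then have "norm (- g r - stepfun qs r) = norm (g r - stepfun ps r)" for r
    by (simp add: norm_minus_commute)
  moreover have "\<forall>(a, b, h)\<in>set qs. 0 \<le> a \<and> a \<le> b" using ps(1) by (auto simp: qs_def)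
  ultimately show "\<exists>ps. (\<forall>(a, b, h)\<in>set ps. 0 \<le> a \<and> a \<le> b) \<and> (\<integral>\<^sup>+r. ennreal ((norm (- g r - stepfun ps r))\<^sup>2) \<partial>lborel) \<le> ennreal e"
    using ps(2) by (intro exI[of _ qs]) simp
qed

lemma step_approximable_sum:
  fixes g :: "'i \<Rightarrow> real \<Rightarrow> 'c::{real_inner,second_countable_topology}"
  assumes "finite I" "\<And>i. i \<in> I \<Longrightarrow> step_approximable (g i)" "\<And>i. i \<in> I \<Longrightarrow> g i \<in> borel_measurable borel"
  shows "step_approximable (\<lambda>r. \<Sum>i\<in>I. g i r)"
  using assms
proof (induction I rule: finite_induct)
  case empty
  then show ?case by (auto intro!: step_approximable_stepfun[of "[]"] simp: stepfun_def)
next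
  case (insert i I)
  then have "step_approximable (\<lambda>r. g i r + (\<Sum>i\<in>I. g i r))"
    by (intro step_approximable_add borel_measurable_sum) auto
  then show ?case using insert by simp
qed

text \<open>Dynkin's argument: half-open intervals are stable under intersection and generate the
  Borel sets. Cutting with [0, n) keeps the measure finite, so that disjoint unions are mean square
  limits of their finite parts by dominated convergence.\<close>

lemma step_approximable_indicator:
  fixes h :: "'c::{real_inner,second_countable_topology}"
  assumes A: "A \<in> sets borel" and n: "n \<ge> 0"
  shows "step_approximable (\<lambda>r. indicator (A \<inter> {0..<n}) r *\<^sub>R h)"
proof -
  let ?G = "range (\<lambda>(a, b). {a ..< b :: real})"
  have iv: "step_approximable (\<lambda>r. indicator {a..<b} r *\<^sub>R h)" if "0 \<le> a" for a b
  proof (cases "a \<le> b")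
    case True
    then show ?thesis using that
      by (intro step_approximable_stepfun[of "[(a, b, h)]"]) (auto simp: stepfun_def indicator_def)
  next
    case False
    then show ?thesis
      by (intro step_approximable_stepfun[of "[]"]) (auto simp: stepfun_def indicator_def)
  qed
  have As: "A \<in> sigma_sets UNIV ?G"
    using A by (subst (asm) borel_eq_atLeastLessThan) simp
  have sb: "B \<in> sets borel" if "B \<in> sigma_sets UNIV ?G" for B
    using that by (subst borel_eq_atLeastLessThan) simp
  have "Int_stable ?G"
  proof (rule Int_stableI)
    fix X Y assume "X \<in> ?G" "Y \<in> ?G"
    then obtain a b c d where "X = {a..<b}" "Y = {c..<d}" by auto
    then have "X \<inter> Y = (\<lambda>(a, b). {a..<b}) (max a c, min b d)" by auto
    then show "X \<inter> Y \<in> ?G" by blast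
  qed
  then show ?thesis using subset_UNIV[of ?G, unfolded Pow_UNIV[symmetric]] As
  proof (induction rule: sigma_sets_induct_disjoint)
    case (basic B)
    then obtain a b where "B = {a..<b}" by auto
    then have "B \<inter> {0..<n} = {max a 0..<min b n}" by auto
    then show ?case using iv[of "max a 0" "min b n"] by simp
  next
    case empty
    then show ?case by (auto intro!: step_approximable_stepfun[of "[]"] simp: stepfun_def)
  next
    case (compl B)
    note sb[OF compl(1), measurable]
    have eq: "indicator ((UNIV - B) \<inter> {0..<n}) r *\<^sub>R h = indicator {0..<n} r *\<^sub>R h + - (indicator (B \<inter> {0..<n}) r *\<^sub>R h)" for r
      by (auto simp: indicator_def)
    show ?case unfolding eq
      by (intro step_approximable_add step_approximable_uminus compl iv) auto
  next
    case (union B)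
    have [measurable]: "B i \<in> sets borel" for i using union(2) sb by auto
    define g where "g r = indicator ((\<Union>i. B i) \<inter> {0..<n}) r *\<^sub>R h" for r
    define G where "G k r = (\<Sum>i<k. indicator (B i \<inter> {0..<n}) r *\<^sub>R h)" for k r
    have G: "G k r = indicator ((\<Union>i<k. B i) \<inter> {0..<n}) r *\<^sub>R h" for k r
    proof -
      have "(\<Sum>i<k. indicator (B i \<inter> {0..<n}) r) = (indicator (\<Union>i<k. B i \<inter> {0..<n}) r :: real)"
        using union(1) by (intro indicator_UN_disjoint[symmetric]) (auto simp: disjoint_family_on_def)
      moreover have "(\<Union>i<k. B i \<inter> {0..<n}) = (\<Union>i<k. B i) \<inter> {0..<n}" by auto
      ultimately show ?thesis by (simp only: G_def scaleR_sum_left[symmetric])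
    qed
    have "step_approximable g"
    proof (rule step_approximable_limit[where G = G])
      show "step_approximable (G k)" for k
        unfolding G_def using union(3) by (intro step_approximable_sum) auto
      show [measurable]: "g \<in> borel_measurable borel" "G k \<in> borel_measurable borel" for k
        unfolding g_def[abs_def] G_def[abs_def] by measurable
      have "(\<lambda>k. \<integral>\<^sup>+r. ennreal ((norm (g r - G k r))\<^sup>2) \<partial>lborel) \<longlonglongrightarrow> (\<integral>\<^sup>+(r::real). 0 \<partial>lborel)"
      proof (rule nn_integral_dominated_convergence[where w = "\<lambda>r. ennreal ((norm h)\<^sup>2) * indicator {0..<n} r"])
        show "(\<lambda>r. ennreal ((norm (g r - G k r))\<^sup>2)) \<in> borel_measurable lborel" for k by measurable
        show "AE r in lborel. ennreal ((norm (g r - G k r))\<^sup>2) \<le> ennreal ((norm h)\<^sup>2) * indicator {0..<n} r" for k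
          by (rule AE_I2) (auto simp: g_def G indicator_def)
        show "(\<integral>\<^sup>+r. ennreal ((norm h)\<^sup>2) * indicator {0..<n} r \<partial>lborel) < \<infinity>"
          using n by (simp add: nn_integral_cmult_indicator ennreal_mult_less_top)
        show "AE r in lborel. (\<lambda>k. ennreal ((norm (g r - G k r))\<^sup>2)) \<longlonglongrightarrow> 0"
        proof (rule AE_I2)
          fix r :: real
          have "\<forall>\<^sub>F k in sequentially. ennreal ((norm (g r - G k r))\<^sup>2) = 0"
          proof (cases "\<exists>i. r \<in> B i")
            case True
            then obtain i where i: "r \<in> B i" by blast
            have "ennreal ((norm (g r - G k r))\<^sup>2) = 0" if "k \<ge> Suc i" for k
              using i that by (auto simp: g_def G indicator_def)
            then show ?thesis by (auto simp: eventually_sequentially)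
          next
            case False
            then show ?thesis by (auto simp: g_def G indicator_def)
          qed
          then show "(\<lambda>k. ennreal ((norm (g r - G k r))\<^sup>2)) \<longlonglongrightarrow> 0" by (rule tendsto_eventually)
        qed
      qed auto
      then show "(\<lambda>k. \<integral>\<^sup>+r. ennreal ((norm (g r - G k r))\<^sup>2) \<partial>lborel) \<longlonglongrightarrow> 0" by simp
    qed
    then show ?case by (simp add: g_def[abs_def])
  qed
qed

text \<open>Simple functions dominated by twice the norm of \<open>g\<close>, cut off outside [0,
  k), converge to \<open>g\<close> in mean square. The vanishing at negative times matches the
  nonnegative end points of the admissible step functions.\<close>

lemma step_approximable_L2:
  fixes g :: "real \<Rightarrow> 'c::{real_inner,second_countable_topology}"
  assumes g [measurable]: "g \<in> borel_measurable borel" and fin: "(\<integral>\<^sup>+r. ennreal ((norm (g r))\<^sup>2) \<partial>lborel) < \<infinity>"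
    and neg: "\<And>r. r < 0 \<Longrightarrow> g r = 0"
  shows "step_approximable g"
proof -
  obtain F where F: "\<And>i. simple_function borel (F i)" "\<And>r. (\<lambda>i. F i r) \<longlonglongrightarrow> g r" "\<And>i r. norm (F i r) \<le> 2 * norm (g r)"
    using borel_measurable_implies_sequence_metric[OF g, of 0] by auto
  have [measurable]: "F i \<in> borel_measurable borel" for i using F(1) by (rule borel_measurable_simple_function)
  define G where "G k r = indicator {0..<real k} r *\<^sub>R F k r" for k :: nat and r
  show ?thesis
  proof (rule step_approximable_limit[where G = G])
    show "step_approximable (G k)" for k
    proof -
      have finr: "finite (range (F k))" using simple_functionD(1)[OF F(1)[of k]] by simp
      have "G k r = (\<Sum>y\<in>range (F k). indicator ((F k -` {y}) \<inter> {0..<real k}) r *\<^sub>R y)" for r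
      proof -
        have "(\<Sum>y\<in>range (F k). indicator ((F k -` {y}) \<inter> {0..<real k}) r *\<^sub>R y) = (\<Sum>y\<in>range (F k). if y = F k r then G k r else 0)"
          by (intro sum.cong) (auto simp: G_def indicator_def)
        then show ?thesis using finr by simp
      qed
      moreover have "step_approximable (\<lambda>r. \<Sum>y\<in>range (F k). indicator ((F k -` {y}) \<inter> {0..<real k}) r *\<^sub>R y)"
      proof (intro step_approximable_sum finr step_approximable_indicator)
        fix y
        have "F k -` {y} \<inter> space borel \<in> sets borel" by (rule simple_functionD(2)[OF F(1)])
        then show [measurable]: "F k -` {y} \<in> sets borel" by simp
        show "(\<lambda>r. indicator ((F k -` {y}) \<inter> {0..<real k}) r *\<^sub>R y) \<in> borel_measurable borel" by measurable
      qed auto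
      ultimately show ?thesis by (simp add: step_approximable_def)
    qed
    show [measurable]: "G k \<in> borel_measurable borel" for k unfolding G_def[abs_def] by measurable
    have lim: "(\<lambda>k. G k r) \<longlonglongrightarrow> g r" for r
    proof (cases "r < 0")
      case True
      then show ?thesis by (simp add: G_def neg)
    next
      case False
      obtain k0 :: nat where k0: "r < real k0" using reals_Archimedean2 by blast
      have "\<forall>\<^sub>F k in sequentially. F k r = G k r"
        using k0 False by (auto simp: eventually_sequentially G_def intro!: exI[of _ k0])
      with F(2)[of r] show ?thesis by (rule Lim_transform_eventually)
    qed
    have "(\<lambda>k. \<integral>\<^sup>+r. ennreal ((norm (g r - G k r))\<^sup>2) \<partial>lborel) \<longlonglongrightarrow> (\<integral>\<^sup>+(r::real). 0 \<partial>lborel)"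
    proof (rule nn_integral_dominated_convergence[where w = "\<lambda>r. ennreal 9 * ennreal ((norm (g r))\<^sup>2)"])
      show "(\<lambda>r. ennreal ((norm (g r - G k r))\<^sup>2)) \<in> borel_measurable lborel" for k by measurable
      show "AE r in lborel. ennreal ((norm (g r - G k r))\<^sup>2) \<le> ennreal 9 * ennreal ((norm (g r))\<^sup>2)" for k
      proof (rule AE_I2)
        fix r :: real
        \<comment> \<open>The difference to \<open>g\<close> is at most three times the norm of
          \<open>g\<close>, whence the factor 9 in the dominating function.\<close>
        have "norm (G k r) \<le> 2 * norm (g r)" using F(3)[of k r] by (auto simp: G_def indicator_def)
        then have "norm (g r - G k r) \<le> 3 * norm (g r)" using norm_triangle_ineq4[of "g r" "G k r"] by linarith
        then have "(norm (g r - G k r))\<^sup>2 \<le> (3 * norm (g r))\<^sup>2" by (intro power_mono) auto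
        then show "ennreal ((norm (g r - G k r))\<^sup>2) \<le> ennreal 9 * ennreal ((norm (g r))\<^sup>2)"
          by (simp add: power_mult_distrib flip: ennreal_mult del: ennreal_numeral)
      qed
      show "(\<integral>\<^sup>+r. ennreal 9 * ennreal ((norm (g r))\<^sup>2) \<partial>lborel) < \<infinity>"
        using fin by (simp add: nn_integral_cmult ennreal_mult_less_top)
      show "AE r in lborel. (\<lambda>k. ennreal ((norm (g r - G k r))\<^sup>2)) \<longlonglongrightarrow> 0"
      proof (rule AE_I2)
        fix r :: real
        have "(\<lambda>k. (norm (g r - G k r))\<^sup>2) \<longlonglongrightarrow> (norm (g r - g r))\<^sup>2" by (intro tendsto_intros lim)
        then have "(\<lambda>k. ennreal ((norm (g r - G k r))\<^sup>2)) \<longlonglongrightarrow> ennreal ((norm (g r - g r))\<^sup>2)" by (rule tendsto_ennrealI)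
        then show "(\<lambda>k. ennreal ((norm (g r - G k r))\<^sup>2)) \<longlonglongrightarrow> 0" by simp
      qed
    qed auto
    then show "(\<lambda>k. \<integral>\<^sup>+r. ennreal ((norm (g r - G k r))\<^sup>2) \<partial>lborel) \<longlonglongrightarrow> 0" by simp
  qed measurable
qed

text \<open>A difference of two step integrals is a weighted step integral with weights 1 and -1, so
  the isometry applies to it.\<close>

lemma stepint_diff_second_moment:
  fixes W :: "real \<Rightarrow> 'c::{real_inner,second_countable_topology} \<Rightarrow> 'w \<Rightarrow> real"
  assumes W: "cyl_BM M W" and ps: "\<forall>(a, b, h)\<in>set ps. 0 \<le> a \<and> a \<le> b" and qs: "\<forall>(a, b, h)\<in>set qs. 0 \<le> a \<and> a \<le> b"
  shows "(\<integral>\<^sup>+\<omega>. ennreal ((stepint W ps \<omega> - stepint W qs \<omega>)\<^sup>2) \<partial>M) = (\<integral>\<^sup>+r. ennreal ((norm (stepfun ps r - stepfun qs r))\<^sup>2) \<partial>lborel)"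
proof -
  have "\<forall>(a, b, h, \<alpha>)\<in>set (wscale 1 ps @ wscale (-1) qs). 0 \<le> a \<and> a \<le> b"
    using ps qs by (auto simp: wscale_def)
  from wstepint_second_moment[OF W this] show ?thesis by (simp add: wstep_append wstep_wscale)
qed

text \<open>Completeness in mean square, carried out by hand: fast step approximations of
  \<open>g\<close> have integrals whose successive differences are summable almost surely, and
  Fatou's lemma shows that the pointwise limit is also the mean square limit.\<close>

lemma wiener_int_exists:
  fixes W :: "real \<Rightarrow> 'c::{real_inner,second_countable_topology} \<Rightarrow> 'w \<Rightarrow> real"
  assumes W: "cyl_BM M W" and g [measurable]: "g \<in> borel_measurable borel"
    and fin: "(\<integral>\<^sup>+r. ennreal ((norm (g r))\<^sup>2) \<partial>lborel) < \<infinity>" and neg: "\<And>r. r < 0 \<Longrightarrow> g r = 0"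
  shows "\<exists>Z. wiener_int M W g Z"
proof -
  interpret prob_space M by (rule cyl_BM_prob_space[OF W])
  note [measurable] = stepint_measurable[OF W]
  have ex: "\<exists>ps. (\<forall>(a, b, h)\<in>set ps. 0 \<le> a \<and> a \<le> b) \<and> (\<integral>\<^sup>+r. ennreal ((norm (g r - stepfun ps r))\<^sup>2) \<partial>lborel) \<le> ennreal ((1/16) ^ k)" for k
    by (rule step_approximableE[OF step_approximable_L2[OF g fin neg], of "(1/16) ^ k"]) auto
  have "\<exists>ps. \<forall>k. (\<forall>(a, b, h)\<in>set (ps k). 0 \<le> a \<and> a \<le> b) \<and> (\<integral>\<^sup>+r. ennreal ((norm (g r - stepfun (ps k) r))\<^sup>2) \<partial>lborel) \<le> ennreal ((1/16) ^ k)"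
    by (intro choice allI ex)
  then obtain ps where ps': "\<forall>k. (\<forall>(a, b, h)\<in>set (ps k). 0 \<le> a \<and> a \<le> b) \<and> (\<integral>\<^sup>+r. ennreal ((norm (g r - stepfun (ps k) r))\<^sup>2) \<partial>lborel) \<le> ennreal ((1/16) ^ k)"
    by (rule exE)
  note ps = ps'[THEN spec, THEN conjunct1] and psl = ps'[THEN spec, THEN conjunct2]
  define X where "X k = stepint W (ps k)" for k
  have [measurable]: "X k \<in> borel_measurable M" for k by (simp add: X_def)
  have diff: "(\<integral>\<^sup>+\<omega>. ennreal ((X j \<omega> - X k \<omega>)\<^sup>2) \<partial>M) \<le> ennreal (4 * (1/16) ^ k)" if "k \<le> j" for j k
  proof -
    have "(\<integral>\<^sup>+\<omega>. ennreal ((X j \<omega> - X k \<omega>)\<^sup>2) \<partial>M) = (\<integral>\<^sup>+r. ennreal ((norm ((g r - stepfun (ps k) r) + - (g r - stepfun (ps j) r)))\<^sup>2) \<partial>lborel)"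
      unfolding X_def stepint_diff_second_moment[OF W ps ps] by (simp add: algebra_simps)
    also have "\<dots> \<le> 2 * (\<integral>\<^sup>+r. ennreal ((norm (g r - stepfun (ps k) r))\<^sup>2) \<partial>lborel) + 2 * (\<integral>\<^sup>+r. ennreal ((norm (- (g r - stepfun (ps j) r)))\<^sup>2) \<partial>lborel)"
      by (rule nn_integral_norm_add_power2_le) measurable
    also have "\<dots> \<le> ennreal 2 * ennreal ((1/16) ^ k) + ennreal 2 * ennreal ((1/16) ^ k)"
    proof (intro add_mono mult_mono)
      have "(1/16::real) ^ j \<le> (1/16) ^ k" using that by (intro power_decreasing) auto
      then show "(\<integral>\<^sup>+r. ennreal ((norm (- (g r - stepfun (ps j) r)))\<^sup>2) \<partial>lborel) \<le> ennreal ((1/16) ^ k)"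
        unfolding norm_minus_cancel by (intro order_trans[OF psl[of j]] ennreal_leI)
    qed (use psl in auto)
    also have "\<dots> = ennreal (4 * (1/16) ^ k)" by (simp flip: ennreal_mult ennreal_plus del: ennreal_numeral)
    finally show ?thesis .
  qed
  define D where "D k \<omega> = X (Suc k) \<omega> - X k \<omega>" for k \<omega>
  have [measurable]: "D k \<in> borel_measurable M" for k unfolding D_def[abs_def] by measurable
  have D1: "(\<integral>\<^sup>+\<omega>. ennreal \<bar>D k \<omega>\<bar> \<partial>M) \<le> ennreal (5 * (1/4) ^ k)" for k
  proof -
    \<comment> \<open>The bound |d| \<le> c + d^2/c with c = 4^{-k}. The second moment of the
      difference is at most 4 times 16^{-k}, so both terms are of order 4^{-k} and the first moments
      are summable.\<close>
    have pt: "\<bar>d\<bar> \<le> (1/4) ^ k + 4 ^ k * d\<^sup>2" for d :: real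
    proof -
      define c :: real where "c = (1/4) ^ k"
      have c: "c > 0" "4 ^ k = 1 / c" by (auto simp: c_def power_divide)
      have "\<bar>d\<bar> \<le> c + d\<^sup>2 / c"
      proof (cases "\<bar>d\<bar> \<le> c")
        case True
        then show ?thesis using c by (simp add: add_increasing2)
      next
        case False
        then have "\<bar>d\<bar> * c \<le> \<bar>d\<bar> * \<bar>d\<bar>" using c by (intro mult_left_mono) auto
        then have "\<bar>d\<bar> \<le> d\<^sup>2 / c" using c by (simp add: field_simps power2_eq_square)
        then show ?thesis using c by simp
      qed
      then show ?thesis using c by (simp add: c_def[symmetric])
    qed
    have "(\<integral>\<^sup>+\<omega>. ennreal \<bar>D k \<omega>\<bar> \<partial>M) \<le> (\<integral>\<^sup>+\<omega>. ennreal ((1/4) ^ k + 4 ^ k * (D k \<omega>)\<^sup>2) \<partial>M)"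
      by (intro nn_integral_mono ennreal_leI pt)
    also have "\<dots> = (\<integral>\<^sup>+\<omega>. ennreal ((1/4) ^ k) + ennreal (4 ^ k) * ennreal ((D k \<omega>)\<^sup>2) \<partial>M)"
      by (intro nn_integral_cong) (simp flip: ennreal_mult ennreal_plus)
    also have "\<dots> = ennreal ((1/4) ^ k) + ennreal (4 ^ k) * (\<integral>\<^sup>+\<omega>. ennreal ((D k \<omega>)\<^sup>2) \<partial>M)"
      by (simp add: nn_integral_add nn_integral_cmult emeasure_space_1)
    also have "\<dots> \<le> ennreal ((1/4) ^ k) + ennreal (4 ^ k) * ennreal (4 * (1/16) ^ k)"
      unfolding D_def by (intro add_mono mult_mono diff) auto
    also have "\<dots> = ennreal ((1/4) ^ k + 4 ^ k * (4 * (1/16) ^ k))" by (simp flip: ennreal_mult ennreal_plus)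
    also have "(1/4) ^ k + 4 ^ k * (4 * (1/16) ^ k) = (5 * (1/4) ^ k :: real)"
    proof -
      have "(4::real) ^ k * (1/16) ^ k = (1/4) ^ k" by (simp flip: power_mult_distrib)
      then show ?thesis by (simp add: algebra_simps)
    qed
    finally show ?thesis .
  qed
  have "(\<integral>\<^sup>+\<omega>. (\<Sum>k. ennreal \<bar>D k \<omega>\<bar>) \<partial>M) = (\<Sum>k. \<integral>\<^sup>+\<omega>. ennreal \<bar>D k \<omega>\<bar> \<partial>M)"
    by (rule nn_integral_suminf) measurable
  also have "\<dots> \<le> (\<Sum>k. ennreal (5 * (1/4) ^ k))" by (intro suminf_le D1) auto
  also have "\<dots> = ennreal (\<Sum>k. 5 * (1/4) ^ k)"
    by (intro suminf_ennreal2) (auto intro!: summable_mult summable_geometric)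
  also have "\<dots> < \<infinity>" by simp
  finally have "(\<integral>\<^sup>+\<omega>. (\<Sum>k. ennreal \<bar>D k \<omega>\<bar>) \<partial>M) \<noteq> \<infinity>" by simp
  then have "AE \<omega> in M. (\<Sum>k. ennreal \<bar>D k \<omega>\<bar>) \<noteq> \<infinity>"
    by (intro nn_integral_noteq_infinite) measurable
  then have conv: "AE \<omega> in M. convergent (\<lambda>k. X k \<omega>)"
  proof eventually_elim
    case (elim \<omega>)
    have "summable (\<lambda>k. \<bar>D k \<omega>\<bar>)" by (rule summable_suminf_not_top) (use elim in auto)
    then have "summable (\<lambda>k. D k \<omega>)" by (rule summable_rabs_cancel)
    then have "convergent (\<lambda>n. \<Sum>k<n. D k \<omega>)" by (simp add: summable_iff_convergent)
    moreover have "(\<Sum>k<n. D k \<omega>) = X n \<omega> - X 0 \<omega>" for n unfolding D_def by (rule sum_lessThan_telescope)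
    ultimately have "convergent (\<lambda>n. X n \<omega> - X 0 \<omega>)" by simp
    then have "convergent (\<lambda>n. (X n \<omega> - X 0 \<omega>) + X 0 \<omega>)" by (intro convergent_add convergent_const)
    then show ?case by simp
  qed
  define Z where "Z \<omega> = lim (\<lambda>k. X k \<omega>)" for \<omega>
  have [measurable]: "Z \<in> borel_measurable M" unfolding Z_def[abs_def] by measurable
  have lim: "AE \<omega> in M. (\<lambda>k. X k \<omega>) \<longlonglongrightarrow> Z \<omega>"
    using conv by eventually_elim (simp add: Z_def convergent_LIMSEQ_iff)
  have bound: "(\<integral>\<^sup>+\<omega>. ennreal ((Z \<omega> - X k \<omega>)\<^sup>2) \<partial>M) \<le> ennreal (4 * (1/16) ^ k)" for k
  proof -
    \<comment> \<open>Almost everywhere the limit inferior is a limit; in this form Fatou's lemma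
      transfers the Cauchy bound for j \<ge> k to the limit \<open>Z\<close>.\<close>
    have "(\<integral>\<^sup>+\<omega>. ennreal ((Z \<omega> - X k \<omega>)\<^sup>2) \<partial>M) = (\<integral>\<^sup>+\<omega>. liminf (\<lambda>j. ennreal ((X j \<omega> - X k \<omega>)\<^sup>2)) \<partial>M)"
    proof (rule nn_integral_cong_AE)
      show "AE \<omega> in M. ennreal ((Z \<omega> - X k \<omega>)\<^sup>2) = liminf (\<lambda>j. ennreal ((X j \<omega> - X k \<omega>)\<^sup>2))"
        using lim
      proof eventually_elim
        case (elim \<omega>)
        have "(\<lambda>j. ennreal ((X j \<omega> - X k \<omega>)\<^sup>2)) \<longlonglongrightarrow> ennreal ((Z \<omega> - X k \<omega>)\<^sup>2)"
          by (intro tendsto_ennrealI tendsto_intros elim)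
        then show ?case by (rule lim_imp_Liminf[OF trivial_limit_sequentially, symmetric])
      qed
    qed
    also have "\<dots> \<le> liminf (\<lambda>j. \<integral>\<^sup>+\<omega>. ennreal ((X j \<omega> - X k \<omega>)\<^sup>2) \<partial>M)"
      by (rule nn_integral_liminf) measurable
    also have "\<dots> \<le> liminf (\<lambda>j. ennreal (4 * (1/16) ^ k))"
      by (rule Liminf_mono) (auto simp: eventually_sequentially intro!: exI[of _ k] diff)
    also have "\<dots> = ennreal (4 * (1/16) ^ k)" by (simp add: Liminf_const)
    finally show ?thesis .
  qed
  have geo: "(\<lambda>k. ennreal (c * (1/16) ^ k)) \<longlonglongrightarrow> 0" for c
  proof -
    have "(\<lambda>k. c * (1/16) ^ k) \<longlonglongrightarrow> c * 0" by (intro tendsto_intros LIMSEQ_power_zero) auto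
    then have "(\<lambda>k. ennreal (c * (1/16) ^ k)) \<longlonglongrightarrow> ennreal (c * 0)" by (rule tendsto_ennrealI)
    then show ?thesis by simp
  qed
  have "(\<lambda>k. \<integral>\<^sup>+r. ennreal ((norm (g r - stepfun (ps k) r))\<^sup>2) \<partial>lborel) \<longlonglongrightarrow> 0"
    by (rule tendsto_sandwich[OF _ _ tendsto_const geo[of 1]]) (use psl in auto)
  moreover have "(\<lambda>k. \<integral>\<^sup>+\<omega>. ennreal ((Z \<omega> - stepint W (ps k) \<omega>)\<^sup>2) \<partial>M) \<longlonglongrightarrow> 0"
    by (rule tendsto_sandwich[OF _ _ tendsto_const geo[of 4]]) (use bound in \<open>auto simp: X_def\<close>)
  ultimately have "wiener_int M W g Z" unfolding wiener_int_def using ps by (intro conjI exI[of _ ps]) auto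
  then show ?thesis by blast
qed

section \<open>Measurability, and the control function\<close>

text \<open>The space of operators is not separable, so the pair \<open>(A u, x u)\<close> need not be Borel measurable; \<open>x\<close> is
  approximated by simple functions instead.\<close>

lemma borel_measurable_blinfun_apply:
  fixes A :: "'x \<Rightarrow> ('b::{real_normed_vector,second_countable_topology} \<Rightarrow>\<^sub>L 'c::{real_normed_vector,second_countable_topology})"
  assumes A: "A \<in> borel_measurable M" and x: "x \<in> borel_measurable M"
  shows "(\<lambda>u. A u (x u)) \<in> borel_measurable M"
proof -
  have Ay: "(\<lambda>u. A u y) \<in> borel_measurable M" for y
    by (rule borel_measurable_continuous_on[OF _ A, where f = "\<lambda>A. blinfun_apply A y"]) (intro continuous_intros)
  obtain F where F: "\<And>i. simple_function M (F i)" "\<And>u. u \<in> space M \<Longrightarrow> (\<lambda>i. F i u) \<longlonglongrightarrow> x u"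
    using borel_measurable_implies_sequence_metric[OF x, of 0] by blast
  have "(\<lambda>u. A u (F i u)) \<in> borel_measurable M" for i
  proof (rule measurable_compose_countable'[where I = "F i ` space M" and f = "\<lambda>y u. A u y", OF Ay])
    show "countable (F i ` space M)" using simple_functionD(1)[OF F(1)] by (rule countable_finite)
    show "F i \<in> measurable M (count_space (F i ` space M))"
      using simple_functionD(2)[OF F(1)] simple_functionD(1)[OF F(1)]
      by (intro measurable_count_space_eq2[THEN iffD2]) auto
  qed
  then show ?thesis
    by (rule borel_measurable_LIMSEQ_metric[where f = "\<lambda>i u. A u (F i u)"])
       (rule blinfun.tendsto[OF tendsto_const F(2)])
qed

text \<open>Pettis' theorem: preimages of cylinders are measurable, and the cylinders generate the
  Borel sets of a separable space.\<close>

lemma borel_measurable_inner_weakI: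
  fixes f :: "'x \<Rightarrow> 'a::{real_inner,second_countable_topology}"
  assumes f: "\<And>k. (\<lambda>x. k \<bullet> f x) \<in> borel_measurable M"
  shows "f \<in> borel_measurable M"
proof (rule measurable_sigma_sets[OF sets_borel_eq_inner_cylinders])
  fix Y :: "'a set" assume "Y \<in> {{x. \<forall>(k, A)\<in>set ps. k \<bullet> x \<in> A} | ps. \<forall>(k, A)\<in>set ps. A \<in> sets borel}"
  then obtain ps where Y: "Y = {x. \<forall>(k, A)\<in>set ps. k \<bullet> x \<in> A}" and ps: "\<forall>(k, A)\<in>set ps. A \<in> sets borel" by blast
  have "f -` Y \<inter> space M = {x\<in>space M. \<forall>p\<in>set ps. fst p \<bullet> f x \<in> snd p}" by (auto simp: Y split_beta')
  also have "\<dots> \<in> sets M"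
  proof (rule sets.sets_Collect_finite_All[OF _ finite_set])
    fix p assume "p \<in> set ps"
    then have "snd p \<in> sets borel" using ps by auto
    then show "{x \<in> space M. fst p \<bullet> f x \<in> snd p} \<in> sets M"
      using measurable_sets[OF f, of "snd p" "fst p"] by (simp add: vimage_def Int_def conj_commute)
  qed
  finally show "f -` Y \<inter> space M \<in> sets M" .
qed auto

lemma set_integrable_continuous_Icc:
  fixes f :: "real \<Rightarrow> 'a::{banach,second_countable_topology}"
  assumes "continuous_on {a..b} f"
  shows "set_integrable lborel {a..b} f"
  unfolding set_integrable_def by (rule borel_integrable_compact[OF compact_Icc assms])

text \<open>\<open>Xsol\<close> uses the Lebesgue integral, \<open>Qop\<close> and
  \<open>Vvec\<close> the gauge integral. For values in a possibly infinite-dimensional space the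
  two are compared after taking inner products with a fixed vector.\<close>

lemma set_lebesgue_integral_eq_integral_Icc:
  fixes f :: "real \<Rightarrow> 'a::{real_inner,banach,second_countable_topology}"
  assumes f: "continuous_on {a..b} f"
  shows "(LINT r:{a..b}|lborel. f r) = integral {a..b} f"
proof (rule vector_eq_ldot[THEN iffD1], rule allI)
  fix k
  have i: "set_integrable lborel {a..b} f" by (rule set_integrable_continuous_Icc[OF f])
  have "k \<bullet> (LINT r:{a..b}|lborel. f r) = (LINT r:{a..b}|lborel. k \<bullet> f r)"
    using i unfolding set_lebesgue_integral_def set_integrable_def
    by (subst integral_inner_right[symmetric]) (auto intro!: Bochner_Integration.integral_cong)
  also have "\<dots> = integral {a..b} (\<lambda>r. k \<bullet> f r)"
    by (intro set_borel_integral_eq_integral(2) set_integrable_continuous_Icc continuous_intros f)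
  also have "\<dots> = k \<bullet> integral {a..b} f"
    using integral_linear[OF integrable_continuous_real[OF f] bounded_linear_inner_right[of k]] by (simp add: o_def)
  finally show "k \<bullet> (LINT r:{a..b}|lborel. f r) = k \<bullet> integral {a..b} f" .
qed

text \<open>Inversion is Lipschitz on the invertible operators with inverse bounded by
  \<open>C\<close>, since the difference of two inverses is the first inverse times the difference
  of the operators times the second inverse. This is where a uniform bound on the inverses is
  used.\<close>

lemma borel_measurable_op_inv:
  fixes A :: "'x \<Rightarrow> ('b::real_normed_vector \<Rightarrow>\<^sub>L 'b)"
  assumes A: "A \<in> borel_measurable M" and inv: "\<And>x. x \<in> space M \<Longrightarrow> op_invertible (A x)"
    and bdd: "\<And>x. x \<in> space M \<Longrightarrow> norm (op_inv (A x)) \<le> C"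
  shows "(\<lambda>x. op_inv (A x)) \<in> borel_measurable M"
proof -
  define K where "K = {A::'b \<Rightarrow>\<^sub>L 'b. op_invertible A \<and> norm (op_inv A) \<le> C}"
  have lip: "norm (op_inv X - op_inv Y) \<le> (\<bar>C\<bar> * \<bar>C\<bar>) * norm (X - Y)" if "X \<in> K" "Y \<in> K" for X Y
  proof -
    have X: "op_invertible X" "norm (op_inv X) \<le> \<bar>C\<bar>" and Y: "op_invertible Y" "norm (op_inv Y) \<le> \<bar>C\<bar>"
      using that by (auto simp: K_def)
    have "op_inv X - op_inv Y = op_inv X o\<^sub>L ((Y - X) o\<^sub>L op_inv Y)"
      by (rule blinfun_eqI) (simp add: blinfun.bilinear_simps op_inv_apply[OF X(1)] op_inv_apply[OF Y(1)])
    then have "norm (op_inv X - op_inv Y) \<le> norm (op_inv X) * (norm (Y - X) * norm (op_inv Y))"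
      by (metis (no_types, lifting) mult_left_mono norm_blinfun_compose norm_ge_zero order_trans)
    also have "\<dots> \<le> \<bar>C\<bar> * (norm (Y - X) * \<bar>C\<bar>)" using X Y by (intro mult_mono) auto
    finally show ?thesis by (simp add: mult_ac norm_minus_commute)
  qed
  have cont: "continuous_on K op_inv"
  proof (rule lipschitz_on_continuous_on, rule lipschitz_onI)
    show "dist (op_inv X) (op_inv Y) \<le> (\<bar>C\<bar> * \<bar>C\<bar>) * dist X Y" if "X \<in> K" "Y \<in> K" for X Y
      using lip[OF that] by (simp add: dist_norm)
  qed auto
  have "A \<in> measurable M (restrict_space borel K)"
    by (rule measurable_restrict_space2[OF _ A]) (use inv bdd in \<open>auto simp: K_def\<close>)
  moreover have "op_inv \<in> borel_measurable (restrict_space borel K)"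
    by (rule borel_measurable_continuous_on_restrict[OF cont])
  ultimately show ?thesis by (rule measurable_compose)
qed

section \<open>Invertibility of Q and the control function\<close>

lemma op_exp_adj_scaleR: "op_adj (op_exp (r *\<^sub>R A)) = op_exp (r *\<^sub>R op_adj A)"
  for A :: "'a::{real_inner,banach} \<Rightarrow>\<^sub>L 'a"
  by (simp add: op_exp_adj linear_simps[OF bounded_linear_op_adj])

text \<open>Exponentials have left inverses, and these are bounded in norm on the compact time
  interval.\<close>

lemma op_exp_lower_bound:
  fixes A :: "'a::banach \<Rightarrow>\<^sub>L 'a"
  shows "\<exists>K>0. \<forall>r\<in>{0..t}. \<forall>x. norm x \<le> K * norm (op_exp (r *\<^sub>R A) x)"
proof -
  have "continuous_on {0..t} (\<lambda>r. op_exp ((- r) *\<^sub>R A))"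
    by (rule continuous_on_compose2[OF continuous_on_op_exp[of UNIV A], where f = uminus]) (auto intro!: continuous_intros)
  then have "bounded ((\<lambda>r. op_exp ((- r) *\<^sub>R A)) ` {0..t})"
    by (intro compact_imp_bounded compact_continuous_image) auto
  then obtain K where K: "K > 0" "\<And>r. r \<in> {0..t} \<Longrightarrow> norm (op_exp ((- r) *\<^sub>R A)) \<le> K"
    unfolding bounded_pos by blast
  have "norm x \<le> K * norm (op_exp (r *\<^sub>R A) x)" if r: "r \<in> {0..t}" for r x
  proof -
    have "norm x = norm ((op_exp ((- r) *\<^sub>R A) o\<^sub>L op_exp (r *\<^sub>R A)) x)" by (simp only: op_exp_neg_compose) simp
    also have "\<dots> \<le> norm (op_exp ((- r) *\<^sub>R A)) * norm (op_exp (r *\<^sub>R A) x)" by (simp add: norm_blinfun)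
    also have "\<dots> \<le> K * norm (op_exp (r *\<^sub>R A) x)" by (intro mult_right_mono K r) auto
    finally show ?thesis .
  qed
  then show ?thesis using K(1) by blast
qed

lemma Qop_integrand_continuous:
  "continuous_on S (\<lambda>r. (r * (t - r)) *\<^sub>R (op_exp (r *\<^sub>R A0) o\<^sub>L B o\<^sub>L op_adj B o\<^sub>L op_exp (r *\<^sub>R op_adj A0)))"
  for A0 :: "'a::{real_inner,banach} \<Rightarrow>\<^sub>L 'a" and B :: "'b::{real_inner,banach} \<Rightarrow>\<^sub>L 'a"
  by (intro continuous_intros continuous_on_op_exp)

lemma Qop_apply:
  fixes A0 :: "'a::{real_inner,banach} \<Rightarrow>\<^sub>L 'a" and B :: "'b::{real_inner,banach} \<Rightarrow>\<^sub>L 'a"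
  shows "Qop A0 B t x = integral {0..t} (\<lambda>r. (r * (t - r)) *\<^sub>R op_exp (r *\<^sub>R A0) (B (op_adj B (op_exp (r *\<^sub>R op_adj A0) x))))"
  unfolding Qop_def
  using integral_linear[OF integrable_continuous_real[OF Qop_integrand_continuous] blinfun.bounded_linear_left[of x], of 0 t t A0 B]
  by (simp add: o_def blinfun.scaleR_left)

text \<open>The quadratic form of Q at x is the integral of r(t - r) times the squared norm of the
  adjoint of \<open>B\<close> applied to e^{r A_0^*} x. That adjoint and the exponentials are
  bounded below, so the form is coercive.\<close>

lemma Qop_invertible:
  fixes A0 :: "'a::{real_inner,banach} \<Rightarrow>\<^sub>L 'a" and B :: "'b::{real_inner,banach} \<Rightarrow>\<^sub>L 'a"
  assumes B: "op_invertible (B o\<^sub>L op_adj B)" and t: "t > 0"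
  shows "op_invertible (Qop A0 B t)"
proof -
  define C where "C = norm (op_inv (B o\<^sub>L op_adj B)) * norm B + 1"
  have C: "C > 0" by (auto simp: C_def intro: add_nonneg_pos)
  have lbB: "norm y \<le> C * norm (op_adj B y)" for y
  proof -
    have "norm y = norm (op_inv (B o\<^sub>L op_adj B) (B (op_adj B y)))"
      using op_inv_apply(1)[OF B, of y] by simp
    also have "\<dots> \<le> norm (op_inv (B o\<^sub>L op_adj B)) * norm (B (op_adj B y))" by (rule norm_blinfun)
    also have "\<dots> \<le> norm (op_inv (B o\<^sub>L op_adj B)) * (norm B * norm (op_adj B y))" by (intro mult_left_mono norm_blinfun) auto
    also have "\<dots> \<le> C * norm (op_adj B y)" by (simp add: C_def algebra_simps)
    finally show ?thesis .
  qed
  obtain K where K: "K > 0" "\<And>r x. r \<in> {0..t} \<Longrightarrow> norm x \<le> K * norm (op_exp (r *\<^sub>R op_adj A0) x)"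
    using op_exp_lower_bound[of t "op_adj A0"] by blast
  have J: "((\<lambda>r. r * (t - r)) has_integral (t ^ 3 / 6)) {0..t}"
  proof -
    have "((\<lambda>r. t * r\<^sup>2 / 2 - r ^ 3 / 3) has_real_derivative (r * (t - r))) (at r within {0..t})" for r
      by (auto intro!: derivative_eq_intros simp: power2_eq_square algebra_simps)
    then have "((\<lambda>r. r * (t - r)) has_integral ((t * t\<^sup>2 / 2 - t ^ 3 / 3) - (t * 0\<^sup>2 / 2 - 0 ^ 3 / 3))) {0..t}"
      using t by (intro fundamental_theorem_of_calculus) (auto simp: has_real_derivative_iff_has_vector_derivative)
    then show ?thesis by (simp add: power2_eq_square power3_eq_cube mult.assoc)
  qed
  \<comment> \<open>The numerator is the integral of r(t - r) over [0, t]; the denominator comes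
    from the two lower bounds.\<close>
  define c where "c = (t ^ 3 / 6) / (C * K)\<^sup>2"
  show ?thesis
  proof (rule op_invertible_coercive)
    show "c > 0" using t C K by (simp add: c_def)
    fix x
    have pt: "op_exp (r *\<^sub>R A0) (B (op_adj B (op_exp (r *\<^sub>R op_adj A0) x))) \<bullet> x = (norm (op_adj B (op_exp (r *\<^sub>R op_adj A0) x)))\<^sup>2" for r
    proof -
      have "op_exp (r *\<^sub>R A0) (B (op_adj B (op_exp (r *\<^sub>R op_adj A0) x))) \<bullet> x = B (op_adj B (op_exp (r *\<^sub>R op_adj A0) x)) \<bullet> op_exp (r *\<^sub>R op_adj A0) x"
        by (simp add: inner_op_adj[symmetric] op_exp_adj_scaleR)
      also have "\<dots> = op_adj B (op_exp (r *\<^sub>R op_adj A0) x) \<bullet> op_adj B (op_exp (r *\<^sub>R op_adj A0) x)"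
        by (simp add: inner_op_adj)
      finally show ?thesis by (simp add: power2_norm_eq_inner)
    qed
    have int: "((\<lambda>r. (r * (t - r)) * (norm (op_adj B (op_exp (r *\<^sub>R op_adj A0) x)))\<^sup>2) has_integral (Qop A0 B t x \<bullet> x)) {0..t}"
    proof -
      have "((\<lambda>r. (r * (t - r)) *\<^sub>R op_exp (r *\<^sub>R A0) (B (op_adj B (op_exp (r *\<^sub>R op_adj A0) x)))) has_integral (Qop A0 B t x)) {0..t}"
        unfolding Qop_apply by (intro integrable_integral integrable_continuous_real continuous_intros continuous_on_op_exp)
      from has_integral_linear[OF this bounded_linear_inner_left[of x]] show ?thesis
        by (simp add: o_def pt)
    qed
    have "((\<lambda>r. (r * (t - r)) * ((norm x)\<^sup>2 / (C * K)\<^sup>2)) has_integral ((t ^ 3 / 6) * ((norm x)\<^sup>2 / (C * K)\<^sup>2))) {0..t}"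
      by (rule has_integral_mult_left[OF J])
    then have "(t ^ 3 / 6) * ((norm x)\<^sup>2 / (C * K)\<^sup>2) \<le> Qop A0 B t x \<bullet> x"
    proof (rule has_integral_le[OF _ int])
      fix r assume r: "r \<in> {0..t}"
      have "norm x \<le> K * norm (op_exp (r *\<^sub>R op_adj A0) x)" by (rule K(2)[OF r])
      also have "\<dots> \<le> K * (C * norm (op_adj B (op_exp (r *\<^sub>R op_adj A0) x)))" using K by (intro mult_left_mono lbB) auto
      finally have "norm x / (C * K) \<le> norm (op_adj B (op_exp (r *\<^sub>R op_adj A0) x))" using C K by (simp add: field_simps)
      then have "(norm x / (C * K))\<^sup>2 \<le> (norm (op_adj B (op_exp (r *\<^sub>R op_adj A0) x)))\<^sup>2" using C K by (intro power_mono) auto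
      then show "(r * (t - r)) * ((norm x)\<^sup>2 / (C * K)\<^sup>2) \<le> (r * (t - r)) * (norm (op_adj B (op_exp (r *\<^sub>R op_adj A0) x)))\<^sup>2"
        using r by (intro mult_left_mono) (auto simp: power_divide)
    qed
    then show "c * (norm x)\<^sup>2 \<le> Qop A0 B t x \<bullet> x" by (simp add: c_def)
  qed
qed

text \<open>The integral over \<open>[s, r]\<close> of the bracket in the definition of \<open>Phi\<close>.\<close>

definition ctrl :: "('a::{real_inner, banach} \<Rightarrow>\<^sub>L 'a) \<Rightarrow> ('b::real_inner \<Rightarrow>\<^sub>L 'a) \<Rightarrow> real \<Rightarrow> real \<Rightarrow> 'a \<times> 'b \<Rightarrow> real \<Rightarrow> 'b" where
  "ctrl A0 B s T v r = ((r - s) / (T - s)) *\<^sub>R snd v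
     + ((r - s) * (T - r)) *\<^sub>R op_adj B (op_exp ((r - s) *\<^sub>R op_adj A0) (Vvec A0 B s T v))"

lemma ctrl_endpoint: "s < T \<Longrightarrow> ctrl A0 B s T v T = snd v"
  by (simp add: ctrl_def)

lemma op_exp_shift_has_vector_derivative:
  fixes A :: "'a::banach \<Rightarrow>\<^sub>L 'a"
  shows "((\<lambda>t. op_exp ((t - s) *\<^sub>R A)) has_vector_derivative (A o\<^sub>L op_exp ((t - s) *\<^sub>R A))) (at t)"
proof -
  have "((\<lambda>t. t - s) has_vector_derivative 1) (at t)" by (auto intro!: derivative_eq_intros)
  from vector_diff_chain_at[OF this op_exp_has_vector_derivative[of A "t - s"]] show ?thesis by (simp add: o_def)
qed

lemma continuous_on_op_exp_shift: "continuous_on S (\<lambda>t. op_exp ((t - s) *\<^sub>R A))"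
  for A :: "'a::banach \<Rightarrow>\<^sub>L 'a"
  by (rule continuous_on_compose2[OF continuous_on_op_exp[of UNIV A], where f = "\<lambda>t. t - s"]) (auto intro!: continuous_intros)

text \<open>The operator derivative in \<open>Phi\<close> is evaluated by the product rule. The
  resulting bracket w is continuous, and its primitive from s is \<open>ctrl\<close>, which vanishes
  at s because both of its terms carry the factor r - s.\<close>

lemma Phi_eq:
  fixes A0 :: "'a::{real_inner,banach} \<Rightarrow>\<^sub>L 'a" and B :: "'b::{real_inner,banach} \<Rightarrow>\<^sub>L 'a"
  obtains w where "continuous_on UNIV w" "\<And>r. Phi S2 A0 B s T v r = S2 (r - s) (w r)"
    "\<And>r. s \<le> r \<Longrightarrow> (w has_integral ctrl A0 B s T v r) {s..r}"
proof -
  define V where "V = Vvec A0 B s T v"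
  define b where "b u = ((u - s) * (T - u)) *\<^sub>R (op_adj B o\<^sub>L op_exp ((u - s) *\<^sub>R op_adj A0))" for u
  define b' where "b' u = ((u - s) * (T - u)) *\<^sub>R (op_adj B o\<^sub>L (op_adj A0 o\<^sub>L op_exp ((u - s) *\<^sub>R op_adj A0)))
     + (T + s - 2 * u) *\<^sub>R (op_adj B o\<^sub>L op_exp ((u - s) *\<^sub>R op_adj A0))" for u
  have der: "(b has_vector_derivative b' u) (at u)" for u
  proof -
    have 1: "((\<lambda>u. (u - s) * (T - u)) has_real_derivative (T + s - 2 * u)) (at u)"
      by (auto intro!: derivative_eq_intros simp: algebra_simps)
    have 2: "((\<lambda>u. op_adj B o\<^sub>L op_exp ((u - s) *\<^sub>R op_adj A0)) has_vector_derivative (op_adj B o\<^sub>L (op_adj A0 o\<^sub>L op_exp ((u - s) *\<^sub>R op_adj A0)))) (at u)"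
      by (rule bounded_linear.has_vector_derivative[OF bounded_bilinear.bounded_linear_right[OF bounded_bilinear_blinfun_compose] op_exp_shift_has_vector_derivative])
    show ?thesis unfolding b_def b'_def by (rule has_vector_derivative_scaleR[OF 1 2])
  qed
  define w where "w r = (1 / (T - s)) *\<^sub>R snd v + b' r V" for r
  show ?thesis
  proof
    show "continuous_on UNIV w" unfolding w_def b'_def
      by (intro continuous_intros continuous_on_op_exp_shift)
    show "Phi S2 A0 B s T v r = S2 (r - s) (w r)" for r
      unfolding Phi_def w_def V_def vector_derivative_at[OF der[of r], unfolded b_def] ..
    fix r assume sr: "s \<le> r"
    have "((\<lambda>u. ((u - s) / (T - s)) *\<^sub>R snd v + b u V) has_vector_derivative w u) (at u within {s..r})" for u
    proof -
      have 1: "((\<lambda>u. ((u - s) / (T - s)) *\<^sub>R snd v) has_vector_derivative (1 / (T - s)) *\<^sub>R snd v) (at u)"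
      proof -
        have "((\<lambda>u. (u - s) / (T - s)) has_real_derivative 1 / (T - s)) (at u)"
          by (auto intro!: derivative_eq_intros DERIV_cdivide)
        from has_vector_derivative_scaleR[OF this has_vector_derivative_const[of "snd v"]] show ?thesis by simp
      qed
      have 2: "((\<lambda>u. b u V) has_vector_derivative b' u V) (at u)"
        by (rule bounded_linear.has_vector_derivative[OF blinfun.bounded_linear_left der])
      show ?thesis unfolding w_def by (rule has_vector_derivative_at_within[OF has_vector_derivative_add[OF 1 2]])
    qed
    from fundamental_theorem_of_calculus[OF sr this]
    have "(w has_integral (((r - s) / (T - s)) *\<^sub>R snd v + b r V) - (((s - s) / (T - s)) *\<^sub>R snd v + b s V)) {s..r}" .
    moreover have "(((r - s) / (T - s)) *\<^sub>R snd v + b r V) - (((s - s) / (T - s)) *\<^sub>R snd v + b s V) = ctrl A0 B s T v r"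
      by (simp add: ctrl_def b_def V_def blinfun.scaleR_left)
    ultimately show "(w has_integral ctrl A0 B s T v r) {s..r}" by simp
  qed
qed

text \<open>The reason behind the definition of V. The quadratic term integrates to Q V, which by
  that definition is v_1 plus an integral with weight (T - r)/(T - s); the linear term has weight (r
  - s)/(T - s), and the two weights add up to 1.\<close>

lemma ctrl_identity:
  fixes A0 :: "'a::{real_inner,banach} \<Rightarrow>\<^sub>L 'a" and B :: "'b::{real_inner,banach} \<Rightarrow>\<^sub>L 'a"
  assumes B: "op_invertible (B o\<^sub>L op_adj B)" and sT: "s < T"
  shows "integral {s..T} (\<lambda>r. op_exp ((r - s) *\<^sub>R A0) (B (ctrl A0 B s T v r)))
       = fst v + integral {s..T} (\<lambda>r. op_exp ((r - s) *\<^sub>R A0) (B (snd v)))"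
proof -
  define V where "V = Vvec A0 B s T v"
  let ?e = "\<lambda>r. op_exp ((r - s) *\<^sub>R A0) (B (snd v))"
  let ?i1 = "\<lambda>r. ((r - s) / (T - s)) *\<^sub>R ?e r" and ?i3 = "\<lambda>r. ((T - r) / (T - s)) *\<^sub>R ?e r"
  let ?i2 = "\<lambda>r. ((r - s) * (T - r)) *\<^sub>R op_exp ((r - s) *\<^sub>R A0) (B (op_adj B (op_exp ((r - s) *\<^sub>R op_adj A0) V)))"
  have i1: "?i1 integrable_on {s..T}" and i2: "?i2 integrable_on {s..T}" and i3: "?i3 integrable_on {s..T}"
    using sT by (intro integrable_continuous_real continuous_intros continuous_on_op_exp_shift; simp)+
  have Q: "integral {s..T} ?i2 = Qop A0 B (T - s) V"
  proof -
    have "integral {s - s..T - s} (\<lambda>r. (r * (T - s - r)) *\<^sub>R op_exp (r *\<^sub>R A0) (B (op_adj B (op_exp (r *\<^sub>R op_adj A0) V)))) = integral {s..T} ?i2"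
      using integral_shift_real_ivl[where f = ?i2 and a = s and b = T and c = s] by (simp add: algebra_simps)
    then show ?thesis by (simp add: Qop_apply)
  qed
  have QV: "Qop A0 B (T - s) V = fst v + integral {s..T} ?i3"
    unfolding V_def Vvec_def using sT by (intro op_inv_apply(2) Qop_invertible B) auto
  have "integral {s..T} (\<lambda>r. op_exp ((r - s) *\<^sub>R A0) (B (ctrl A0 B s T v r))) = integral {s..T} (\<lambda>r. ?i1 r + ?i2 r)"
    by (simp add: ctrl_def V_def blinfun.bilinear_simps)
  also have "\<dots> = integral {s..T} ?i1 + (fst v + integral {s..T} ?i3)"
    by (simp only: Henstock_Kurzweil_Integration.integral_add[OF i1 i2] Q QV)
  also have "\<dots> = fst v + (integral {s..T} ?i1 + integral {s..T} ?i3)" by simp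
  also have "integral {s..T} ?i1 + integral {s..T} ?i3 = integral {s..T} (\<lambda>r. ?i1 r + ?i3 r)"
    by (simp only: Henstock_Kurzweil_Integration.integral_add[OF i1 i3])
  also have "(\<lambda>r. ?i1 r + ?i3 r) = ?e"
  proof
    fix r
    have "(r - s) / (T - s) + (T - r) / (T - s) = 1" using sT by (simp add: add_divide_distrib[symmetric])
    then show "?i1 r + ?i3 r = ?e r" by (metis scaleR_add_left scaleR_one)
  qed
  finally show ?thesis .
qed

section \<open>A stochastic Fubini theorem\<close>

lemma nn_integral_norm_power2_bounded_support:
  fixes f :: "real \<Rightarrow> 'c::{real_normed_vector,second_countable_topology}"
  assumes "\<And>u. norm (f u) \<le> C * indicator {s..T} u" "s \<le> T"
  shows "(\<integral>\<^sup>+u. ennreal ((norm (f u))\<^sup>2) \<partial>lborel) \<le> ennreal (C\<^sup>2 * (T - s))"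
proof -
  have "(\<integral>\<^sup>+u. ennreal ((norm (f u))\<^sup>2) \<partial>lborel) \<le> (\<integral>\<^sup>+u. ennreal (C\<^sup>2) * indicator {s..T} u \<partial>lborel)"
  proof (rule nn_integral_mono)
    fix u
    have "(norm (f u))\<^sup>2 \<le> (C * indicator {s..T} u)\<^sup>2" by (intro power_mono assms) auto
    also have "\<dots> = C\<^sup>2 * indicator {s..T} u" by (auto simp: indicator_def)
    finally have "ennreal ((norm (f u))\<^sup>2) \<le> ennreal (C\<^sup>2 * indicator {s..T} u)" by (rule ennreal_leI)
    then show "ennreal ((norm (f u))\<^sup>2) \<le> ennreal (C\<^sup>2) * indicator {s..T} u"
      by (auto simp: indicator_def split: if_splits)
  qed
  also have "\<dots> = ennreal (C\<^sup>2 * (T - s))" using assms(2) by (simp add: nn_integral_cmult_indicator ennreal_mult)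
  finally show ?thesis .
qed

lemma nn_integral_norm_power2_bounded_support_finite:
  fixes f :: "real \<Rightarrow> 'c::{real_normed_vector,second_countable_topology}"
  assumes "\<And>u. norm (f u) \<le> C * indicator {s..T} u" "s \<le> T"
  shows "(\<integral>\<^sup>+u. ennreal ((norm (f u))\<^sup>2) \<partial>lborel) < \<infinity>"
  by (rule le_less_trans[OF nn_integral_norm_power2_bounded_support[OF assms]]) simp

lemma Fubini_inner_bounded_support:
  fixes G :: "real \<Rightarrow> real \<Rightarrow> 'c::{real_inner,banach,second_countable_topology}"
  assumes G: "(\<lambda>(r, u). G r u) \<in> borel_measurable (borel \<Otimes>\<^sub>M borel)"
    and bd: "\<And>r u. norm (G r u) \<le> C * (indicator {s..T} r * indicator {s..T} u)"
    and F: "F \<in> borel_measurable borel" "\<And>u. norm (F u) \<le> C' * indicator {s..T} u"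
    and sT: "s \<le> T"
  shows "(\<integral>r. (\<integral>u. G r u \<bullet> F u \<partial>lborel) \<partial>lborel) = (\<integral>u. (\<integral>r. G r u \<partial>lborel) \<bullet> F u \<partial>lborel)"
proof -
  have [measurable]: "(\<lambda>p. G (fst p) (snd p)) \<in> borel_measurable (lborel \<Otimes>\<^sub>M lborel)" "F \<in> borel_measurable borel"
    using G F by (simp_all add: split_beta' cong: measurable_cong_sets sets_pair_measure_cong)
  have C: "0 \<le> C" using bd[of s s] sT by (auto intro: order_trans[OF norm_ge_zero])
  have C': "0 \<le> C'" using F(2)[of s] sT by (auto intro: order_trans[OF norm_ge_zero])
  have int: "integrable (lborel \<Otimes>\<^sub>M lborel) (\<lambda>(r, u). G r u \<bullet> F u)"
  proof (rule integrableI_bounded_set[where A = "{s..T} \<times> {s..T}" and B = "C * C'"])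
    show "(\<lambda>(r, u). G r u \<bullet> F u) \<in> borel_measurable (lborel \<Otimes>\<^sub>M lborel)" unfolding split_beta' by measurable
    show "emeasure (lborel \<Otimes>\<^sub>M lborel) ({s..T} \<times> {s..T}) < \<infinity>"
      using sT by (simp add: lborel.emeasure_pair_measure_Times ennreal_mult[symmetric])
    show "AE p in lborel \<Otimes>\<^sub>M lborel. p \<in> {s..T} \<times> {s..T} \<longrightarrow> norm (case p of (r, u) \<Rightarrow> G r u \<bullet> F u) \<le> C * C'"
    proof (rule AE_I2, clarify)
      fix r u assume "r \<in> {s..T}" "u \<in> {s..T}"
      then have "norm (G r u) \<le> C" "norm (F u) \<le> C'" using bd[of r u] F(2)[of u] by auto
      then have "norm (G r u) * norm (F u) \<le> C * C'" using C by (intro mult_mono) auto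
      then show "norm (G r u \<bullet> F u) \<le> C * C'"
        using Cauchy_Schwarz_ineq2[of "G r u" "F u"] by simp
    qed
    show "AE p in lborel \<Otimes>\<^sub>M lborel. p \<notin> {s..T} \<times> {s..T} \<longrightarrow> (case p of (r, u) \<Rightarrow> G r u \<bullet> F u) = 0"
    proof (intro AE_I2 impI)
      fix p :: "real \<times> real" assume p: "p \<notin> {s..T} \<times> {s..T}"
      obtain r u where ru: "p = (r, u)" by (cases p)
      have "norm (G r u) \<le> 0" using bd[of r u] p by (auto simp: ru indicator_def split: if_splits)
      then show "(case p of (r, u) \<Rightarrow> G r u \<bullet> F u) = 0" by (simp add: ru)
    qed
  qed simp
  have "(\<integral>r. (\<integral>u. G r u \<bullet> F u \<partial>lborel) \<partial>lborel) = (\<integral>u. (\<integral>r. G r u \<bullet> F u \<partial>lborel) \<partial>lborel)"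
    using lborel_pair.Fubini_integral[OF int] by simp
  also have "\<dots> = (\<integral>u. (\<integral>r. G r u \<partial>lborel) \<bullet> F u \<partial>lborel)"
  proof (intro Bochner_Integration.integral_cong refl integral_inner_left)
    fix u
    show "integrable lborel (\<lambda>r. G r u)"
    proof (rule integrableI_bounded_set[where A = "{s..T}" and B = C])
      have "(\<lambda>r. (\<lambda>p. G (fst p) (snd p)) (r, u)) \<in> borel_measurable lborel" by measurable
      then show "(\<lambda>r. G r u) \<in> borel_measurable lborel" by simp
      show "AE r in lborel. r \<in> {s..T} \<longrightarrow> norm (G r u) \<le> C"
      proof (intro AE_I2 impI)
        show "norm (G r u) \<le> C" for r
          by (rule order_trans[OF bd]) (use C in \<open>auto simp: indicator_def\<close>)
      qed
      show "AE r in lborel. r \<notin> {s..T} \<longrightarrow> G r u = 0"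
      proof (intro AE_I2 impI)
        fix r assume "r \<notin> {s..T}"
        then have "norm (G r u) \<le> 0" using bd[of r u] by (auto simp: indicator_def split: if_splits)
        then show "G r u = 0" by simp
      qed
    qed (use sT in auto)
  qed
  finally show "(\<integral>r. (\<integral>u. G r u \<bullet> F u \<partial>lborel) \<partial>lborel) = (\<integral>u. (\<integral>r. G r u \<partial>lborel) \<bullet> F u \<partial>lborel)" .
qed

text \<open>Cauchy--Schwarz against the indicator of [s, T]. A non-integrable \<open>y\<close> has
  Bochner integral 0 and satisfies the bound trivially, so the lemma can be applied to every sample
  path before integrability of the paths is known.\<close>

lemma integral_norm_power2_le:
  fixes y :: "real \<Rightarrow> real"
  assumes [measurable]: "y \<in> borel_measurable borel" and y0: "\<And>r. r \<notin> {s..T} \<Longrightarrow> y r = 0" and sT: "s \<le> T"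
  shows "ennreal ((\<integral>r. y r \<partial>lborel)\<^sup>2) \<le> ennreal (T - s) * (\<integral>\<^sup>+r. ennreal ((y r)\<^sup>2) \<partial>lborel)"
proof (cases "integrable lborel y")
  case True
  have "ennreal (norm (\<integral>r. y r \<partial>lborel)) \<le> (\<integral>\<^sup>+r. norm (y r) \<partial>lborel)" by (rule integral_norm_bound_ennreal[OF True])
  also have "\<dots> = (\<integral>\<^sup>+r. ennreal \<bar>y r\<bar> * indicator {s..T} r \<partial>lborel)"
    by (intro nn_integral_cong) (auto simp: indicator_def y0)
  finally have "(ennreal (norm (\<integral>r. y r \<partial>lborel)))\<^sup>2 \<le> (\<integral>\<^sup>+r. ennreal \<bar>y r\<bar> * indicator {s..T} r \<partial>lborel)\<^sup>2"
    by (intro power_mono) auto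
  also have "\<dots> \<le> (\<integral>\<^sup>+r. (ennreal \<bar>y r\<bar>)\<^sup>2 \<partial>lborel) * (\<integral>\<^sup>+r. (indicator {s..T} r)\<^sup>2 \<partial>lborel)"
    by (rule Cauchy_Schwarz_nn_integral) auto
  also have "(\<integral>\<^sup>+r. (indicator {s..T} r)\<^sup>2 \<partial>lborel) = (\<integral>\<^sup>+r. indicator {s..T} r \<partial>lborel)"
    by (intro nn_integral_cong) (auto simp: indicator_def)
  also have "\<dots> = ennreal (T - s)" using sT by simp
  also have "(\<integral>\<^sup>+r. (ennreal \<bar>y r\<bar>)\<^sup>2 \<partial>lborel) = (\<integral>\<^sup>+r. ennreal ((y r)\<^sup>2) \<partial>lborel)"
    by (intro nn_integral_cong) (simp add: ennreal_power)
  finally show ?thesis by (simp add: ennreal_power mult.commute)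
qed (simp add: not_integrable_integral_eq)

text \<open>The approximating step functions are never interchanged with the r-integral. With U the
  integral of \<open>y\<close> and Z the Wiener integral of the averaged kernel, the three moments
  E[U U], E[U Z] and E[Z Z] are all equal, so E[(U - Z)^2] = 0.\<close>

lemma stochastic_Fubini:
  fixes W :: "real \<Rightarrow> 'c::{real_inner,banach,second_countable_topology} \<Rightarrow> 'w \<Rightarrow> real"
    and G :: "real \<Rightarrow> real \<Rightarrow> 'c" and y :: "real \<Rightarrow> 'w \<Rightarrow> real"
  assumes W: "cyl_BM M W" and s0: "0 \<le> s" and sT: "s \<le> T"
    and G: "(\<lambda>(r, u). G r u) \<in> borel_measurable (borel \<Otimes>\<^sub>M borel)"
    and y: "(\<lambda>(r, \<omega>). y r \<omega>) \<in> borel_measurable (lborel \<Otimes>\<^sub>M M)"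
    and bd: "\<And>r u. norm (G r u) \<le> C * (indicator {s..T} r * indicator {s..T} u)"
    and y0: "\<And>r \<omega>. r \<notin> {s..T} \<Longrightarrow> y r \<omega> = 0"
    and WI: "\<And>r. wiener_int M W (G r) (y r)"
  shows "wiener_int M W (\<lambda>u. \<integral>r. G r u \<partial>lborel) (\<lambda>\<omega>. \<integral>r. y r \<omega> \<partial>lborel)"
    and "(\<lambda>u. \<integral>r. G r u \<partial>lborel) \<in> borel_measurable borel"
    and "norm (\<integral>r. G r u \<partial>lborel) \<le> (C * (T - s)) * indicator {s..T} u"
proof -
  interpret prob_space M by (rule cyl_BM_prob_space[OF W])
  interpret P: pair_sigma_finite lborel M ..
  have C: "0 \<le> C" using bd[of s s] sT by (auto intro: order_trans[OF norm_ge_zero])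
  have G' [measurable]: "(\<lambda>p. G (fst p) (snd p)) \<in> borel_measurable (borel \<Otimes>\<^sub>M borel)"
    using G by (simp add: split_beta')
  have y' [measurable]: "(\<lambda>p. y (fst p) (snd p)) \<in> borel_measurable (lborel \<Otimes>\<^sub>M M)"
    using y by (simp add: split_beta')
  have Gr [measurable]: "G r \<in> borel_measurable borel" for r
    using measurable_compose[OF measurable_Pair1'[of r borel borel] G'] by simp
  have Gu: "(\<lambda>r. G r u) \<in> borel_measurable borel" for u
    using measurable_compose[OF measurable_Pair2'[of u borel borel] G'] by simp
  have yr [measurable]: "y r \<in> borel_measurable M" for r using WI[of r] by (simp add: wiener_int_def)
  have y\<omega>: "(\<lambda>r. y r \<omega>) \<in> borel_measurable borel" if "\<omega> \<in> space M" for \<omega>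
    using measurable_compose[OF measurable_Pair2'[OF that, of lborel] y'] by simp
  have bdr: "norm (G r u) \<le> C * indicator {s..T} u" for r u
    by (rule order_trans[OF bd]) (use C in \<open>auto simp: indicator_def\<close>)
  have finG: "(\<integral>\<^sup>+u. ennreal ((norm (G r u))\<^sup>2) \<partial>lborel) < \<infinity>" for r
    by (rule nn_integral_norm_power2_bounded_support_finite[OF bdr sT])
  define Gb where "Gb u = (\<integral>r. G r u \<partial>lborel)" for u
  show Gb_meas [measurable]: "(\<lambda>u. \<integral>r. G r u \<partial>lborel) \<in> borel_measurable borel"
  proof -
    have "(\<lambda>p. G (snd p) (fst p)) \<in> borel_measurable (borel \<Otimes>\<^sub>M borel)"
      using measurable_pair_swap[OF G] by (simp add: split_beta')
    then have "(\<lambda>(u, r). G r u) \<in> borel_measurable (borel \<Otimes>\<^sub>M lborel)"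
      by (simp add: split_beta' cong: measurable_cong_sets sets_pair_measure_cong)
    then show ?thesis by (rule lborel.borel_measurable_lebesgue_integral)
  qed
  have intG: "integrable lborel (\<lambda>r. G r u)" for u
  proof (rule integrableI_bounded_set[where A = "{s..T}" and B = C])
    show "AE r in lborel. r \<in> {s..T} \<longrightarrow> norm (G r u) \<le> C"
    proof (intro AE_I2 impI)
      show "norm (G r u) \<le> C" for r
        by (rule order_trans[OF bdr]) (use C in \<open>auto simp: indicator_def\<close>)
    qed
    show "AE r in lborel. r \<notin> {s..T} \<longrightarrow> G r u = 0"
    proof (intro AE_I2 impI)
      fix r assume "r \<notin> {s..T}"
      then have "norm (G r u) \<le> 0" using bd[of r u] by (auto simp: indicator_def split: if_splits)
      then show "G r u = 0" by simp
    qed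
  qed (use sT Gu in auto)
  show Gb_bd: "norm (\<integral>r. G r u \<partial>lborel) \<le> (C * (T - s)) * indicator {s..T} u" for u
  proof -
    have "norm (\<integral>r. G r u \<partial>lborel) \<le> (\<integral>r. norm (G r u) \<partial>lborel)" by (rule integral_norm_bound)
    also have "\<dots> \<le> (\<integral>r. (C * indicator {s..T} u) * indicator {s..T} r \<partial>lborel)"
      by (rule integral_mono) (use intG[of u] sT bd[of _ u] in \<open>auto simp: mult_ac intro!: integrable_mult_right\<close>)
    also have "\<dots> = (C * (T - s)) * indicator {s..T} u" using sT by simp
    finally show ?thesis .
  qed
  have finGb: "(\<integral>\<^sup>+u. ennreal ((norm (Gb u))\<^sup>2) \<partial>lborel) < \<infinity>"
    unfolding Gb_def by (rule nn_integral_norm_power2_bounded_support_finite[OF Gb_bd sT])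
  have Gbm [measurable]: "Gb \<in> borel_measurable borel" unfolding Gb_def by (rule Gb_meas)
  have "\<exists>Z. wiener_int M W Gb Z"
  proof (rule wiener_int_exists[OF W Gbm finGb])
    fix r :: real assume "r < 0"
    then show "Gb r = 0" using Gb_bd[of r] s0 by (simp add: Gb_def)
  qed
  then obtain Z where Z: "wiener_int M W Gb Z" by blast
  have Zm [measurable]: "Z \<in> borel_measurable M" using Z by (simp add: wiener_int_def)
  define K where "K = C\<^sup>2 * (T - s)"
  have K0: "0 \<le> K" using sT by (simp add: K_def)
  have y2: "integrable M (\<lambda>\<omega>. (y r \<omega>)\<^sup>2)" "(\<integral>\<omega>. (y r \<omega>)\<^sup>2 \<partial>M) \<le> K" for r
  proof -
    note c = wiener_int_covariance[OF W WI[of r] WI[of r] Gr Gr finG finG]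
    show "integrable M (\<lambda>\<omega>. (y r \<omega>)\<^sup>2)" using c(1) by (simp add: power2_eq_square)
    have "(\<integral>\<omega>. (y r \<omega>)\<^sup>2 \<partial>M) = (\<integral>u. (norm (G r u))\<^sup>2 \<partial>lborel)"
      using c(2) by (simp add: power2_eq_square[symmetric] power2_norm_eq_inner)
    also have "ennreal \<dots> = (\<integral>\<^sup>+u. ennreal ((norm (G r u))\<^sup>2) \<partial>lborel)"
      using finG[of r] by (intro nn_integral_eq_integral[symmetric]) (auto simp: integrable_norm_power2_iff)
    also have "\<dots> \<le> ennreal K" unfolding K_def by (rule nn_integral_norm_power2_bounded_support[OF bdr sT])
    finally show "(\<integral>\<omega>. (y r \<omega>)\<^sup>2 \<partial>M) \<le> K" using K0 by (simp add: ennreal_le_iff)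
  qed
  have y2n: "(\<integral>\<^sup>+\<omega>. ennreal ((y r \<omega>)\<^sup>2) \<partial>M) \<le> ennreal K" for r
    using y2[of r] by (simp add: nn_integral_eq_integral ennreal_leI)
  define U where "U \<omega> = (\<integral>r. y r \<omega> \<partial>lborel)" for \<omega>
  have Um [measurable]: "U \<in> borel_measurable M"
  proof -
    have "(\<lambda>(\<omega>, r). y r \<omega>) \<in> borel_measurable (M \<Otimes>\<^sub>M lborel)"
      using measurable_pair_swap[OF y] by (simp add: split_beta')
    then show ?thesis unfolding U_def by (rule lborel.borel_measurable_lebesgue_integral)
  qed
  have U2: "integrable M (\<lambda>\<omega>. (U \<omega>)\<^sup>2)"
  proof (rule integrableI_bounded)
    have "(\<integral>\<^sup>+\<omega>. ennreal (norm ((U \<omega>)\<^sup>2)) \<partial>M) \<le> (\<integral>\<^sup>+\<omega>. ennreal (T - s) * (\<integral>\<^sup>+r. ennreal ((y r \<omega>)\<^sup>2) \<partial>lborel) \<partial>M)"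
    proof (rule nn_integral_mono)
      fix \<omega> assume "\<omega> \<in> space M"
      from integral_norm_power2_le[OF y\<omega>[OF this] y0 sT] show "ennreal (norm ((U \<omega>)\<^sup>2)) \<le> ennreal (T - s) * (\<integral>\<^sup>+r. ennreal ((y r \<omega>)\<^sup>2) \<partial>lborel)"
        by (simp add: U_def)
    qed
    also have "\<dots> = ennreal (T - s) * (\<integral>\<^sup>+\<omega>. (\<integral>\<^sup>+r. ennreal ((y r \<omega>)\<^sup>2) \<partial>lborel) \<partial>M)"
    proof (rule nn_integral_cmult, rule lborel.borel_measurable_nn_integral)
      have "(\<lambda>p. y (snd p) (fst p)) \<in> borel_measurable (M \<Otimes>\<^sub>M lborel)"
        using measurable_pair_swap[OF y] by (simp add: split_beta')
      then show "(\<lambda>(\<omega>, r). ennreal ((y r \<omega>)\<^sup>2)) \<in> borel_measurable (M \<Otimes>\<^sub>M lborel)"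
        unfolding split_beta' by measurable
    qed
    also have "(\<integral>\<^sup>+\<omega>. (\<integral>\<^sup>+r. ennreal ((y r \<omega>)\<^sup>2) \<partial>lborel) \<partial>M) = (\<integral>\<^sup>+r. (\<integral>\<^sup>+\<omega>. ennreal ((y r \<omega>)\<^sup>2) \<partial>M) \<partial>lborel)"
      using P.Fubini[of "\<lambda>p. ennreal ((y (fst p) (snd p))\<^sup>2)"] by simp
    also have "\<dots> \<le> (\<integral>\<^sup>+r. ennreal K * indicator {s..T} r \<partial>lborel)"
    proof (rule nn_integral_mono)
      fix r show "(\<integral>\<^sup>+\<omega>. ennreal ((y r \<omega>)\<^sup>2) \<partial>M) \<le> ennreal K * indicator {s..T} r"
        using y2n[of r] by (cases "r \<in> {s..T}") (simp_all add: y0)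
    qed
    also have "\<dots> = ennreal (K * (T - s))" using sT K0 by (simp add: nn_integral_cmult_indicator ennreal_mult)
    finally have "(\<integral>\<^sup>+\<omega>. ennreal (norm ((U \<omega>)\<^sup>2)) \<partial>M) \<le> ennreal (T - s) * ennreal (K * (T - s))"
      by (simp add: mult_left_mono)
    also have "\<dots> < \<infinity>" by (simp add: ennreal_mult_less_top)
    finally show "(\<integral>\<^sup>+\<omega>. ennreal (norm ((U \<omega>)\<^sup>2)) \<partial>M) < \<infinity>" .
  qed simp
  \<comment> \<open>Fubini against any square integrable R; it is used with R = Z, R = y_r and
    finally R = U, which is why square integrability of U is established before.\<close>
  have EU: "integrable M (\<lambda>\<omega>. U \<omega> * R \<omega>)" "(\<integral>\<omega>. U \<omega> * R \<omega> \<partial>M) = (\<integral>r. (\<integral>\<omega>. y r \<omega> * R \<omega> \<partial>M) \<partial>lborel)"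
    if R [measurable]: "R \<in> borel_measurable M" and R2: "integrable M (\<lambda>\<omega>. (R \<omega>)\<^sup>2)" for R
  proof -
    define L where "L = (\<integral>\<omega>. (R \<omega>)\<^sup>2 \<partial>M)"
    have int: "integrable (lborel \<Otimes>\<^sub>M M) (\<lambda>(r, \<omega>). y r \<omega> * R \<omega>)"
    proof (rule integrableI_bounded)
      show "(\<lambda>(r, \<omega>). y r \<omega> * R \<omega>) \<in> borel_measurable (lborel \<Otimes>\<^sub>M M)" unfolding split_beta' by measurable
      have "(\<integral>\<^sup>+p. ennreal (norm (case p of (r, \<omega>) \<Rightarrow> y r \<omega> * R \<omega>)) \<partial>(lborel \<Otimes>\<^sub>M M)) = (\<integral>\<^sup>+r. (\<integral>\<^sup>+\<omega>. ennreal (norm (y r \<omega> * R \<omega>)) \<partial>M) \<partial>lborel)"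
        by (subst nn_integral_fst[symmetric]) (auto simp: split_beta')
      also have "\<dots> \<le> (\<integral>\<^sup>+r. ennreal (K + L) * indicator {s..T} r \<partial>lborel)"
      proof (rule nn_integral_mono)
        fix r
        show "(\<integral>\<^sup>+\<omega>. ennreal (norm (y r \<omega> * R \<omega>)) \<partial>M) \<le> ennreal (K + L) * indicator {s..T} r"
        proof (cases "r \<in> {s..T}")
          case True
          have "(\<integral>\<^sup>+\<omega>. ennreal (norm (y r \<omega> * R \<omega>)) \<partial>M) \<le> (\<integral>\<^sup>+\<omega>. ennreal ((y r \<omega>)\<^sup>2 + (R \<omega>)\<^sup>2) \<partial>M)"
          proof (intro nn_integral_mono ennreal_leI)
            fix \<omega>
            show "norm (y r \<omega> * R \<omega>) \<le> (y r \<omega>)\<^sup>2 + (R \<omega>)\<^sup>2"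
            proof -
              have "2 * (\<bar>y r \<omega>\<bar> * \<bar>R \<omega>\<bar>) \<le> (y r \<omega>)\<^sup>2 + (R \<omega>)\<^sup>2"
                using sum_squares_bound[of "\<bar>y r \<omega>\<bar>" "\<bar>R \<omega>\<bar>"] by (simp add: mult.assoc)
              moreover have "0 \<le> \<bar>y r \<omega>\<bar> * \<bar>R \<omega>\<bar>" by simp
              ultimately show ?thesis unfolding real_norm_def abs_mult by linarith
            qed
          qed
          also have "\<dots> = ennreal (\<integral>\<omega>. (y r \<omega>)\<^sup>2 + (R \<omega>)\<^sup>2 \<partial>M)"
            by (rule nn_integral_eq_integral) (use y2[of r] R2 in auto)
          also have "\<dots> \<le> ennreal (K + L)" using y2[of r] R2 by (intro ennreal_leI) (simp add: L_def)
          finally show ?thesis using True by simp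
        qed (simp add: y0)
      qed
      also have "\<dots> < \<infinity>" using sT by (simp add: nn_integral_cmult_indicator ennreal_mult_less_top)
      finally show "(\<integral>\<^sup>+p. ennreal (norm (case p of (r, \<omega>) \<Rightarrow> y r \<omega> * R \<omega>)) \<partial>(lborel \<Otimes>\<^sub>M M)) < \<infinity>" .
    qed
    show "integrable M (\<lambda>\<omega>. U \<omega> * R \<omega>)" using P.integrable_snd[OF int] by (simp add: U_def)
    show "(\<integral>\<omega>. U \<omega> * R \<omega> \<partial>M) = (\<integral>r. (\<integral>\<omega>. y r \<omega> * R \<omega> \<partial>M) \<partial>lborel)"
      using P.Fubini_integral[OF int] by (simp add: U_def)
  qed
  \<comment> \<open>The common covariance of \<open>y r\<close> with U and with Z; all three second
    moments are its integral over r.\<close>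
  define c where "c r = (\<integral>u. G r u \<bullet> Gb u \<partial>lborel)" for r
  have covZ: "(\<integral>\<omega>. y r \<omega> * Z \<omega> \<partial>M) = c r" for r
    unfolding c_def by (rule wiener_int_covariance(2)[OF W WI Z Gr Gbm finG finGb])
  have ZZ: "integrable M (\<lambda>\<omega>. (Z \<omega>)\<^sup>2)" "(\<integral>\<omega>. (Z \<omega>)\<^sup>2 \<partial>M) = (\<integral>r. c r \<partial>lborel)"
  proof -
    note cc = wiener_int_covariance[OF W Z Z Gbm Gbm finGb finGb]
    show "integrable M (\<lambda>\<omega>. (Z \<omega>)\<^sup>2)" using cc(1) by (simp add: power2_eq_square)
    have "(\<integral>\<omega>. (Z \<omega>)\<^sup>2 \<partial>M) = (\<integral>u. (\<integral>r. G r u \<partial>lborel) \<bullet> Gb u \<partial>lborel)"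
      using cc(2) by (simp add: power2_eq_square Gb_def)
    also have "\<dots> = (\<integral>r. c r \<partial>lborel)" unfolding c_def
      by (rule Fubini_inner_bounded_support[OF G bd Gbm Gb_bd[folded Gb_def] sT, symmetric])
    finally show "(\<integral>\<omega>. (Z \<omega>)\<^sup>2 \<partial>M) = (\<integral>r. c r \<partial>lborel)" .
  qed
  have UZ: "(\<integral>\<omega>. U \<omega> * Z \<omega> \<partial>M) = (\<integral>r. c r \<partial>lborel)"
    by (simp add: EU(2)[OF Zm ZZ(1)] covZ)
  have Uy: "(\<integral>\<omega>. U \<omega> * y r \<omega> \<partial>M) = c r" for r
  proof -
    have "(\<integral>\<omega>. U \<omega> * y r \<omega> \<partial>M) = (\<integral>r'. (\<integral>u. G r' u \<bullet> G r u \<partial>lborel) \<partial>lborel)"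
      by (simp add: EU(2)[OF yr y2(1)] wiener_int_covariance(2)[OF W WI WI Gr Gr finG finG])
    also have "\<dots> = (\<integral>u. Gb u \<bullet> G r u \<partial>lborel)" unfolding Gb_def
      by (rule Fubini_inner_bounded_support[OF G bd Gr bdr sT])
    finally show ?thesis by (simp add: c_def inner_commute)
  qed
  have UU: "(\<integral>\<omega>. (U \<omega>)\<^sup>2 \<partial>M) = (\<integral>r. c r \<partial>lborel)"
    using EU(2)[OF Um U2] Uy by (simp add: power2_eq_square mult.commute)
  have iUZ: "integrable M (\<lambda>\<omega>. U \<omega> * Z \<omega>)" by (rule EU(1)[OF Zm ZZ(1)])
  have expand: "(U \<omega> - Z \<omega>)\<^sup>2 = (U \<omega>)\<^sup>2 - 2 * (U \<omega> * Z \<omega>) + (Z \<omega>)\<^sup>2" for \<omega>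
    by (simp add: power2_diff)
  have "integrable M (\<lambda>\<omega>. (U \<omega> - Z \<omega>)\<^sup>2)" unfolding expand
    using U2 iUZ ZZ(1) by (intro Bochner_Integration.integrable_add Bochner_Integration.integrable_diff integrable_mult_right)
  moreover have "(\<integral>\<omega>. (U \<omega> - Z \<omega>)\<^sup>2 \<partial>M) = 0" unfolding expand
    using U2 iUZ ZZ UZ UU by simp
  ultimately have "AE \<omega> in M. (U \<omega> - Z \<omega>)\<^sup>2 = 0"
    by (subst (asm) integral_nonneg_eq_0_iff_AE) auto
  then have "AE \<omega> in M. Z \<omega> = U \<omega>" by eventually_elim simp
  from wiener_int_cong_AE[OF Z Um this] show "wiener_int M W (\<lambda>u. \<integral>r. G r u \<partial>lborel) (\<lambda>\<omega>. \<integral>r. y r \<omega> \<partial>lborel)"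
    unfolding Gb_def U_def .
qed

section \<open>Moments of the stochastic convolution\<close>

text \<open>One half of Parseval's identity. The sum over the basis is an integral for the counting
  measure, so that it can be exchanged with an expectation.\<close>

lemma norm_power2_le_nn_integral_coordinates:
  fixes x :: "'a::real_inner"
  assumes unit: "\<forall>e\<in>E. norm e = 1" and orth: "\<forall>e\<in>E. \<forall>e'\<in>E. e \<noteq> e' \<longrightarrow> e \<bullet> e' = 0"
    and dense: "closure (span E) = UNIV"
  shows "ennreal ((norm x)\<^sup>2) \<le> (\<integral>\<^sup>+e. ennreal ((e \<bullet> x)\<^sup>2) \<partial>count_space E)"
proof (rule ennreal_le_epsilon)
  fix \<epsilon> :: real assume \<epsilon>: "\<epsilon> > 0"
  have "x \<in> closure (span E)" by (simp add: dense)
  then obtain p where p: "p \<in> span E" "dist p x < sqrt \<epsilon>"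
    using \<epsilon> unfolding closure_approachable by (metis real_sqrt_gt_zero)
  obtain F c where F: "finite F" "F \<subseteq> E" "p = (\<Sum>e\<in>F. c e *\<^sub>R e)"
    using p(1) unfolding span_explicit by blast
  have ee: "e \<bullet> e' = (if e = e' then 1 else 0)" if "e \<in> F" "e' \<in> F" for e e'
    using that F(2) unit orth by (auto simp: subset_iff norm_eq_1)
  have pp: "p \<bullet> p = (\<Sum>e\<in>F. (c e)\<^sup>2)"
  proof -
    have "p \<bullet> p = (\<Sum>e\<in>F. \<Sum>e'\<in>F. c e * c e' * (if e = e' then 1 else 0))"
      unfolding F(3) inner_sum_left inner_sum_right
      by (intro sum.cong refl) (simp add: ee inner_commute)
    also have "\<dots> = (\<Sum>e\<in>F. (c e)\<^sup>2)" using F(1) by (simp add: power2_eq_square if_distrib cong: if_cong)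
    finally show ?thesis .
  qed
  have "(norm (x - p))\<^sup>2 = (norm x)\<^sup>2 - 2 * (p \<bullet> x) + p \<bullet> p"
    unfolding power2_norm_eq_inner by (simp add: inner_simps inner_commute)
  also have "p \<bullet> x = (\<Sum>e\<in>F. c e * (e \<bullet> x))" unfolding F(3) by (simp add: inner_sum_left)
  \<comment> \<open>Completing the square in each coordinate: among all coefficients, the inner
    products give the best approximation, so the last sum may be dropped.\<close>
  finally have "(norm (x - p))\<^sup>2 = (norm x)\<^sup>2 - (\<Sum>e\<in>F. (e \<bullet> x)\<^sup>2) + (\<Sum>e\<in>F. (c e - e \<bullet> x)\<^sup>2)"
    by (simp add: pp power2_diff sum.distrib sum_subtractf sum_distrib_left algebra_simps)
  moreover have "0 \<le> (\<Sum>e\<in>F. (c e - e \<bullet> x)\<^sup>2)" by (intro sum_nonneg) auto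
  moreover have "(norm (x - p))\<^sup>2 \<le> \<epsilon>"
  proof -
    have "(norm (x - p))\<^sup>2 \<le> (sqrt \<epsilon>)\<^sup>2" using p(2) by (intro power_mono) (auto simp: dist_norm norm_minus_commute)
    then show ?thesis using \<epsilon> by simp
  qed
  ultimately have "(norm x)\<^sup>2 \<le> (\<Sum>e\<in>F. (e \<bullet> x)\<^sup>2) + \<epsilon>" by linarith
  then have "ennreal ((norm x)\<^sup>2) \<le> ennreal ((\<Sum>e\<in>F. (e \<bullet> x)\<^sup>2) + \<epsilon>)" by (rule ennreal_leI)
  also have "\<dots> = (\<Sum>e\<in>F. ennreal ((e \<bullet> x)\<^sup>2)) + ennreal \<epsilon>"
    using \<epsilon> by (simp add: sum_nonneg)
  also have "(\<Sum>e\<in>F. ennreal ((e \<bullet> x)\<^sup>2)) = (\<integral>\<^sup>+e. ennreal ((e \<bullet> x)\<^sup>2) \<partial>count_space F)"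
    by (rule nn_integral_count_space_finite[OF F(1), symmetric])
  also have "\<dots> \<le> (\<integral>\<^sup>+e. ennreal ((e \<bullet> x)\<^sup>2) \<partial>count_space E)"
    unfolding nn_integral_count_space_indicator[of F, simplified] nn_integral_count_space_indicator[of E, simplified]
    using F(2) by (intro nn_integral_mono) (auto simp: indicator_def)
  finally show "ennreal ((norm x)\<^sup>2) \<le> (\<integral>\<^sup>+e. ennreal ((e \<bullet> x)\<^sup>2) \<partial>count_space E) + ennreal \<epsilon>"
    by (simp add: add_right_mono)
qed

text \<open>Summability of \<lambda>^{-(1-\<delta>)} gives that of 1/\<lambda>, because the extra
  factor \<lambda>^{-\<delta>} is a power of a summand and hence bounded by the same power of the
  total sum. Positive terms with a finite sum also force the basis to be countable.\<close>

lemma nn_integral_inverse_eigenvalues_finite: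
  fixes lam :: "'b \<Rightarrow> real"
  assumes pos: "\<And>e. e \<in> E \<Longrightarrow> 0 < lam e" and \<delta>: "0 < \<delta>" "\<delta> < 1"
    and sum: "(\<lambda>e. lam e powr (- (1 - \<delta>))) summable_on E"
  shows "countable E" "(\<integral>\<^sup>+e. ennreal (1 / lam e) \<partial>count_space E) < \<infinity>"
proof -
  define a where "a e = lam e powr (- (1 - \<delta>))" for e
  have a: "0 < a e" if "e \<in> E" for e using pos[OF that] by (simp add: a_def)
  have suma: "a summable_on E" using sum by (simp add: a_def[abs_def])
  have "{e \<in> E. a e \<noteq> 0} = E" using a by force
  with summable_countable_real[OF suma] show "countable E" by simp
  define S where "S = infsum a E"
  have aS: "a e \<le> S" if "e \<in> E" for e
    using finite_sum_le_infsum[OF suma, of "{e}"] that a by (auto simp: S_def intro: less_imp_le)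
  define c where "c = S powr (\<delta> / (1 - \<delta>))"
  have bound: "1 / lam e \<le> c * a e" if e: "e \<in> E" for e
  proof -
    have "a e powr (\<delta> / (1 - \<delta>)) = lam e powr (- \<delta>)"
    proof -
      have "- (1 - \<delta>) * (\<delta> / (1 - \<delta>)) = - \<delta>" using \<delta> by (simp add: field_simps)
      then show ?thesis by (simp only: a_def powr_powr)
    qed
    moreover have "a e powr (\<delta> / (1 - \<delta>)) \<le> c" unfolding c_def
      using a[OF e] aS[OF e] \<delta> by (intro powr_mono2) auto
    ultimately have "lam e powr (- \<delta>) * a e \<le> c * a e" using a[OF e] by (intro mult_right_mono) auto
    moreover have "lam e powr (- \<delta>) * a e = 1 / lam e"
    proof -
      have "lam e powr (- \<delta>) * a e = lam e powr (- 1)" unfolding a_def by (simp flip: powr_add)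
      then show ?thesis using pos[OF e] by (simp add: powr_minus_divide)
    qed
    ultimately show ?thesis by simp
  qed
  have "integrable (count_space E) a"
    using suma abs_summable_equivalent[of a E] summable_on_iff_abs_summable_on_real[of a E]
    by (simp add: Infinite_Set_Sum.abs_summable_on_def)
  then have "integrable (count_space E) (\<lambda>e. c * a e)" by (rule integrable_mult_right)
  then have fin: "(\<integral>\<^sup>+e. ennreal (norm (c * a e)) \<partial>count_space E) < \<infinity>"
    unfolding integrable_iff_bounded by (rule conjunct2)
  have "(\<integral>\<^sup>+e. ennreal (1 / lam e) \<partial>count_space E) \<le> (\<integral>\<^sup>+e. ennreal (norm (c * a e)) \<partial>count_space E)"
    by (intro nn_integral_mono ennreal_leI) (auto intro!: order_trans[OF bound])
  with fin show "(\<integral>\<^sup>+e. ennreal (1 / lam e) \<partial>count_space E) < \<infinity>" by simp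
qed

lemma nn_integral_exp_decay_le:
  fixes l r s :: real
  assumes l: "l > 0" and sr: "s \<le> r"
  shows "(\<integral>\<^sup>+u. ennreal (exp (- (2 * l * (r - u)))) * indicator {s..r} u \<partial>lborel) \<le> ennreal (1 / l)"
proof -
  have "(\<integral>\<^sup>+u. ennreal (exp (- (2 * l * (r - u)))) * indicator {s..r} u \<partial>lborel) = ennreal (exp (- (2 * l * (r - r))) / (2 * l) - exp (- (2 * l * (r - s))) / (2 * l))"
  proof (rule nn_integral_FTC_Icc[where F = "\<lambda>u. exp (- (2 * l * (r - u))) / (2 * l)" and f = "\<lambda>u. exp (- (2 * l * (r - u)))"])
    show "((\<lambda>u. exp (- (2 * l * (r - u))) / (2 * l)) has_real_derivative exp (- (2 * l * (r - u)))) (at u)" for u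
      using l by (auto intro!: derivative_eq_intros)
  qed (use sr in auto)
  also have "\<dots> \<le> ennreal (1 / l)"
  proof (rule ennreal_leI)
    have "0 \<le> exp (- (2 * l * (r - s))) / (2 * l)" using l by simp
    moreover have "1 / (2 * l) \<le> 1 / l" using l by (simp add: field_simps)
    ultimately show "exp (- (2 * l * (r - r))) / (2 * l) - exp (- (2 * l * (r - s))) / (2 * l) \<le> 1 / l" by simp
  qed
  finally show ?thesis .
qed

lemma wiener_int_zero: "wiener_int M W (\<lambda>r. 0) (\<lambda>\<omega>. 0)"
  unfolding wiener_int_def by (intro conjI exI[of _ "\<lambda>k. []"]) (auto simp: stepfun_def stepint_def)

text \<open>In the direction of an eigenvector e the kernel decays like exp(-\<lambda>(r - u)), so
  the variance of that coordinate is at most C^2/\<lambda>. Summing over the basis bounds the second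
  moment of the norm uniformly in r.\<close>

lemma stoch_conv_second_moment:
  fixes S2 :: "real \<Rightarrow> ('b::{real_inner,banach,second_countable_topology} \<Rightarrow>\<^sub>L 'b)"
    and W :: "real \<Rightarrow> 'c::{real_inner,banach,second_countable_topology} \<Rightarrow> 'w \<Rightarrow> real"
  assumes W: "cyl_BM M W" and Nm: "\<And>r. N r \<in> borel_measurable M"
    and onb: "\<forall>e\<in>E. norm e = 1" "\<forall>e\<in>E. \<forall>e'\<in>E. e \<noteq> e' \<longrightarrow> e \<bullet> e' = 0" "closure (span E) = UNIV"
    and lam: "\<And>e. e \<in> E \<Longrightarrow> 0 < lam e" and eig: "\<And>e t. e \<in> E \<Longrightarrow> t \<ge> 0 \<Longrightarrow> op_adj (S2 t) e = exp (- lam e * t) *\<^sub>R e"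
    and \<delta>: "0 < \<delta>" "\<delta> < 1" "(\<lambda>e. lam e powr (- (1 - \<delta>))) summable_on E"
    and \<sigma>: "\<And>u. u \<in> {s..T} \<Longrightarrow> norm (\<sigma> u) \<le> C" "C \<ge> 0"
    and meas: "\<And>r h. r \<in> {s..T} \<Longrightarrow> (\<lambda>u. if u \<in> {s..r} then op_adj (\<sigma> u) (op_adj (S2 (r - u)) h) else 0) \<in> borel_measurable borel"
    and N: "\<And>r h. r \<in> {s..T} \<Longrightarrow> wiener_int M W (\<lambda>u. if u \<in> {s..r} then op_adj (\<sigma> u) (op_adj (S2 (r - u)) h) else 0) (\<lambda>\<omega>. h \<bullet> N r \<omega>)"
  obtains K where "K \<ge> 0" "\<And>r. r \<in> {s..T} \<Longrightarrow> (\<integral>\<^sup>+\<omega>. ennreal ((norm (N r \<omega>))\<^sup>2) \<partial>M) \<le> ennreal K"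
proof -
  note [measurable] = Nm
  note lfin = nn_integral_inverse_eigenvalues_finite[OF lam \<delta>]
  define L where "L = ennreal (C\<^sup>2) * (\<integral>\<^sup>+e. ennreal (1 / lam e) \<partial>count_space E)"
  have L: "L < \<infinity>" unfolding L_def using lfin(2) by (simp add: ennreal_mult_less_top)
  have coord: "(\<integral>\<^sup>+\<omega>. ennreal ((e \<bullet> N r \<omega>)\<^sup>2) \<partial>M) \<le> ennreal (C\<^sup>2) * ennreal (1 / lam e)" if r: "r \<in> {s..T}" and e: "e \<in> E" for r e
  proof -
    let ?g = "\<lambda>u. if u \<in> {s..r} then op_adj (\<sigma> u) (op_adj (S2 (r - u)) e) else 0"
    have pt: "ennreal ((norm (?g u))\<^sup>2) \<le> ennreal (C\<^sup>2) * (ennreal (exp (- (2 * lam e * (r - u)))) * indicator {s..r} u)" for u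
    proof (cases "u \<in> {s..r}")
      case True
      have "norm (?g u) \<le> norm (op_adj (\<sigma> u)) * norm (exp (- lam e * (r - u)) *\<^sub>R e)"
        using True eig[OF e, of "r - u"] norm_blinfun[of "op_adj (\<sigma> u)" "exp (- lam e * (r - u)) *\<^sub>R e"] by simp
      also have "\<dots> \<le> C * exp (- lam e * (r - u))"
        using onb(1) e True r \<sigma>(1)[of u] norm_op_adj_le[of "\<sigma> u"] by (intro mult_mono) (auto intro: \<sigma>(2))
      finally have "(norm (?g u))\<^sup>2 \<le> (C * exp (- lam e * (r - u)))\<^sup>2" by (intro power_mono) auto
      also have "\<dots> = C\<^sup>2 * exp (- (2 * lam e * (r - u)))"
        by (simp add: power_mult_distrib power2_eq_square flip: exp_add)
      finally have "ennreal ((norm (?g u))\<^sup>2) \<le> ennreal (C\<^sup>2 * exp (- (2 * lam e * (r - u))))" by (rule ennreal_leI)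
      then show ?thesis using True by (simp add: ennreal_mult)
    qed auto
    have "(\<integral>\<^sup>+u. ennreal ((norm (?g u))\<^sup>2) \<partial>lborel) \<le> (\<integral>\<^sup>+u. ennreal (C\<^sup>2) * (ennreal (exp (- (2 * lam e * (r - u)))) * indicator {s..r} u) \<partial>lborel)"
      by (intro nn_integral_mono pt)
    also have "\<dots> = ennreal (C\<^sup>2) * (\<integral>\<^sup>+u. ennreal (exp (- (2 * lam e * (r - u)))) * indicator {s..r} u \<partial>lborel)"
      by (rule nn_integral_cmult) measurable
    also have "\<dots> \<le> ennreal (C\<^sup>2) * ennreal (1 / lam e)"
      using r by (intro mult_left_mono nn_integral_exp_decay_le lam e) auto
    finally have gb: "(\<integral>\<^sup>+u. ennreal ((norm (?g u))\<^sup>2) \<partial>lborel) \<le> ennreal (C\<^sup>2) * ennreal (1 / lam e)" .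
    have gfin: "(\<integral>\<^sup>+u. ennreal ((norm (?g u))\<^sup>2) \<partial>lborel) < \<infinity>"
      by (rule le_less_trans[OF gb]) (simp add: ennreal_mult_less_top)
    note c = wiener_int_covariance[OF W N[OF r, of e] N[OF r, of e] meas[OF r] meas[OF r] gfin gfin]
    have "(\<integral>\<^sup>+\<omega>. ennreal ((e \<bullet> N r \<omega>)\<^sup>2) \<partial>M) = ennreal (\<integral>\<omega>. (e \<bullet> N r \<omega>)\<^sup>2 \<partial>M)"
      using c(1) by (intro nn_integral_eq_integral) (auto simp: power2_eq_square)
    also have "(\<integral>\<omega>. (e \<bullet> N r \<omega>)\<^sup>2 \<partial>M) = (\<integral>u. (norm (?g u))\<^sup>2 \<partial>lborel)"
      unfolding power2_norm_eq_inner c(2)[symmetric] by (simp add: power2_eq_square)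
    also have "ennreal \<dots> = (\<integral>\<^sup>+u. ennreal ((norm (?g u))\<^sup>2) \<partial>lborel)"
      using gfin meas[OF r, of e] by (intro nn_integral_eq_integral[symmetric]) (auto simp: integrable_norm_power2_iff)
    finally show ?thesis using gb by simp
  qed
  have bound: "(\<integral>\<^sup>+\<omega>. ennreal ((norm (N r \<omega>))\<^sup>2) \<partial>M) \<le> L" if r: "r \<in> {s..T}" for r
  proof -
    have "(\<integral>\<^sup>+\<omega>. ennreal ((norm (N r \<omega>))\<^sup>2) \<partial>M) \<le> (\<integral>\<^sup>+\<omega>. (\<integral>\<^sup>+e. ennreal ((e \<bullet> N r \<omega>)\<^sup>2) \<partial>count_space E) \<partial>M)"
      by (intro nn_integral_mono norm_power2_le_nn_integral_coordinates onb)
    also have "\<dots> = (\<integral>\<^sup>+e. (\<integral>\<^sup>+\<omega>. ennreal ((e \<bullet> N r \<omega>)\<^sup>2) \<partial>M) \<partial>count_space E)"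
      by (rule nn_integral_count_space_nn_integral[OF lfin(1)]) measurable
    also have "\<dots> \<le> (\<integral>\<^sup>+e. ennreal (C\<^sup>2) * ennreal (1 / lam e) \<partial>count_space E)"
      by (intro nn_integral_mono coord r) simp
    also have "\<dots> = L" unfolding L_def by (rule nn_integral_cmult) simp
    finally show ?thesis .
  qed
  show ?thesis
  proof (rule that[of "enn2real L"])
    show "(\<integral>\<^sup>+\<omega>. ennreal ((norm (N r \<omega>))\<^sup>2) \<partial>M) \<le> ennreal (enn2real L)" if "r \<in> {s..T}" for r
      using bound[OF that] L by simp
  qed simp
qed

section \<open>The derivative formula\<close>

text \<open>The spectral assumption takes the form of an orthonormal set \<open>E\<close> with dense
  span, consisting of eigenvectors of the generator of \<open>S2\<close> with eigenvalue
  \<open>- lam e\<close>; multiplicity is counted by the elements of \<open>E\<close>.\<close>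

locale degenerate_linear_SDE =
  fixes M :: "'w measure"
    and W :: "real \<Rightarrow> 'c::{real_inner, banach, second_countable_topology} \<Rightarrow> 'w \<Rightarrow> real"
    and S1 :: "real \<Rightarrow> ('a::{real_inner, banach, second_countable_topology} \<Rightarrow>\<^sub>L 'a)"
    and S2 :: "real \<Rightarrow> ('b::{real_inner, banach, second_countable_topology} \<Rightarrow>\<^sub>L 'b)"
    and B :: "'b \<Rightarrow>\<^sub>L 'a"
    and \<sigma> :: "real \<Rightarrow> ('c \<Rightarrow>\<^sub>L 'b)"
    and A0 :: "'a \<Rightarrow>\<^sub>L 'a"
    and E :: "'b set" and lam :: "'b \<Rightarrow> real" and \<delta> :: real
    and T s :: real
    and N :: "real \<Rightarrow> 'w \<Rightarrow> 'b"
  assumes W: "cyl_BM M W"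
    and sg1: "c0_semigroup S1" and sg2: "c0_semigroup S2"
    and \<sigma>_meas: "\<sigma> \<in> borel_measurable borel"
    and \<sigma>_bdd: "\<forall>t. \<exists>C. \<forall>r \<in> {0..t}. norm (\<sigma> r) \<le> C"
    and H1_inv: "\<forall>t \<ge> 0. op_invertible (\<sigma> t o\<^sub>L op_adj (\<sigma> t))"
    and H1_bdd: "\<forall>t. \<exists>C. \<forall>r \<in> {0..t}. norm (op_inv (\<sigma> r o\<^sub>L op_adj (\<sigma> r))) \<le> C"
    and H2_inv: "op_invertible (B o\<^sub>L op_adj B)"
    and H2_comm: "\<forall>t \<ge> 0. B o\<^sub>L S2 t = S1 t o\<^sub>L op_exp (t *\<^sub>R A0) o\<^sub>L B"
    and H3_onb: "\<forall>e \<in> E. norm e = 1" "\<forall>e \<in> E. \<forall>e' \<in> E. e \<noteq> e' \<longrightarrow> e \<bullet> e' = 0" "closure (span E) = UNIV"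
    and H3_eig: "\<forall>e \<in> E. 0 < lam e \<and> sg_gen S2 e (- (lam e *\<^sub>R e))"
    and H3_sum: "0 < \<delta>" "\<delta> < 1" "(\<lambda>e. lam e powr (- (1 - \<delta>))) summable_on E"
    and s: "0 \<le> s" "s < T"
    and N: "stoch_conv M W S2 \<sigma> s N"
begin

sublocale prob_space M by (rule cyl_BM_prob_space[OF W])

sublocale P: pair_sigma_finite lborel M ..

lemma S_add:
  assumes "0 \<le> t" "0 \<le> u"
  shows "S1 (t + u) x = S1 t (S1 u x)" "S2 (t + u) y = S2 t (S2 u y)"
  using sg1 sg2 assms by (auto simp: c0_semigroup_def)

lemma S2_eigen: "e \<in> E \<Longrightarrow> t \<ge> 0 \<Longrightarrow> S2 t e = exp (- lam e * t) *\<^sub>R e"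
  using H3_eig by (intro c0_semigroup_eigenvector[OF sg2]) auto

lemma S2_adj: "t \<ge> 0 \<Longrightarrow> op_adj (S2 t) = S2 t"
  by (rule op_adj_diagonal[OF H3_onb(2,3) S2_eigen])

lemma N_joint: "(\<lambda>p. N (fst p) (snd p)) \<in> borel_measurable (lborel \<Otimes>\<^sub>M M)"
  using N by (simp add: stoch_conv_def split_beta')

lemma N_measurable [measurable]: "N r \<in> borel_measurable M"
  using measurable_compose[OF measurable_Pair1'[of r lborel M] N_joint] by simp

lemma measurable_adj_\<sigma>:
  assumes "u \<in> borel_measurable X" "x \<in> borel_measurable X"
  shows "(\<lambda>p. op_adj (\<sigma> (u p)) (x p)) \<in> borel_measurable X"
proof (rule borel_measurable_blinfun_apply[OF _ assms(2)])
  have "(\<lambda>r. op_adj (\<sigma> r)) \<in> borel_measurable borel"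
    by (rule borel_measurable_continuous_on[OF linear_continuous_on[OF bounded_linear_op_adj] \<sigma>_meas])
  from measurable_compose[OF assms(1) this] show "(\<lambda>p. op_adj (\<sigma> (u p))) \<in> borel_measurable X" .
qed

text \<open>The integrand of the Wiener integral \<open>\<langle>h, N_r\<rangle>\<close>.\<close>

definition kern :: "real \<Rightarrow> 'b \<Rightarrow> real \<Rightarrow> 'c" where
  "kern r h u = (if u \<in> {s..r} then op_adj (\<sigma> u) (op_adj (S2 (r - u)) h) else 0)"

text \<open>Self-adjointness removes the adjoint of \<open>S2\<close>, and the clamp at 0 matches
  the form in which the semigroup is jointly measurable.\<close>

lemma kern_eq: "kern r h u = indicator {s..r} u *\<^sub>R op_adj (\<sigma> u) (S2 (max 0 (r - u)) h)"
  by (simp add: kern_def S2_adj)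

lemma kern_measurable [measurable]: "kern r h \<in> borel_measurable borel"
proof -
  have "(\<lambda>u. op_adj (\<sigma> u) (S2 (max 0 (r - u)) h)) \<in> borel_measurable borel"
    by (rule measurable_adj_\<sigma>) (auto intro!: c0_semigroup_measurable[OF sg2])
  then show ?thesis unfolding kern_eq[abs_def] by measurable
qed

lemma kern_wiener:
  assumes "r \<ge> s" shows "wiener_int M W (kern r h) (\<lambda>\<omega>. h \<bullet> N r \<omega>)"
proof -
  obtain Z where "wiener_int M W (kern r h) Z" "AE \<omega> in M. h \<bullet> N r \<omega> = Z \<omega>"
    using N assms unfolding stoch_conv_def kern_def[abs_def] by blast
  then have Z: "wiener_int M W (kern r h) Z" and AE: "AE \<omega> in M. Z \<omega> = h \<bullet> N r \<omega>" by (simp_all add: eq_commute)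
  show ?thesis by (rule wiener_int_cong_AE[OF Z _ AE]) measurable
qed

lemma bounds:
  obtains C where "C \<ge> 0" "\<And>r. r \<in> {0..T} \<Longrightarrow> norm (\<sigma> r) \<le> C" "\<And>r. r \<in> {0..T} \<Longrightarrow> norm (S1 r) \<le> C"
    "\<And>r. r \<in> {0..T} \<Longrightarrow> norm (S2 r) \<le> C" "\<And>r. r \<in> {0..T} \<Longrightarrow> norm (op_inv (\<sigma> r o\<^sub>L op_adj (\<sigma> r))) \<le> C"
proof -
  obtain a where a: "\<forall>r\<in>{0..T}. norm (\<sigma> r) \<le> a" using \<sigma>_bdd by blast
  obtain b where b: "\<forall>r\<in>{0..T}. norm (op_inv (\<sigma> r o\<^sub>L op_adj (\<sigma> r))) \<le> b" using H1_bdd by blast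
  obtain c where c: "\<forall>r\<in>{0..T}. norm (S1 r) \<le> c" using c0_semigroup_locally_bounded[OF sg1] by blast
  obtain d where d: "\<forall>r\<in>{0..T}. norm (S2 r) \<le> d" using c0_semigroup_locally_bounded[OF sg2] by blast
  show ?thesis
    by (rule that[of "max 0 (max (max a b) (max c d))"]) (use a b c d in \<open>auto simp: le_max_iff_disj\<close>)
qed

lemma kern_bounded:
  obtains C where "C \<ge> 0" "\<And>r h u. r \<le> T \<Longrightarrow> norm (kern r h u) \<le> C * norm h * indicator {s..T} u"
proof -
  obtain C where C: "C \<ge> 0" "\<And>r. r \<in> {0..T} \<Longrightarrow> norm (\<sigma> r) \<le> C" "\<And>r. r \<in> {0..T} \<Longrightarrow> norm (S1 r) \<le> C"
    "\<And>r. r \<in> {0..T} \<Longrightarrow> norm (S2 r) \<le> C" "\<And>r. r \<in> {0..T} \<Longrightarrow> norm (op_inv (\<sigma> r o\<^sub>L op_adj (\<sigma> r))) \<le> C"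
    using bounds by blast
  show ?thesis
  proof (rule that[of "C * C"])
    fix r h u assume r: "r \<le> T"
    show "norm (kern r h u) \<le> C * C * norm h * indicator {s..T} u"
    proof (cases "u \<in> {s..r}")
      case True
      then have u: "u \<in> {0..T}" "r - u \<in> {0..T}" "u \<in> {s..T}" using s r by auto
      have "norm (kern r h u) \<le> norm (op_adj (\<sigma> u)) * norm (S2 (max 0 (r - u)) h)"
        using True by (simp add: kern_eq norm_blinfun)
      also have "\<dots> \<le> C * (C * norm h)"
      proof (intro mult_mono)
        show "norm (op_adj (\<sigma> u)) \<le> C" using norm_op_adj_le[of "\<sigma> u"] C(2)[OF u(1)] by linarith
        have "norm (S2 (max 0 (r - u)) h) \<le> norm (S2 (r - u)) * norm h" using u by (simp add: norm_blinfun max_def)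
        also have "\<dots> \<le> C * norm h" by (intro mult_right_mono C u) auto
        finally show "norm (S2 (max 0 (r - u)) h) \<le> C * norm h" .
      qed (use C(1) in auto)
      finally show ?thesis using u by simp
    qed (use C(1) in \<open>auto simp: kern_def\<close>)
  qed (use C(1) in auto)
qed

lemma N_second_moment:
  obtains K where "K \<ge> 0" "\<And>r. r \<in> {s..T} \<Longrightarrow> (\<integral>\<^sup>+\<omega>. ennreal ((norm (N r \<omega>))\<^sup>2) \<partial>M) \<le> ennreal K"
proof -
  obtain C where C: "C \<ge> 0" "\<And>r. r \<in> {0..T} \<Longrightarrow> norm (\<sigma> r) \<le> C" "\<And>r. r \<in> {0..T} \<Longrightarrow> norm (S1 r) \<le> C"
    "\<And>r. r \<in> {0..T} \<Longrightarrow> norm (S2 r) \<le> C" "\<And>r. r \<in> {0..T} \<Longrightarrow> norm (op_inv (\<sigma> r o\<^sub>L op_adj (\<sigma> r))) \<le> C"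
    using bounds by blast
  show ?thesis
  proof (rule stoch_conv_second_moment[OF W N_measurable H3_onb _ _ H3_sum, where ?S2.0 = S2 and \<sigma> = \<sigma> and s = s and T = T and C = C])
    show "op_adj (S2 t) e = exp (- lam e * t) *\<^sub>R e" if "e \<in> E" "t \<ge> 0" for e t
      using that by (simp add: S2_adj S2_eigen)
    show "wiener_int M W (\<lambda>u. if u \<in> {s..r} then op_adj (\<sigma> u) (op_adj (S2 (r - u)) h) else 0) (\<lambda>\<omega>. h \<bullet> N r \<omega>)"
      if "r \<in> {s..T}" for r h using that kern_wiener[of r h] by (simp add: kern_def[abs_def])
    show "(\<lambda>u. if u \<in> {s..r} then op_adj (\<sigma> u) (op_adj (S2 (r - u)) h) else 0) \<in> borel_measurable borel" for r h
      using kern_measurable[of r h] by (simp add: kern_def[abs_def])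
    show "thesis" if "K \<ge> 0" "\<And>r. r \<in> {s..T} \<Longrightarrow> (\<integral>\<^sup>+\<omega>. ennreal ((norm (N r \<omega>))\<^sup>2) \<partial>M) \<le> ennreal K" for K
      using that by (rule \<open>\<And>K. 0 \<le> K \<Longrightarrow> (\<And>r. r \<in> {s..T} \<Longrightarrow> (\<integral>\<^sup>+\<omega>. ennreal ((norm (N r \<omega>))\<^sup>2) \<partial>M) \<le> ennreal K) \<Longrightarrow> thesis\<close>)
  qed (use C s H3_eig in auto)
qed

section \<open>The noise part of the solution\<close>

text \<open>Under the guard \<open>P\<close> the time is nonnegative, so the clamped semigroup,
  measurable everywhere, agrees with the unclamped one wherever it is evaluated.\<close>

lemma S1_measurable:
  assumes "t \<in> borel_measurable X" "x \<in> borel_measurable X" "\<And>p. p \<in> space X \<Longrightarrow> P p \<Longrightarrow> 0 \<le> t p"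
    and [measurable]: "Measurable.pred X P"
  shows "(\<lambda>p. if P p then S1 (t p) (x p) else 0) \<in> borel_measurable X"
proof -
  have [measurable]: "(\<lambda>p. S1 (max 0 (t p)) (x p)) \<in> borel_measurable X"
    by (rule c0_semigroup_measurable[OF sg1 assms(1,2)])
  have "(\<lambda>p. if P p then S1 (max 0 (t p)) (x p) else 0) \<in> borel_measurable X" by measurable
  then show ?thesis by (rule measurable_cong[THEN iffD1, rotated]) (use assms(3) in \<open>auto simp: max_def\<close>)
qed

definition xint :: "real \<Rightarrow> 'w \<Rightarrow> 'a" where
  "xint r \<omega> = (if r \<in> {s..T} then S1 (T - r) (B (N r \<omega>)) else 0)"

lemma xint_joint: "(\<lambda>p. xint (fst p) (snd p)) \<in> borel_measurable (lborel \<Otimes>\<^sub>M M)"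
  unfolding xint_def
proof (rule S1_measurable)
  have "(\<lambda>x. B x) \<in> borel_measurable borel"
    by (intro borel_measurable_continuous_onI continuous_intros)
  from measurable_compose[OF N_joint this] show "(\<lambda>p. B (N (fst p) (snd p))) \<in> borel_measurable (lborel \<Otimes>\<^sub>M M)" .
qed (auto simp: max_def)

text \<open>The second moment of \<open>N r\<close> is bounded uniformly in r, hence so is the first
  moment of its norm. The integrand is therefore integrable over time and sample space together, and
  almost every path is integrable.\<close>

lemma xint_integrable: "AE \<omega> in M. integrable lborel (\<lambda>r. xint r \<omega>)"
proof -
  obtain C where C: "C \<ge> 0" "\<And>r. r \<in> {0..T} \<Longrightarrow> norm (\<sigma> r) \<le> C" "\<And>r. r \<in> {0..T} \<Longrightarrow> norm (S1 r) \<le> C"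
    "\<And>r. r \<in> {0..T} \<Longrightarrow> norm (S2 r) \<le> C" "\<And>r. r \<in> {0..T} \<Longrightarrow> norm (op_inv (\<sigma> r o\<^sub>L op_adj (\<sigma> r))) \<le> C"
    using bounds by blast
  obtain K where K: "K \<ge> 0" "\<And>r. r \<in> {s..T} \<Longrightarrow> (\<integral>\<^sup>+\<omega>. ennreal ((norm (N r \<omega>))\<^sup>2) \<partial>M) \<le> ennreal K"
    using N_second_moment by blast
  define c where "c = C * norm B"
  have c: "c \<ge> 0" using C by (simp add: c_def)
  have "integrable (lborel \<Otimes>\<^sub>M M) (\<lambda>p. xint (fst p) (snd p))"
  proof (rule integrableI_bounded[OF xint_joint])
    have "(\<integral>\<^sup>+p. ennreal (norm (xint (fst p) (snd p))) \<partial>(lborel \<Otimes>\<^sub>M M)) = (\<integral>\<^sup>+r. (\<integral>\<^sup>+\<omega>. ennreal (norm (xint r \<omega>)) \<partial>M) \<partial>lborel)"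
      using xint_joint by (subst nn_integral_fst[symmetric]) (auto simp: split_beta')
    also have "\<dots> \<le> (\<integral>\<^sup>+r. ennreal (c * (1 + K)) * indicator {s..T} r \<partial>lborel)"
    proof (rule nn_integral_mono)
      fix r
      show "(\<integral>\<^sup>+\<omega>. ennreal (norm (xint r \<omega>)) \<partial>M) \<le> ennreal (c * (1 + K)) * indicator {s..T} r"
      proof (cases "r \<in> {s..T}")
        case True
        have "(\<integral>\<^sup>+\<omega>. ennreal (norm (xint r \<omega>)) \<partial>M) \<le> (\<integral>\<^sup>+\<omega>. ennreal c * (1 + ennreal ((norm (N r \<omega>))\<^sup>2)) \<partial>M)"
        proof (rule nn_integral_mono)
          fix \<omega>
          have "norm (xint r \<omega>) \<le> norm (S1 (T - r)) * norm (B (N r \<omega>))" using True by (simp add: xint_def norm_blinfun)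
          also have "\<dots> \<le> C * (norm B * norm (N r \<omega>))"
            using True s C by (intro mult_mono norm_blinfun) auto
          also have "\<dots> \<le> c * (1 + (norm (N r \<omega>))\<^sup>2)"
          proof -
            have "norm (N r \<omega>) \<le> 1 + (norm (N r \<omega>))\<^sup>2"
              using sum_squares_bound[of 1 "norm (N r \<omega>)"] norm_ge_zero[of "N r \<omega>"] unfolding power_one mult_1_right by linarith
            then show ?thesis unfolding c_def mult.assoc using C(1) by (intro mult_left_mono) auto
          qed
          finally have "ennreal (norm (xint r \<omega>)) \<le> ennreal (c * (1 + (norm (N r \<omega>))\<^sup>2))" by (rule ennreal_leI)
          then show "ennreal (norm (xint r \<omega>)) \<le> ennreal c * (1 + ennreal ((norm (N r \<omega>))\<^sup>2))"
            using c by (simp add: ennreal_mult ennreal_plus)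
        qed
        also have "\<dots> = ennreal c * (1 + (\<integral>\<^sup>+\<omega>. ennreal ((norm (N r \<omega>))\<^sup>2) \<partial>M))"
          by (simp add: nn_integral_cmult nn_integral_add emeasure_space_1)
        also have "\<dots> \<le> ennreal c * (1 + ennreal K)" by (intro mult_left_mono add_left_mono K True) auto
        also have "\<dots> = ennreal (c * (1 + K))" using c K by (simp add: ennreal_mult ennreal_plus)
        finally show ?thesis using True by simp
      next
        case False
        then have "xint r = (\<lambda>_. 0)" by (auto simp: xint_def)
        then show ?thesis by simp
      qed
    qed
    also have "\<dots> < \<infinity>" using s by (simp add: nn_integral_cmult_indicator ennreal_mult_less_top)
    finally show "(\<integral>\<^sup>+p. ennreal (norm (xint (fst p) (snd p))) \<partial>(lborel \<Otimes>\<^sub>M M)) < \<infinity>" .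
  qed
  then have "integrable (lborel \<Otimes>\<^sub>M M) (\<lambda>(r, \<omega>). xint r \<omega>)" by (simp add: split_beta')
  from P.AE_integrable_snd[OF this] show ?thesis .
qed

text \<open>The exceptional paths with a non-integrable integrand form a null set; there the Bochner
  integral takes its default value 0.\<close>

definition NX :: "'w \<Rightarrow> 'a" where "NX \<omega> = (\<integral>r. xint r \<omega> \<partial>lborel)"

lemma NX_measurable [measurable]: "NX \<in> borel_measurable M"
proof -
  have "(\<lambda>(r, \<omega>). xint r \<omega>) \<in> borel_measurable (lborel \<Otimes>\<^sub>M M)" using xint_joint by (simp add: split_beta')
  then have "(\<lambda>(\<omega>, r). xint r \<omega>) \<in> borel_measurable (M \<Otimes>\<^sub>M lborel)"
    using measurable_pair_swap[of "\<lambda>(r, \<omega>). xint r \<omega>"] by (simp add: split_beta')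
  then show ?thesis unfolding NX_def[abs_def] by (rule lborel.borel_measurable_lebesgue_integral)
qed

text \<open>The functional k carried back through the semigroup and \<open>B\<close>, so that
  pairing k with \<open>NX\<close> becomes an integral of the weakly known quantities
  \<open>dual k r \<bullet> N r \<omega>\<close>.\<close>

definition dual :: "'a \<Rightarrow> real \<Rightarrow> 'b" where
  "dual k r = (if r \<in> {s..T} then op_adj B (op_adj (S1 (T - r)) k) else 0)"

lemma dual_inner: "dual k r \<bullet> x = (if r \<in> {s..T} then k \<bullet> S1 (T - r) (B x) else 0)"
  by (simp add: dual_def op_adj_inner)

lemma dual_measurable [measurable]: "dual k \<in> borel_measurable borel"
proof (rule borel_measurable_inner_weakI)
  fix x
  have "(\<lambda>r. if r \<in> {s..T} then S1 (T - r) (B x) else 0) \<in> borel_measurable borel"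
    by (rule S1_measurable) (auto simp: max_def)
  then have "(\<lambda>r. k \<bullet> (if r \<in> {s..T} then S1 (T - r) (B x) else 0)) \<in> borel_measurable borel" by measurable
  moreover have "x \<bullet> dual k r = k \<bullet> (if r \<in> {s..T} then S1 (T - r) (B x) else 0)" for r
    using dual_inner[of k r x] by (simp add: inner_commute)
  ultimately show "(\<lambda>r. x \<bullet> dual k r) \<in> borel_measurable borel" by simp
qed

lemma dual_bounded: obtains C where "C \<ge> 0" "\<And>r. norm (dual k r) \<le> C"
proof -
  obtain C where C: "C \<ge> 0" "\<And>r. r \<in> {0..T} \<Longrightarrow> norm (\<sigma> r) \<le> C" "\<And>r. r \<in> {0..T} \<Longrightarrow> norm (S1 r) \<le> C"
    "\<And>r. r \<in> {0..T} \<Longrightarrow> norm (S2 r) \<le> C" "\<And>r. r \<in> {0..T} \<Longrightarrow> norm (op_inv (\<sigma> r o\<^sub>L op_adj (\<sigma> r))) \<le> C"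
    using bounds by blast
  show ?thesis
  proof (rule that[of "norm B * (C * norm k)"])
    fix r
    show "norm (dual k r) \<le> norm B * (C * norm k)"
    proof (cases "r \<in> {s..T}")
      case True
      have "norm (dual k r) \<le> norm (op_adj B) * (norm (op_adj (S1 (T - r))) * norm k)"
        using True by (auto simp: dual_def intro!: order_trans[OF norm_blinfun] mult_left_mono norm_blinfun)
      also have "\<dots> \<le> norm B * (C * norm k)"
      proof (intro mult_mono norm_op_adj_le)
        show "norm (op_adj (S1 (T - r))) \<le> C"
          using norm_op_adj_le[of "S1 (T - r)"] C(3)[of "T - r"] True s by auto
      qed (use C(1) in auto)
      finally show ?thesis .
    qed (use C(1) in \<open>auto simp: dual_def\<close>)
  qed (use C(1) in auto)
qed

text \<open>The integrand of the Wiener integral \<open>dual k r \<bullet> N r\<close>: the test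
  vector of the kernel now varies with r.\<close>

definition G :: "'a \<Rightarrow> real \<Rightarrow> real \<Rightarrow> 'c" where "G k r u = kern r (dual k r) u"

lemma G_zero: "r \<notin> {s..T} \<Longrightarrow> G k r u = 0"
  by (auto simp: G_def dual_def kern_def blinfun.bilinear_simps)

lemma G_joint: "(\<lambda>(r, u). G k r u) \<in> borel_measurable (borel \<Otimes>\<^sub>M borel)"
proof -
  have [measurable]: "(\<lambda>p. op_adj (\<sigma> (snd p)) (S2 (max 0 (fst p - snd p)) (dual k (fst p)))) \<in> borel_measurable (borel \<Otimes>\<^sub>M borel)"
    by (intro measurable_adj_\<sigma> c0_semigroup_measurable[OF sg2]) measurable
  have "G k (fst p) (snd p) = (if s \<le> snd p \<and> snd p \<le> fst p then op_adj (\<sigma> (snd p)) (S2 (max 0 (fst p - snd p)) (dual k (fst p))) else 0)" for p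
    by (auto simp: G_def kern_eq)
  then show ?thesis unfolding split_beta' by simp measurable
qed

lemma G_bounded: obtains C where "\<And>r u. norm (G k r u) \<le> C * (indicator {s..T} r * indicator {s..T} u)"
proof -
  obtain C where C: "C \<ge> 0" "\<And>r h u. r \<le> T \<Longrightarrow> norm (kern r h u) \<le> C * norm h * indicator {s..T} u"
    using kern_bounded by blast
  obtain D where D: "D \<ge> 0" "\<And>r. norm (dual k r) \<le> D" using dual_bounded[of k] by blast
  show ?thesis
  proof (rule that[of "C * D"])
    fix r u
    show "norm (G k r u) \<le> C * D * (indicator {s..T} r * indicator {s..T} u)"
    proof (cases "r \<in> {s..T}")
      case True
      have "norm (G k r u) \<le> C * norm (dual k r) * indicator {s..T} u" unfolding G_def using True by (intro C(2)) auto
      also have "\<dots> \<le> C * D * indicator {s..T} u" using C(1) D(2) by (intro mult_right_mono mult_left_mono) auto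
      finally show ?thesis using True by simp
    qed (simp add: G_zero)
  qed
qed

definition Gbar :: "'a \<Rightarrow> real \<Rightarrow> 'c" where "Gbar k u = (\<integral>r. G k r u \<partial>lborel)"

text \<open>Stochastic Fubini for the family \<open>G k r\<close>. Times outside [s, T] contribute
  the zero integrand and the zero variable.\<close>

lemma Gbar_facts:
  shows "wiener_int M W (Gbar k) (\<lambda>\<omega>. \<integral>r. dual k r \<bullet> N r \<omega> \<partial>lborel)"
    and "Gbar k \<in> borel_measurable borel"
    and "\<exists>C. \<forall>u. norm (Gbar k u) \<le> C * indicator {s..T} u"
proof -
  obtain C where C: "\<And>r u. norm (G k r u) \<le> C * (indicator {s..T} r * indicator {s..T} u)"
    using G_bounded[of k] by blast
  have y: "(\<lambda>(r, \<omega>). dual k r \<bullet> N r \<omega>) \<in> borel_measurable (lborel \<Otimes>\<^sub>M M)"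
    using N_joint unfolding split_beta' by measurable
  have y0: "dual k r \<bullet> N r \<omega> = 0" if "r \<notin> {s..T}" for r \<omega> using that by (auto simp: dual_inner)
  have WI: "wiener_int M W (G k r) (\<lambda>\<omega>. dual k r \<bullet> N r \<omega>)" for r
  proof (cases "r \<in> {s..T}")
    case True
    then show ?thesis unfolding G_def[abs_def] by (intro kern_wiener) auto
  next
    case False
    then have "G k r = (\<lambda>u. 0)" "(\<lambda>\<omega>. dual k r \<bullet> N r \<omega>) = (\<lambda>\<omega>. 0)" by (auto simp: G_zero y0)
    then show ?thesis using wiener_int_zero[of M W] by simp
  qed
  have sT: "s \<le> T" using s by simp
  note sF = stochastic_Fubini[OF W s(1) sT G_joint y C y0 WI]
  show "wiener_int M W (Gbar k) (\<lambda>\<omega>. \<integral>r. dual k r \<bullet> N r \<omega> \<partial>lborel)" using sF(1) by (simp add: Gbar_def[abs_def])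
  show "Gbar k \<in> borel_measurable borel" using sF(2) by (simp add: Gbar_def[abs_def])
  show "\<exists>C. \<forall>u. norm (Gbar k u) \<le> C * indicator {s..T} u" using sF(3) unfolding Gbar_def by blast
qed

text \<open>Moving the inner product inside the Bochner integral requires an integrable path, hence
  only almost surely.\<close>

lemma inner_NX: "AE \<omega> in M. k \<bullet> NX \<omega> = (\<integral>r. dual k r \<bullet> N r \<omega> \<partial>lborel)"
  using xint_integrable
proof eventually_elim
  case (elim \<omega>)
  have "k \<bullet> NX \<omega> = (\<integral>r. k \<bullet> xint r \<omega> \<partial>lborel)" unfolding NX_def using elim by (intro integral_inner_right[symmetric])
  also have "\<dots> = (\<integral>r. dual k r \<bullet> N r \<omega> \<partial>lborel)"
    by (intro Bochner_Integration.integral_cong) (auto simp: dual_inner xint_def)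
  finally show ?case .
qed

definition Gk :: "'a \<times> 'b \<Rightarrow> real \<Rightarrow> 'c" where "Gk k u = Gbar (fst k) u + kern T (snd k) u"

definition \<xi> :: "'w \<Rightarrow> 'a \<times> 'b" where "\<xi> \<omega> = (NX \<omega>, N T \<omega>)"

lemma \<xi>_measurable [measurable]: "\<xi> \<in> borel_measurable M"
  unfolding \<xi>_def[abs_def] by measurable

lemma Gk_measurable [measurable]: "Gk k \<in> borel_measurable borel"
  unfolding Gk_def[abs_def] using Gbar_facts(2) by measurable

lemma Gk_wiener: "wiener_int M W (Gk k) (\<lambda>\<omega>. k \<bullet> \<xi> \<omega>)"
proof (rule wiener_int_cong_AE)
  show "wiener_int M W (Gk k) (\<lambda>\<omega>. (\<integral>r. dual (fst k) r \<bullet> N r \<omega> \<partial>lborel) + snd k \<bullet> N T \<omega>)"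
    unfolding Gk_def[abs_def] using s
    by (intro wiener_int_add[OF W Gbar_facts(1) kern_wiener Gbar_facts(2) kern_measurable]) auto
  show "AE \<omega> in M. (\<integral>r. dual (fst k) r \<bullet> N r \<omega> \<partial>lborel) + snd k \<bullet> N T \<omega> = k \<bullet> \<xi> \<omega>"
    using inner_NX[of "fst k"] by eventually_elim (simp add: \<xi>_def inner_prod_def)
qed measurable

lemma Gk_bounded: obtains C where "\<And>u. norm (Gk k u) \<le> C * indicator {s..T} u"
proof -
  obtain C where C: "\<And>u. norm (Gbar (fst k) u) \<le> C * indicator {s..T} u" using Gbar_facts(3) by blast
  obtain D where "D \<ge> 0" and D: "\<And>r h u. r \<le> T \<Longrightarrow> norm (kern r h u) \<le> D * norm h * indicator {s..T} u"
    using kern_bounded by blast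
  show ?thesis
  proof (rule that[of "C + D * norm (snd k)"])
    fix u
    show "norm (Gk k u) \<le> (C + D * norm (snd k)) * indicator {s..T} u"
      unfolding Gk_def using norm_triangle_ineq[of "Gbar (fst k) u" "kern T (snd k) u"] C[of u] D[of T "snd k" u]
      by (simp add: distrib_right)
  qed
qed

section \<open>The noise-free flow and the decomposition of the solution\<close>

text \<open>The commutation relation at time r - s, followed by the semigroup law T - r + (r - s) =
  T - s. All dependence on r moves into the norm continuous exponential, so the remaining time
  integrals have continuous integrands.\<close>

lemma S1_B_S2: "r \<in> {s..T} \<Longrightarrow> S1 (T - r) (B (S2 (r - s) x)) = S1 (T - s) (op_exp ((r - s) *\<^sub>R A0) (B x))"
proof -
  assume r: "r \<in> {s..T}"
  have "B (S2 (r - s) x) = (B o\<^sub>L S2 (r - s)) x" by simp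
  also have "\<dots> = S1 (r - s) (op_exp ((r - s) *\<^sub>R A0) (B x))" using H2_comm r by simp
  finally show ?thesis using S_add(1)[of "T - r" "r - s"] r by simp
qed

text \<open>The solution at time T without noise, its first component rewritten by the commutation
  relation. Being linear in the starting point, it is also the displacement produced by moving that
  point.\<close>

definition flow :: "'a \<times> 'b \<Rightarrow> 'a \<times> 'b" where
  "flow z = (S1 (T - s) (fst z + integral {s..T} (\<lambda>r. op_exp ((r - s) *\<^sub>R A0) (B (snd z)))), S2 (T - s) (snd z))"

lemma op_exp_B_integrable: "(\<lambda>r. op_exp ((r - s) *\<^sub>R A0) (B x)) integrable_on {s..T}"
  by (intro integrable_continuous_real continuous_intros continuous_on_op_exp_shift)

lemma flow_add_scaleR: "flow (z + \<epsilon> *\<^sub>R v) = flow z + \<epsilon> *\<^sub>R flow v"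
proof -
  have "integral {s..T} (\<lambda>r. op_exp ((r - s) *\<^sub>R A0) (B (snd z + \<epsilon> *\<^sub>R snd v)))
     = integral {s..T} (\<lambda>r. op_exp ((r - s) *\<^sub>R A0) (B (snd z))) + \<epsilon> *\<^sub>R integral {s..T} (\<lambda>r. op_exp ((r - s) *\<^sub>R A0) (B (snd v)))"
    using op_exp_B_integrable
    by (simp add: blinfun.bilinear_simps Henstock_Kurzweil_Integration.integral_add integrable_cmul)
  then show ?thesis
    by (simp add: flow_def blinfun.bilinear_simps algebra_simps)
qed

lemma LINT_S1_B_S2:
  shows "integrable lborel (\<lambda>r. indicator {s..T} r *\<^sub>R S1 (T - r) (B (S2 (r - s) x)))"
    and "(\<integral>r. indicator {s..T} r *\<^sub>R S1 (T - r) (B (S2 (r - s) x)) \<partial>lborel) = S1 (T - s) (integral {s..T} (\<lambda>r. op_exp ((r - s) *\<^sub>R A0) (B x)))"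
proof -
  let ?f = "\<lambda>r. op_exp ((r - s) *\<^sub>R A0) (B x)"
  have c: "continuous_on {s..T} ?f" by (intro continuous_intros continuous_on_op_exp_shift)
  have e: "(\<lambda>r. indicator {s..T} r *\<^sub>R S1 (T - r) (B (S2 (r - s) x))) = (\<lambda>r. S1 (T - s) (indicator {s..T} r *\<^sub>R ?f r))"
    by (rule ext) (simp add: indicator_def S1_B_S2)
  have i: "integrable lborel (\<lambda>r. indicator {s..T} r *\<^sub>R ?f r)"
    using set_integrable_continuous_Icc[OF c] by (simp add: set_integrable_def)
  show "integrable lborel (\<lambda>r. indicator {s..T} r *\<^sub>R S1 (T - r) (B (S2 (r - s) x)))"
    unfolding e by (rule integrable_bounded_linear[OF blinfun.bounded_linear_right i])
  have "(\<integral>r. S1 (T - s) (indicator {s..T} r *\<^sub>R ?f r) \<partial>lborel) = S1 (T - s) (\<integral>r. indicator {s..T} r *\<^sub>R ?f r \<partial>lborel)"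
    by (rule integral_bounded_linear[OF blinfun.bounded_linear_right i])
  also have "(\<integral>r. indicator {s..T} r *\<^sub>R ?f r \<partial>lborel) = integral {s..T} ?f"
    using set_lebesgue_integral_eq_integral_Icc[OF c] by (simp add: set_lebesgue_integral_def)
  finally show "(\<integral>r. indicator {s..T} r *\<^sub>R S1 (T - r) (B (S2 (r - s) x)) \<partial>lborel) = S1 (T - s) (integral {s..T} ?f)"
    unfolding e .
qed

lemma solution_eq: "AE \<omega> in M. (Xsol S1 S2 B N s T z \<omega>, Ysol S2 N s T z \<omega>) = flow z + \<xi> \<omega>"
  using xint_integrable
proof eventually_elim
  case (elim \<omega>)
  have "(LINT r:{s..T}|lborel. S1 (T - r) (B (S2 (r - s) (snd z) + N r \<omega>)))
     = (\<integral>r. indicator {s..T} r *\<^sub>R S1 (T - r) (B (S2 (r - s) (snd z))) + xint r \<omega> \<partial>lborel)"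
    unfolding set_lebesgue_integral_def
    by (intro Bochner_Integration.integral_cong) (auto simp: xint_def blinfun.bilinear_simps)
  also have "\<dots> = S1 (T - s) (integral {s..T} (\<lambda>r. op_exp ((r - s) *\<^sub>R A0) (B (snd z)))) + NX \<omega>"
    by (simp add: Bochner_Integration.integral_add[OF LINT_S1_B_S2(1) elim] LINT_S1_B_S2(2) NX_def)
  finally show ?case
    by (simp add: Xsol_def Ysol_def flow_def \<xi>_def blinfun.bilinear_simps)
qed

text \<open>Almost sure equality with \<open>flow z + \<xi> \<omega>\<close> does not yield
  measurability on a measure space that may be incomplete. It is derived from joint measurability of
  the integrand instead, and it allows the integrals in \<open>P0\<close> to be compared almost
  everywhere.\<close>

lemma solution_measurable: "(\<lambda>\<omega>. (Xsol S1 S2 B N s T z \<omega>, Ysol S2 N s T z \<omega>)) \<in> borel_measurable M"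
proof -
  have Y: "(\<lambda>\<omega>. Ysol S2 N s T z \<omega>) \<in> borel_measurable M" unfolding Ysol_def by measurable
  have Bm: "(\<lambda>x. B x) \<in> borel_measurable borel"
    by (intro borel_measurable_continuous_onI continuous_intros)
  have [measurable]: "(\<lambda>p. S2 (max 0 (fst p - s)) (snd z) + N (fst p) (snd p)) \<in> borel_measurable (lborel \<Otimes>\<^sub>M M)"
    by (intro borel_measurable_add N_joint c0_semigroup_measurable[OF sg2]) auto
  have 1: "(\<lambda>p. if fst p \<in> {s..T} then S1 (T - fst p) (B (S2 (max 0 (fst p - s)) (snd z) + N (fst p) (snd p))) else 0) \<in> borel_measurable (lborel \<Otimes>\<^sub>M M)"
    by (intro S1_measurable measurable_compose[OF _ Bm]) auto
  have "(\<lambda>(\<omega>, r). if r \<in> {s..T} then S1 (T - r) (B (S2 (max 0 (r - s)) (snd z) + N r \<omega>)) else 0) \<in> borel_measurable (M \<Otimes>\<^sub>M lborel)"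
  proof -
    have "(\<lambda>p. (snd p, fst p)) \<in> measurable (M \<Otimes>\<^sub>M lborel) (lborel \<Otimes>\<^sub>M M)" by measurable
    from measurable_compose[OF this 1] show ?thesis unfolding split_beta' fst_conv snd_conv .
  qed
  then have "(\<lambda>\<omega>. \<integral>r. (if r \<in> {s..T} then S1 (T - r) (B (S2 (max 0 (r - s)) (snd z) + N r \<omega>)) else 0) \<partial>lborel) \<in> borel_measurable M"
    by (rule lborel.borel_measurable_lebesgue_integral)
  moreover have "(LINT r:{s..T}|lborel. S1 (T - r) (B (S2 (r - s) (snd z) + N r \<omega>))) = (\<integral>r. (if r \<in> {s..T} then S1 (T - r) (B (S2 (max 0 (r - s)) (snd z) + N r \<omega>)) else 0) \<partial>lborel)" for \<omega>
    unfolding set_lebesgue_integral_def by (intro Bochner_Integration.integral_cong) (auto simp: max_def)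
  ultimately have "(\<lambda>\<omega>. Xsol S1 S2 B N s T z \<omega>) \<in> borel_measurable M" unfolding Xsol_def by simp
  then show ?thesis using Y by measurable
qed

text \<open>The integrand of the weight \<open>Z\<close> in the formula.\<close>

definition gir :: "'a \<times> 'b \<Rightarrow> real \<Rightarrow> 'c" where
  "gir v r = (if r \<in> {s..T} then op_adj (\<sigma> r) (op_inv (\<sigma> r o\<^sub>L op_adj (\<sigma> r)) (Phi S2 A0 B s T v r)) else 0)"

section \<open>The weight and its covariance with the noise part\<close>

text \<open>The inverses are known to exist with a common bound on [s, T], so measurability is
  proved on that interval as a restricted space and the function is then extended by 0.\<close>

lemma gir_facts:
  shows "gir v \<in> borel_measurable borel" and "\<exists>C. \<forall>u. norm (gir v u) \<le> C * indicator {s..T} u"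
proof -
  obtain C where C: "C \<ge> 0" "\<And>r. r \<in> {0..T} \<Longrightarrow> norm (\<sigma> r) \<le> C" "\<And>r. r \<in> {0..T} \<Longrightarrow> norm (S1 r) \<le> C"
    "\<And>r. r \<in> {0..T} \<Longrightarrow> norm (S2 r) \<le> C" "\<And>r. r \<in> {0..T} \<Longrightarrow> norm (op_inv (\<sigma> r o\<^sub>L op_adj (\<sigma> r))) \<le> C"
    using bounds by blast
  obtain w where w: "continuous_on UNIV w" "\<And>r. Phi S2 A0 B s T v r = S2 (r - s) (w r)"
    "\<And>r. s \<le> r \<Longrightarrow> (w has_integral ctrl A0 B s T v r) {s..r}"
    using Phi_eq[of S2 A0 B s T v] by blast
  have wm: "w \<in> borel_measurable borel" by (rule borel_measurable_continuous_onI[OF w(1)])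
  have "compact (w ` {s..T})" by (rule compact_continuous_image[OF continuous_on_subset[OF w(1)]]) auto
  then have "bounded (w ` {s..T})" by (rule compact_imp_bounded)
  then obtain D where "\<forall>x\<in>w ` {s..T}. norm x \<le> D" unfolding bounded_iff ..
  then have D: "norm (w r) \<le> D" if "r \<in> {s..T}" for r using that by blast
  have D0: "D \<ge> 0" using D[of s] s by (auto intro: order_trans[OF norm_ge_zero])
  let ?R = "restrict_space borel {s..T}"
  have R: "f \<in> borel_measurable borel \<Longrightarrow> f \<in> borel_measurable ?R" for f :: "real \<Rightarrow> 'd::topological_space"
    by (rule measurable_restrict_space1)
  have sp: "r \<in> {s..T}" if "r \<in> space ?R" for r using that by (simp add: space_restrict_space)
  have cont: "continuous_on UNIV (\<lambda>A :: 'c \<Rightarrow>\<^sub>L 'b. A o\<^sub>L op_adj A)"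
    by (intro continuous_intros linear_continuous_on[OF bounded_linear_op_adj])
  have "(\<lambda>r. \<sigma> r o\<^sub>L op_adj (\<sigma> r)) \<in> borel_measurable ?R"
    by (rule R, rule borel_measurable_continuous_on[OF cont \<sigma>_meas])
  then have inv: "(\<lambda>r. op_inv (\<sigma> r o\<^sub>L op_adj (\<sigma> r))) \<in> borel_measurable ?R"
  proof (rule borel_measurable_op_inv[where C = C])
    fix r assume "r \<in> space ?R"
    then have "r \<in> {0..T}" using sp s by force
    then show "op_invertible (\<sigma> r o\<^sub>L op_adj (\<sigma> r))" "norm (op_inv (\<sigma> r o\<^sub>L op_adj (\<sigma> r))) \<le> C"
      using H1_inv C(5) by auto
  qed
  have phi: "(\<lambda>r. S2 (max 0 (r - s)) (w r)) \<in> borel_measurable ?R"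
    by (rule R, rule c0_semigroup_measurable[OF sg2 _ wm]) measurable
  have "(\<lambda>r. op_adj (\<sigma> r) (op_inv (\<sigma> r o\<^sub>L op_adj (\<sigma> r)) (S2 (max 0 (r - s)) (w r)))) \<in> borel_measurable ?R"
    by (intro measurable_adj_\<sigma> borel_measurable_blinfun_apply inv phi R) measurable
  then have "(\<lambda>r. indicator {s..T} r *\<^sub>R op_adj (\<sigma> r) (op_inv (\<sigma> r o\<^sub>L op_adj (\<sigma> r)) (S2 (max 0 (r - s)) (w r)))) \<in> borel_measurable borel"
    by (subst (asm) borel_measurable_restrict_space_iff) auto
  moreover have "(\<lambda>r. indicator {s..T} r *\<^sub>R op_adj (\<sigma> r) (op_inv (\<sigma> r o\<^sub>L op_adj (\<sigma> r)) (S2 (max 0 (r - s)) (w r)))) = gir v"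
    by (rule ext) (auto simp: gir_def w(2) max_def)
  ultimately show "gir v \<in> borel_measurable borel" by simp
  show "\<exists>C. \<forall>u. norm (gir v u) \<le> C * indicator {s..T} u"
  proof (intro exI allI)
    fix r
    show "norm (gir v r) \<le> (C * (C * (C * D))) * indicator {s..T} r"
    proof (cases "r \<in> {s..T}")
      case True
      then have r: "r \<in> {0..T}" "r - s \<in> {0..T}" using s by auto
      have "norm (gir v r) \<le> norm (op_adj (\<sigma> r)) * (norm (op_inv (\<sigma> r o\<^sub>L op_adj (\<sigma> r))) * (norm (S2 (r - s)) * norm (w r)))"
        using True by (auto simp: gir_def w(2) intro!: order_trans[OF norm_blinfun] mult_left_mono norm_blinfun)
      also have "\<dots> \<le> C * (C * (C * D))"
      proof (intro mult_mono)
        show "norm (op_adj (\<sigma> r)) \<le> C" using norm_op_adj_le[of "\<sigma> r"] C(2)[OF r(1)] by linarith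
      qed (use C r D True D0 in auto)
      finally show ?thesis using True by simp
    qed (auto simp: gir_def)
  qed
qed

text \<open>The covariance of \<open>h \<bullet> N r\<close> with the weight. The \<sigma> factors
  cancel against the inverse, S2(r - u) S2(u - s) = S2(r - s) no longer depends on u, and the
  bracket of \<open>Phi\<close> integrates to \<open>ctrl\<close> at r.\<close>

lemma kern_gir:
  assumes r: "r \<in> {s..T}"
  shows "(\<integral>u. kern r h u \<bullet> gir v u \<partial>lborel) = h \<bullet> S2 (r - s) (ctrl A0 B s T v r)"
proof -
  obtain w where w: "continuous_on UNIV w" "\<And>r. Phi S2 A0 B s T v r = S2 (r - s) (w r)"
    "\<And>r. s \<le> r \<Longrightarrow> (w has_integral ctrl A0 B s T v r) {s..r}"
    using Phi_eq[of S2 A0 B s T v] by blast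
  have pt: "kern r h u \<bullet> gir v u = h \<bullet> S2 (r - s) (indicator {s..r} u *\<^sub>R w u)" for u
  proof (cases "u \<in> {s..r}")
    case True
    then have u: "u \<in> {s..T}" "u \<ge> 0" using r s by auto
    have "kern r h u \<bullet> gir v u = op_adj (S2 (r - u)) h \<bullet> (\<sigma> u o\<^sub>L op_adj (\<sigma> u)) (op_inv (\<sigma> u o\<^sub>L op_adj (\<sigma> u)) (Phi S2 A0 B s T v u))"
      using True u by (simp add: kern_def gir_def op_adj_inner)
    also have "\<dots> = op_adj (S2 (r - u)) h \<bullet> Phi S2 A0 B s T v u"
      using H1_inv u by (simp only: op_inv_apply(2))
    also have "\<dots> = h \<bullet> S2 (r - u) (S2 (u - s) (w u))" by (simp add: op_adj_inner w(2))
    also have "\<dots> = h \<bullet> S2 (r - s) (w u)" using S_add(2)[of "r - u" "u - s" "w u"] True by simp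
    finally show ?thesis using True by simp
  qed (auto simp: kern_def)
  have c: "continuous_on {s..r} w" by (rule continuous_on_subset[OF w(1)]) auto
  have i: "integrable lborel (\<lambda>u. indicator {s..r} u *\<^sub>R w u)"
    using set_integrable_continuous_Icc[OF c] by (simp add: set_integrable_def)
  have "(\<integral>u. kern r h u \<bullet> gir v u \<partial>lborel) = h \<bullet> (\<integral>u. S2 (r - s) (indicator {s..r} u *\<^sub>R w u) \<partial>lborel)"
    unfolding pt by (intro integral_inner_right integrable_bounded_linear[OF blinfun.bounded_linear_right i])
  also have "(\<integral>u. S2 (r - s) (indicator {s..r} u *\<^sub>R w u) \<partial>lborel) = S2 (r - s) (\<integral>u. indicator {s..r} u *\<^sub>R w u \<partial>lborel)"
    by (rule integral_bounded_linear[OF blinfun.bounded_linear_right i])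
  also have "(\<integral>u. indicator {s..r} u *\<^sub>R w u \<partial>lborel) = integral {s..r} w"
    using set_lebesgue_integral_eq_integral_Icc[OF c] by (simp add: set_lebesgue_integral_def)
  also have "integral {s..r} w = ctrl A0 B s T v r" using w(3)[of r] r by (simp add: integral_unique)
  finally show ?thesis .
qed

text \<open>The covariance of \<open>k \<bullet> \<xi>\<close> with the weight, component by
  component: averaging over r and the identity for \<open>ctrl\<close> give the first component of
  the flow, and the value of \<open>ctrl\<close> at T gives the second.\<close>

lemma Gk_gir: "(\<integral>u. Gk k u \<bullet> gir v u \<partial>lborel) = k \<bullet> flow v"
proof -
  obtain D where D: "\<And>u. norm (gir v u) \<le> D * indicator {s..T} u" using gir_facts(2) by blast
  obtain C where C: "\<And>r u. norm (G (fst k) r u) \<le> C * (indicator {s..T} r * indicator {s..T} u)"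
    using G_bounded[of "fst k"] by blast
  obtain C1 where C1: "\<And>u. norm (Gbar (fst k) u) \<le> C1 * indicator {s..T} u" using Gbar_facts(3) by blast
  have sT: "s \<le> T" using s by simp
  let ?c = "\<lambda>r. op_exp ((r - s) *\<^sub>R A0) (B (ctrl A0 B s T v r))"
  have cc: "continuous_on {s..T} ?c" unfolding ctrl_def using s
    by (intro continuous_intros continuous_on_op_exp_shift) auto
  have "(\<integral>u. Gbar (fst k) u \<bullet> gir v u \<partial>lborel) = (\<integral>r. (\<integral>u. G (fst k) r u \<bullet> gir v u \<partial>lborel) \<partial>lborel)"
    unfolding Gbar_def by (rule Fubini_inner_bounded_support[OF G_joint C gir_facts(1) D sT, symmetric])
  also have "\<dots> = (\<integral>r. fst k \<bullet> S1 (T - s) (indicator {s..T} r *\<^sub>R ?c r) \<partial>lborel)"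
  proof (intro Bochner_Integration.integral_cong refl)
    fix r
    show "(\<integral>u. G (fst k) r u \<bullet> gir v u \<partial>lborel) = fst k \<bullet> S1 (T - s) (indicator {s..T} r *\<^sub>R ?c r)"
    proof (cases "r \<in> {s..T}")
      case True
      then show ?thesis by (simp add: G_def kern_gir dual_inner S1_B_S2)
    qed (simp add: G_zero)
  qed
  also have "\<dots> = fst k \<bullet> S1 (T - s) (integral {s..T} ?c)"
  proof -
    have i: "integrable lborel (\<lambda>r. indicator {s..T} r *\<^sub>R ?c r)"
      using set_integrable_continuous_Icc[OF cc] by (simp add: set_integrable_def)
    have "(\<integral>r. fst k \<bullet> S1 (T - s) (indicator {s..T} r *\<^sub>R ?c r) \<partial>lborel) = fst k \<bullet> (\<integral>r. S1 (T - s) (indicator {s..T} r *\<^sub>R ?c r) \<partial>lborel)"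
      by (intro integral_inner_right integrable_bounded_linear[OF blinfun.bounded_linear_right i])
    also have "(\<integral>r. S1 (T - s) (indicator {s..T} r *\<^sub>R ?c r) \<partial>lborel) = S1 (T - s) (\<integral>r. indicator {s..T} r *\<^sub>R ?c r \<partial>lborel)"
      by (rule integral_bounded_linear[OF blinfun.bounded_linear_right i])
    also have "(\<integral>r. indicator {s..T} r *\<^sub>R ?c r \<partial>lborel) = integral {s..T} ?c"
      using set_lebesgue_integral_eq_integral_Icc[OF cc] by (simp add: set_lebesgue_integral_def)
    finally show ?thesis .
  qed
  also have "\<dots> = fst k \<bullet> fst (flow v)" by (simp add: ctrl_identity[OF H2_inv s(2)] flow_def)
  finally have 1: "(\<integral>u. Gbar (fst k) u \<bullet> gir v u \<partial>lborel) = fst k \<bullet> fst (flow v)" .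
  have 2: "(\<integral>u. kern T (snd k) u \<bullet> gir v u \<partial>lborel) = snd k \<bullet> snd (flow v)"
    using s by (subst kern_gir) (auto simp: ctrl_endpoint flow_def)
  obtain K where "K \<ge> 0" and K: "\<And>r h u. r \<le> T \<Longrightarrow> norm (kern r h u) \<le> K * norm h * indicator {s..T} u"
    using kern_bounded by blast
  have int: "integrable lborel (\<lambda>u. f u \<bullet> gir v u)"
    if f: "f \<in> borel_measurable borel" "\<And>u. norm (f u) \<le> L * indicator {s..T} u" for f L
  proof (rule integrableI_bounded_set[where A = "{s..T}" and B = "L * D"])
    show "(\<lambda>u. f u \<bullet> gir v u) \<in> borel_measurable lborel" using f(1) gir_facts(1)[of v] by simp
    show "AE u in lborel. u \<in> {s..T} \<longrightarrow> norm (f u \<bullet> gir v u) \<le> L * D"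
    proof (intro AE_I2 impI)
      fix u assume u: "u \<in> {s..T}"
      have "norm (f u \<bullet> gir v u) \<le> norm (f u) * norm (gir v u)" using Cauchy_Schwarz_ineq2 by simp
      also have "\<dots> \<le> L * D" using f(2)[of u] D[of u] u by (intro mult_mono) (auto intro: order_trans[OF norm_ge_zero])
      finally show "norm (f u \<bullet> gir v u) \<le> L * D" .
    qed
    show "AE u in lborel. u \<notin> {s..T} \<longrightarrow> f u \<bullet> gir v u = 0" by (auto simp: gir_def intro!: AE_I2)
  qed (use sT in auto)
  have "(\<integral>u. Gk k u \<bullet> gir v u \<partial>lborel) = (\<integral>u. Gbar (fst k) u \<bullet> gir v u \<partial>lborel) + (\<integral>u. kern T (snd k) u \<bullet> gir v u \<partial>lborel)"
    unfolding Gk_def inner_add_left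
    by (rule Bochner_Integration.integral_add[OF int[OF Gbar_facts(2) C1] int[OF kern_measurable K]]) simp
  then show ?thesis unfolding 1 2 by (simp add: inner_prod_def)
qed

text \<open>The Wiener integral of \<open>gir v\<close> and the noise \<xi> are jointly Gaussian
  with covariance \<open>flow v\<close>, so the abstract shift formula differentiates the
  expectation of \<open>f\<close> at
  \<open>flow z + \<epsilon> *\<^sub>R flow v + \<xi> \<omega>\<close>.\<close>

lemma bismut_formula:
  assumes f [measurable]: "f \<in> borel_measurable borel" and f_bdd: "\<exists>C. \<forall>z. \<bar>f z\<bar> \<le> C"
  shows "\<exists>Z. ((\<lambda>\<epsilon>. P0 M S1 S2 B N s T f (z + \<epsilon> *\<^sub>R v)) has_real_derivative
             (\<integral>\<omega>. f (Xsol S1 S2 B N s T z \<omega>, Ysol S2 N s T z \<omega>) * Z \<omega> \<partial>M)) (at 0)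
           \<and> wiener_int M W (gir v) Z"
proof -
  obtain C where C: "\<And>z. \<bar>f z\<bar> \<le> C" using f_bdd by blast
  obtain D where D: "\<And>u. norm (gir v u) \<le> D * indicator {s..T} u" using gir_facts(2) by blast
  have sT: "s \<le> T" using s by simp
  have gm [measurable]: "gir v \<in> borel_measurable borel" by (rule gir_facts)
  have gfin: "(\<integral>\<^sup>+u. ennreal ((norm (gir v u))\<^sup>2) \<partial>lborel) < \<infinity>"
    by (rule nn_integral_norm_power2_bounded_support_finite[OF D sT])
  have "\<exists>Z. wiener_int M W (gir v) Z"
    using s by (intro wiener_int_exists[OF W gm gfin]) (auto simp: gir_def)
  then obtain Z where Z: "wiener_int M W (gir v) Z" by blast
  have Zm [measurable]: "Z \<in> borel_measurable M" using Z by (simp add: wiener_int_def)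
  define q where "q = (\<integral>u. (norm (gir v u))\<^sup>2 \<partial>lborel)"
  define p where "p k = (\<integral>u. (norm (Gk k u))\<^sup>2 \<partial>lborel)" for k
  have kfin: "(\<integral>\<^sup>+u. ennreal ((norm (Gk k u))\<^sup>2) \<partial>lborel) < \<infinity>" for k
  proof -
    obtain L where "\<And>u. norm (Gk k u) \<le> L * indicator {s..T} u" using Gk_bounded[of k] by blast
    then show ?thesis by (rule nn_integral_norm_power2_bounded_support_finite[OF _ sT])
  qed
  have char: "(\<integral>\<omega>. cis (k \<bullet> \<xi> \<omega> + b * Z \<omega>) \<partial>M) = complex_of_real (exp (- (p k + 2 * b * (k \<bullet> flow v) + b\<^sup>2 * q) / 2))" for k b
  proof -
    have i: "integrable lborel (\<lambda>u. (norm (Gk k u))\<^sup>2)" "integrable lborel (\<lambda>u. (norm (gir v u))\<^sup>2)"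
      using kfin gfin by (auto simp: integrable_norm_power2_iff)
    have ii: "integrable lborel (\<lambda>u. Gk k u \<bullet> gir v u)"
    proof (rule Bochner_Integration.integrable_bound[OF Bochner_Integration.integrable_add[OF i]], simp, rule AE_I2)
      fix u
      have "\<bar>Gk k u \<bullet> gir v u\<bar> \<le> norm (Gk k u) * norm (gir v u)" by (rule Cauchy_Schwarz_ineq2)
      moreover have "2 * (norm (Gk k u) * norm (gir v u)) \<le> (norm (Gk k u))\<^sup>2 + (norm (gir v u))\<^sup>2"
        using sum_squares_bound[of "norm (Gk k u)" "norm (gir v u)"] by simp
      moreover have "0 \<le> norm (Gk k u) * norm (gir v u)" by simp
      ultimately have "\<bar>Gk k u \<bullet> gir v u\<bar> \<le> (norm (Gk k u))\<^sup>2 + (norm (gir v u))\<^sup>2" by linarith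
      then show "norm (Gk k u \<bullet> gir v u) \<le> norm ((norm (Gk k u))\<^sup>2 + (norm (gir v u))\<^sup>2)" by simp
    qed
    have "(\<integral>u. (norm (1 *\<^sub>R Gk k u + b *\<^sub>R gir v u))\<^sup>2 \<partial>lborel) = (\<integral>u. (norm (Gk k u))\<^sup>2 + 2 * b * (Gk k u \<bullet> gir v u) + b\<^sup>2 * (norm (gir v u))\<^sup>2 \<partial>lborel)"
    proof (intro Bochner_Integration.integral_cong refl)
      fix u show "(norm (1 *\<^sub>R Gk k u + b *\<^sub>R gir v u))\<^sup>2 = (norm (Gk k u))\<^sup>2 + 2 * b * (Gk k u \<bullet> gir v u) + b\<^sup>2 * (norm (gir v u))\<^sup>2"
        unfolding power2_norm_eq_inner by (simp add: inner_simps inner_commute power2_eq_square algebra_simps)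
    qed
    also have "\<dots> = p k + 2 * b * (k \<bullet> flow v) + b\<^sup>2 * q"
      using i ii by (simp add: p_def q_def Gk_gir)
    finally show ?thesis
      using wiener_int_char[OF W Gk_wiener[of k] Z Gk_measurable gm kfin gfin, of 1 1 b] by simp
  qed
  have q0: "q \<ge> 0" by (simp add: q_def)
  \<comment> \<open>The isometry: a weight with vanishing integrand has second moment 0.\<close>
  have Z0: "AE \<omega> in M. Z \<omega> = 0" if "q = 0"
  proof -
    note c = wiener_int_covariance[OF W Z Z gm gm gfin gfin]
    have "integrable M (\<lambda>\<omega>. (Z \<omega>)\<^sup>2)" "(\<integral>\<omega>. (Z \<omega>)\<^sup>2 \<partial>M) = 0"
      using c that[unfolded q_def power2_norm_eq_inner] by (simp_all add: power2_eq_square)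
    then have "AE \<omega> in M. (Z \<omega>)\<^sup>2 = 0" by (subst (asm) integral_nonneg_eq_0_iff_AE) auto
    then show ?thesis by eventually_elim simp
  qed
  \<comment> \<open>The shift formula concerns the centred vector \<xi>; the deterministic part of
    the starting point is absorbed into the test function.\<close>
  define f' where "f' x = f (flow z + x)" for x
  have f' [measurable]: "f' \<in> borel_measurable borel" unfolding f'_def[abs_def] by measurable
  have "((\<lambda>\<epsilon>. \<integral>\<omega>. f' (\<xi> \<omega> + \<epsilon> *\<^sub>R flow v) \<partial>M) has_real_derivative (\<integral>\<omega>. f' (\<xi> \<omega>) * Z \<omega> \<partial>M)) (at 0)"
    by (rule gaussian_shift_derivative[OF prob_space_axioms \<xi>_measurable Zm char q0 Z0 f', of C]) (auto simp: f'_def C)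
  moreover have "(\<integral>\<omega>. f' (\<xi> \<omega> + \<epsilon> *\<^sub>R flow v) \<partial>M) = P0 M S1 S2 B N s T f (z + \<epsilon> *\<^sub>R v)" for \<epsilon>
    unfolding P0_def
  proof (rule integral_cong_AE)
    show "(\<lambda>\<omega>. f (Xsol S1 S2 B N s T (z + \<epsilon> *\<^sub>R v) \<omega>, Ysol S2 N s T (z + \<epsilon> *\<^sub>R v) \<omega>)) \<in> borel_measurable M"
      by (rule measurable_compose[OF solution_measurable f])
    show "AE \<omega> in M. f' (\<xi> \<omega> + \<epsilon> *\<^sub>R flow v) = f (Xsol S1 S2 B N s T (z + \<epsilon> *\<^sub>R v) \<omega>, Ysol S2 N s T (z + \<epsilon> *\<^sub>R v) \<omega>)"
      using solution_eq[of "z + \<epsilon> *\<^sub>R v"] by eventually_elim (simp add: f'_def flow_add_scaleR add_ac)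
  qed measurable
  moreover have "(\<integral>\<omega>. f' (\<xi> \<omega>) * Z \<omega> \<partial>M) = (\<integral>\<omega>. f (Xsol S1 S2 B N s T z \<omega>, Ysol S2 N s T z \<omega>) * Z \<omega> \<partial>M)"
  proof (rule integral_cong_AE)
    show "(\<lambda>\<omega>. f (Xsol S1 S2 B N s T z \<omega>, Ysol S2 N s T z \<omega>) * Z \<omega>) \<in> borel_measurable M"
      by (intro borel_measurable_times measurable_compose[OF solution_measurable f] Zm)
    show "AE \<omega> in M. f' (\<xi> \<omega>) * Z \<omega> = f (Xsol S1 S2 B N s T z \<omega>, Ysol S2 N s T z \<omega>) * Z \<omega>"
      using solution_eq[of z] by eventually_elim (simp add: f'_def)
  qed measurable
  ultimately show ?thesis using Z by (intro exI[of _ Z]) simp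
qed

end

theorem theorem2p1:
  fixes M :: "'w measure"
    and W :: "real \<Rightarrow> 'c::{real_inner, banach, second_countable_topology} \<Rightarrow> 'w \<Rightarrow> real"
    and S1 :: "real \<Rightarrow> ('a::{real_inner, banach, second_countable_topology} \<Rightarrow>\<^sub>L 'a)"
    and S2 :: "real \<Rightarrow> ('b::{real_inner, banach, second_countable_topology} \<Rightarrow>\<^sub>L 'b)"
    and B :: "'b \<Rightarrow>\<^sub>L 'a"
    and \<sigma> :: "real \<Rightarrow> ('c \<Rightarrow>\<^sub>L 'b)"
    and A0 :: "'a \<Rightarrow>\<^sub>L 'a"
    and E :: "'b set" and lam :: "'b \<Rightarrow> real" and \<delta> :: real
    and T s :: real and v :: "'a \<times> 'b" and f :: "'a \<times> 'b \<Rightarrow> real" and x :: 'a and y :: 'b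
    and N :: "real \<Rightarrow> 'w \<Rightarrow> 'b"
  assumes W: "cyl_BM M W"
    and sg1: "c0_semigroup S1" and ba1: "gen_bounded_above S1"
    and sg2: "c0_semigroup S2" and ba2: "gen_bounded_above S2"
    and \<sigma>_meas: "\<sigma> \<in> borel_measurable borel"
    and \<sigma>_bdd: "\<forall>t. \<exists>C. \<forall>r \<in> {0..t}. norm (\<sigma> r) \<le> C"
    and H1_inv: "\<forall>t \<ge> 0. op_invertible (\<sigma> t o\<^sub>L op_adj (\<sigma> t))"
    and H1_bdd: "\<forall>t. \<exists>C. \<forall>r \<in> {0..t}. norm (op_inv (\<sigma> r o\<^sub>L op_adj (\<sigma> r))) \<le> C"
    and H2_inv: "op_invertible (B o\<^sub>L op_adj B)"
    and H2_comm: "\<forall>t \<ge> 0. B o\<^sub>L S2 t = S1 t o\<^sub>L op_exp (t *\<^sub>R A0) o\<^sub>L B"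
    and H3_onb: "(\<forall>e \<in> E. norm e = 1) \<and> (\<forall>e \<in> E. \<forall>e' \<in> E. e \<noteq> e' \<longrightarrow> e \<bullet> e' = 0)
                 \<and> closure (span E) = UNIV"
    and H3_eig: "\<forall>e \<in> E. 0 < lam e \<and> sg_gen S2 e (- (lam e *\<^sub>R e))"
    and H3_sum: "0 < \<delta>" "\<delta> < 1" "(\<lambda>e. lam e powr (- (1 - \<delta>))) summable_on E"
    and T: "0 < T" and s: "0 \<le> s" "s < T"
    and f_meas: "f \<in> borel_measurable borel" and f_bdd: "\<exists>C. \<forall>z. \<bar>f z\<bar> \<le> C"
    and N: "stoch_conv M W S2 \<sigma> s N"
  shows "\<exists>D Z. ((\<lambda>\<epsilon>. P0 M S1 S2 B N s T f ((x, y) + \<epsilon> *\<^sub>R v)) has_real_derivative D) (at 0)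
           \<and> wiener_int M W (\<lambda>r. if r \<in> {s..T}
                 then op_adj (\<sigma> r) (op_inv (\<sigma> r o\<^sub>L op_adj (\<sigma> r)) (Phi S2 A0 B s T v r)) else 0) Z
           \<and> D = (\<integral>\<omega>. f (Xsol S1 S2 B N s T (x, y) \<omega>, Ysol S2 N s T (x, y) \<omega>) * Z \<omega> \<partial>M)"
proof -
  interpret D: degenerate_linear_SDE M W S1 S2 B \<sigma> A0 E lam \<delta> T s N
    by (rule degenerate_linear_SDE.intro[OF W sg1 sg2 \<sigma>_meas \<sigma>_bdd H1_inv H1_bdd H2_inv H2_comm
      H3_onb[THEN conjunct1] H3_onb[THEN conjunct2, THEN conjunct1] H3_onb[THEN conjunct2, THEN conjunct2]
      H3_eig H3_sum s N])
  obtain Z where "((\<lambda>\<epsilon>. P0 M S1 S2 B N s T f ((x, y) + \<epsilon> *\<^sub>R v)) has_real_derivative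
      (\<integral>\<omega>. f (Xsol S1 S2 B N s T (x, y) \<omega>, Ysol S2 N s T (x, y) \<omega>) * Z \<omega> \<partial>M)) (at 0)"
    "wiener_int M W (D.gir v) Z"
    using D.bismut_formula[OF f_meas f_bdd, of "(x, y)" v] by blast
  then show ?thesis unfolding D.gir_def[abs_def] by blast
qed

end
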